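(* Suppose that $\mathbb{P}\big(\sum_{i=0}^{b-1}W_i=1\big)=1$. (1) If there exists $p>1$ such that $\varphi_W(p)>0$, then: (a) $(F_n)_{n\ge 1}$ converges uniformly on $[0,1]$, almost surely and in $L^p$ norm (i.e. $\mathbb{E}(\|F_n-F\|_\infty^p)\to0$), as $n\to\infty$, to a function $F=F_W$, which is nondecreasing if $W\ge0$ (all components nonnegative); moreover, almost surely, $F$ is $\gamma$-Hölder continuous for all $\gamma\in\big(0,\max_{q\in(1,p]}\varphi_W(q)/q\big)$; (b) with $S_i(t)=(t+i)/b$, there are random functions $F_0,\dots,F_{b-1}$, each distributed like $F$, such that $W=W(\varnothing),F_0,\dots,F_{b-1}$ are independent and, almost surely, for every $0\le i\le b-1$ and every $t\in[i/b,(i+1)/b]$, $F(t)=F(i/b)+W_iF_i(S_i^{-1}(t))$. (2) (Critical case.) The condition $\lim_{p\to\infty}\varphi_W(p)=0$ is equivalent to the conjunction of $\mathbb{P}(\forall\,0\le i\le b-1,\ |W_i|\le 1)=1$ and $\sum_{i=0}^{b-1}\mathbb{P}(|W_i|=1)=1$. Suppose that this condition holds. Suppose also that $\mathbb{P}(\#\{i: |W_i|=1\}=1)<1$ (in particular $\varphi_W$ is then increasing and $\varphi_W(p)<0$ for all $p>1$), and that there exists $\gamma\in(0,1)$ such that, with probability 1, for each $0\le i\le b-1$ one of the two following properties holds: $$\text{either } |W_i|\le\gamma,\qquad\text{or } |W_i|=1 \text{ and } \Big(\sum_{k=0}^{i-1}W_k,\ \sum_{k=0}^{i}W_k\Big)\in\{(0,1),(1,0)\}.$$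 Then, with probability 1, $(F_n)_{n\ge1}$ converges uniformly to a limit $F=F_W$ which is not uniformly Hölder (it is $\alpha$-Hölder continuous on $[0,1]$ for no $\alpha>0$), and $F$ satisfies the scaling property (b) of part (1).
   Context: Fix an integer $b\ge 2$, let $\mathscr{A}=\{0,\dots,b-1\}$ and let $\mathscr{A}^*=\bigcup_{n\ge 0}\mathscr{A}^n$ be the set of finite words ($\mathscr{A}^0=\{\varnothing\}$). Let $W=(W_0,\dots,W_{b-1})$ be a $\mathbb{C}^b$-valued random vector with integrable components satisfying $\mathbb{E}\big(\sum_{i=0}^{b-1}W_i\big)=1$, and let $(W(w))_{w\in\mathscr{A}^*}$ be a family of independent copies of $W$ (with $W$ identified with $W(\varnothing)$). For $n\ge1$ and $t\in[0,1]$ define $$F_n(t)=F_{W,n}(t)=\int_0^t b^n\prod_{k=1}^n W_{u_k}(u|k-1)\,\mathrm{d}u,$$ where a non $b$-adic point $u=\sum_{k\ge1}u_kb^{-k}$ is identified with the infinite word $u_1u_2\cdots$ of its $b$-adic digits, $u|k=u_1\cdots u_k$ and $u|0=\varnothing$. For $p\in\mathbb{R}_+$ let $\varphi_W(p)=-\log_b\mathbb{E}\big(\sum_{i=0}^{b-1}|W_i|^p\big)$ (possibly $-\infty$). $\|f\|_\infty=\sup_{t\in[0,1]}|f(t)|$. Empty sums are $0$. *)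

theory Defs
  imports "HOL-Probability.Probability"
begin

text \<open>
  The weights form a family \<open>V\<close> with \<open>V w \<omega> i\<close> the \<open>i\<close>-th component (\<open>i < b\<close>) of the random
  vector attached to the word \<open>w\<close>. A vector in \<open>\<complex>\<^sup>b\<close> is an element of the product
  space \<open>weight_space b\<close>, i.e. a function on \<open>{..<b}\<close> that is \<open>undefined\<close> elsewhere.
\<close>

definition weight_space :: "nat \<Rightarrow> (nat \<Rightarrow> complex) measure" where
  "weight_space b = Pi\<^sub>M {..<b} (\<lambda>_. borel)"

text \<open>The digits are those of the expansion not ending in \<open>b - 1\<close> repeated; on the countable set of
  \<open>b\<close>-adic points this choice has no influence on the integrals below.\<close>

definition digit :: "nat \<Rightarrow> real \<Rightarrow> nat \<Rightarrow> nat" where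
  "digit b u k = nat (\<lfloor>real b ^ k * u\<rfloor> mod int b)"

definition prefix_word :: "nat \<Rightarrow> real \<Rightarrow> nat \<Rightarrow> nat list" where
  "prefix_word b u k = map (digit b u) [1..<Suc k]"

definition cascade ::
    "nat \<Rightarrow> (nat list \<Rightarrow> 'a \<Rightarrow> nat \<Rightarrow> complex) \<Rightarrow> nat \<Rightarrow> 'a \<Rightarrow> real \<Rightarrow> complex" where
  "cascade b V n \<omega> t =
     (LINT u:{0..t}|lborel. of_nat b ^ n * (\<Prod>k=1..n. V (prefix_word b u (k - 1)) \<omega> (digit b u k)))"

text \<open>The expectation is taken in \<^typ>\<open>ennreal\<close>, so it is always meaningful and the function
  is \<open>-\<infinity>\<close> exactly where it is infinite. Note that \<open>0 powr p = 0\<close> also for \<open>p = 0\<close>.\<close>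

definition phi :: "'a measure \<Rightarrow> nat \<Rightarrow> ('a \<Rightarrow> nat \<Rightarrow> complex) \<Rightarrow> real \<Rightarrow> ereal" where
  "phi M b W p =
     (let m = \<integral>\<^sup>+\<omega>. (\<Sum>i<b. ennreal (cmod (W \<omega> i) powr p)) \<partial>M in
      if m = \<infinity> then -\<infinity> else if m = 0 then \<infinity> else ereal (- log (real b) (enn2real m)))"

definition holder_on :: "real \<Rightarrow> real set \<Rightarrow> (real \<Rightarrow> complex) \<Rightarrow> bool" where
  "holder_on \<gamma> S f \<longleftrightarrow> (\<exists>C. \<forall>s\<in>S. \<forall>t\<in>S. cmod (f s - f t) \<le> C * \<bar>s - t\<bar> powr \<gamma>)"

definition sup_norm :: "(real \<Rightarrow> complex) \<Rightarrow> real" where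
  "sup_norm f = (SUP t\<in>{0..1}. cmod (f t))"

text \<open>Random functions are random elements of the continuous functions on \<open>[0,1]\<close>. Measurability,
  laws and independence refer to the \<open>\<sigma>\<close>-algebra generated by the evaluations, which on continuous
  functions is the Borel \<open>\<sigma>\<close>-algebra of the sup norm.\<close>

definition path_space :: "(real \<Rightarrow> complex) measure" where
  "path_space = Pi\<^sub>M {0..1} (\<lambda>_. borel)"

definition random_function :: "'a measure \<Rightarrow> ('a \<Rightarrow> real \<Rightarrow> complex) \<Rightarrow> bool" where
  "random_function M F \<longleftrightarrow>
     F \<in> M \<rightarrow>\<^sub>M path_space \<and> (\<forall>\<omega>\<in>space M. continuous_on {0..1} (F \<omega>))"

definition similitude :: "nat \<Rightarrow> nat \<Rightarrow> real \<Rightarrow> real" where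
  "similitude b i t = (t + real i) / real b"

text \<open>Joint independence of \<open>W, G 0, \<dots>, G (b - 1)\<close> is stated for the generated \<open>\<sigma>\<close>-algebras because
  these random elements have values in different types; \<open>None\<close> is the index of \<open>W\<close>.\<close>

definition scaling_property ::
    "'a measure \<Rightarrow> nat \<Rightarrow> ('a \<Rightarrow> nat \<Rightarrow> complex) \<Rightarrow> ('a \<Rightarrow> real \<Rightarrow> complex) \<Rightarrow> bool" where
  "scaling_property M b W F \<longleftrightarrow>
     (\<exists>G :: nat \<Rightarrow> 'a \<Rightarrow> real \<Rightarrow> complex.
        (\<forall>i<b. random_function M (G i) \<and> distr M path_space (G i) = distr M path_space F) \<and>
        prob_space.indep_sets M
          (\<lambda>j. case j of
                 None \<Rightarrow> sets (vimage_algebra (space M) W (weight_space b))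
               | Some i \<Rightarrow> sets (vimage_algebra (space M) (G i) path_space))
          (insert None (Some ` {..<b})) \<and>
        (AE \<omega> in M. \<forall>i<b. \<forall>t\<in>{real i / real b..(real i + 1) / real b}.
           F \<omega> t = F \<omega> (real i / real b) + W \<omega> i * G i \<omega> (inv (similitude b i) t)))"

end

theory Submission
  imports Defs
begin

text \<open>
  Fix an outcome. The weights are then a function on the \<open>b\<close>-adic tree of words, and on the cell of a
  word \<open>v\<close> of length \<open>n\<close> the function \<open>F n\<close> is affine with increment \<open>Q v\<close>, the product of the weights
  along \<open>v\<close>. Cutting at the first digit gives the recursion
  \<open>F (n + 1) ((s + i) / b) = (\<Sum>k<i. W k) + W i * F\<^sup>i n s\<close>, where \<open>F\<^sup>i\<close> is built from the tree of the
  descendants of \<open>i\<close>. Since the weights at each vertex sum to 1, \<open>F n\<close> and \<open>F (n + m)\<close> agree at the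
  end points of the cells of generation \<open>n\<close>, whence \<open>sup \<bar>F (n + m) - F n\<bar>\<close> is at most the maximum
  over the words \<open>v\<close> of length \<open>n\<close> of \<open>\<bar>Q v\<bar> * sup \<bar>F\<^sup>v m - id\<bar>\<close> (\<open>tree_cascade_diff_bound\<close>).
  Everything else is a matter of the size of the products \<open>Q v\<close>.

  If the moment \<open>m = E (\<Sum>i. \<bar>W i\<bar>\<^sup>p)\<close> is finite, the sum over the generation \<open>n\<close> of
  \<open>(\<bar>Q v\<bar> (1 + \<Sum>i. \<bar>W\<^sub>i(v)\<bar>))\<^sup>p\<close> has expectation \<open>m\<^sup>n\<close> times a finite constant. For \<open>m < \<theta>\<^sup>p\<close> the
  series of these sums with the weights \<open>\<theta>\<close> to the power \<open>- p n\<close> has a finite expectation, and its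
  tail \<open>T\<close> from generation \<open>N\<close> on bounds all terms with \<open>n \<ge> N\<close> by \<open>T\<close> to the power \<open>1 / p\<close> times
  \<open>\<theta>\<^sup>n\<close> (\<open>level_tail_bound\<close>). With \<open>\<theta> < 1\<close> this yields uniform convergence almost surely; as the
  expectation of \<open>T\<close> tends to 0, it yields convergence in \<open>L\<^sup>p\<close> too. With \<open>\<theta> = b powr - \<gamma>\<close> it yields
  Hoelder continuity of order \<open>\<gamma>\<close>, because \<open>F n\<close> has Lipschitz constant \<open>b\<^sup>n max \<bar>Q v\<bar>\<close>. The scaling
  property is the limit of the recursion: the root weights and the trees of descendants of the \<open>b\<close>
  children are functions of disjoint blocks of the independent weights, and each of these trees has
  the law of the whole tree.

  In the critical case the vertices reached through weights of modulus 1 form a branching process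
  with mean 1 that is not degenerate. Let \<open>u\<close> be the probability that in every generation some \<open>\<bar>Q v\<bar>\<close>
  exceeds a level, chosen such that a first weight of modulus at most \<open>\<gamma>\<close> is fatal. Then a child with
  weight of modulus 1 must have a tree of descendants with the same property, and the Bonferroni
  inequality gives \<open>u \<le> u - \<rho> u\<^sup>2\<close>, where \<open>\<rho> > 0\<close> is the probability that two given root weights have
  modulus 1. So \<open>u = 0\<close>, and by induction over the levels \<open>\<gamma>\<^sup>k\<close> the maximum of \<open>\<bar>Q v\<bar>\<close> over a generation
  tends to 0 (\<open>no_survival\<close>). No rate comes with it, but the hypothesis on the partial sums bounds all
  \<open>F m\<close> by one constant (\<open>tree_cascade_critical_bound\<close>), and this suffices for uniform convergence.

  A limit that is Hoelder continuous of order \<open>\<alpha>\<close> would make \<open>K = sup \<bar>Q v\<bar> \<beta> ^ length v\<close> finite, where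
  \<open>\<beta> = b powr \<alpha>\<close>. The probabilities \<open>u n\<close> of \<open>K > \<beta>\<^sup>n\<close> satisfy
  \<open>u (n + 1) \<ge> u n + \<eta> * u (n + l) - b\<^sup>2 * (u n)\<^sup>2\<close>: the first term comes from the children
  with weight of modulus 1, whose mean number is 1, the second from a child whose weight has modulus
  strictly between 0 and 1, and the last bounds the overlaps. If \<open>u\<close> tended to 0, monotonicity would give \<open>\<eta> * u (n + l) \<le> b\<^sup>2 * (u n)\<^sup>2\<close>, whereas the recursion
  keeps \<open>u (n + l)\<close> above a fixed multiple of \<open>u n\<close> (\<open>no_slowly_decaying_sequence\<close>). Hence \<open>K\<close> is infinite
  with positive probability, and a zero-one law makes this probability 1 (\<open>unbounded_zero_one\<close>).
\<close>

section \<open>Cascades on a deterministic tree of weights\<close>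

definition words :: "nat \<Rightarrow> nat \<Rightarrow> nat list set" where
  "words b n = {v \<in> lists {..<b}. length v = n}"

definition subtree :: "nat list \<Rightarrow> (nat list \<Rightarrow> 'c) \<Rightarrow> nat list \<Rightarrow> 'c" where
  "subtree v x = (\<lambda>w. x (v @ w))"

primrec path_weight :: "nat list \<Rightarrow> (nat list \<Rightarrow> nat \<Rightarrow> complex) \<Rightarrow> complex" where
  "path_weight [] x = 1"
| "path_weight (i # v) x = x [] i * path_weight v (subtree [i] x)"

definition unit_clamp :: "real \<Rightarrow> real" where
  "unit_clamp y = max 0 (min 1 y)"

text \<open>
  The function \<open>cascade\<close> for a fixed tree of weights, with a sum over all children in place of a case distinction
  on the first digit: the child \<open>i\<close> contributes nothing left of its cell and its total increment right of
  it. In this form measurability, continuity and Lipschitz bounds follow by induction termwise.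
\<close>

primrec tree_cascade :: "nat \<Rightarrow> nat \<Rightarrow> (nat list \<Rightarrow> nat \<Rightarrow> complex) \<Rightarrow> real \<Rightarrow> complex" where
  "tree_cascade b 0 x t = of_real t"
| "tree_cascade b (Suc n) x t =
     (\<Sum>i<b. x [] i * tree_cascade b n (subtree [i] x) (unit_clamp (real b * t - real i)))"

lemma subtree_Nil [simp]: "subtree [] x = x"
  by (simp add: subtree_def)

lemma subtree_subtree [simp]: "subtree v (subtree u x) = subtree (u @ v) x"
  by (simp add: subtree_def)

lemma subtree_apply_Nil [simp]: "subtree v x [] = x v"
  by (simp add: subtree_def)

lemma finite_words: "finite (words b n)"
proof -
  have "words b n = {v. set v \<subseteq> {..<b} \<and> length v = n}"
    by (auto simp: words_def lists_eq_set)
  thus ?thesis by (simp add: finite_lists_length_eq)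
qed

lemma words_0 [simp]: "words b 0 = {[]}"
  by (auto simp: words_def)

lemma Cons_in_words [simp]: "i # v \<in> words b (Suc n) \<longleftrightarrow> i < b \<and> v \<in> words b n"
  by (auto simp: words_def)

lemma words_Suc_cases:
  assumes "v \<in> words b (Suc n)"
  obtains i u where "v = i # u" "i < b" "u \<in> words b n"
  using assms by (cases v) (auto simp: words_def)

lemma words_in_lists: "v \<in> words b n \<Longrightarrow> v \<in> lists {..<b}"
  by (simp add: words_def)

lemma words_nonempty: "0 < b \<Longrightarrow> words b n \<noteq> {}"
  by (induction n) (simp, metis Cons_in_words all_not_in_conv)

lemma unit_clamp_range [simp]: "0 \<le> unit_clamp y" "unit_clamp y \<le> 1"
  by (auto simp: unit_clamp_def)

lemma unit_clamp_mono: "s \<le> t \<Longrightarrow> unit_clamp s \<le> unit_clamp t"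
  by (auto simp: unit_clamp_def)

text \<open>
  The increasing functions \<open>t \<mapsto> unit_clamp (b t - i)\<close> add up to \<open>b t\<close>, hence their
  increments add up to \<open>b\<close> times the increment of \<open>t\<close>; this is the factor gained per generation in the
  Lipschitz bound below.
\<close>

lemma sum_unit_clamp: "0 \<le> y \<Longrightarrow> (\<Sum>i<n. unit_clamp (y - real i)) = min y (real n)"
  by (induction n) (auto simp: unit_clamp_def)

lemma tree_cascade_0 [simp]: "tree_cascade b n x 0 = 0"
  by (induction n arbitrary: x) (auto simp: unit_clamp_def)

lemma continuous_on_tree_cascade: "continuous_on S (tree_cascade b n x)"
proof (induction n arbitrary: x S)
  case 0 show ?case by (auto intro!: continuous_intros)
next
  case (Suc n)
  have "continuous_on S (\<lambda>t. tree_cascade b n (subtree [i] x) (unit_clamp (real b * t - real i)))" for i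
    by (rule continuous_on_compose2[OF Suc[of UNIV]]) (auto simp: unit_clamp_def intro!: continuous_intros)
  thus ?case by (auto intro!: continuous_intros)
qed

lemma tree_cascade_cong:
  assumes "\<And>w. w \<in> lists {..<b} \<Longrightarrow> x w = y w"
  shows "tree_cascade b n x t = tree_cascade b n y t"
  using assms
proof (induction n arbitrary: x y t)
  case (Suc n)
  have "tree_cascade b n (subtree [i] x) s = tree_cascade b n (subtree [i] y) s" if "i < b" for i s
    using Suc.prems that by (intro Suc.IH) (auto simp: subtree_def)
  moreover have "x [] = y []" using Suc.prems by simp
  ultimately show ?case by simp
qed simp

text \<open>
  The density of \<open>F n\<close> on the cell of \<open>v\<close> is \<open>b\<^sup>n Q v\<close>. In the induction the root weight is divided out of
  the constant, since the hypothesis bounds only the product over the whole word.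
\<close>

lemma tree_cascade_lipschitz:
  assumes "\<forall>v\<in>words b n. cmod (path_weight v x) \<le> C" "s \<in> {0..1}" "t \<in> {0..1}" "0 < b"
  shows "cmod (tree_cascade b n x s - tree_cascade b n x t) \<le> C * real b ^ n * \<bar>s - t\<bar>"
  using assms
proof (induction n arbitrary: x C s t)
  case 0
  hence "1 \<le> C" by simp
  have "cmod (of_real s - of_real t) = \<bar>s - t\<bar>" by (metis norm_of_real of_real_diff)
  also have "\<dots> \<le> C * \<bar>s - t\<bar>" using \<open>1 \<le> C\<close> mult_right_mono[of 1 C "\<bar>s - t\<bar>"] by simp
  finally show ?case by simp
next
  case (Suc n)
  let ?c = "\<lambda>t i. unit_clamp (real b * t - real i)"
  have C0: "0 \<le> C"
    using Suc.prems(1,4) words_nonempty[of b "Suc n"] by (metis all_not_in_conv norm_ge_zero order_trans)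
  have step: "cmod (x [] i * (tree_cascade b n (subtree [i] x) (?c s i) - tree_cascade b n (subtree [i] x) (?c t i)))
      \<le> C * real b ^ n * \<bar>?c s i - ?c t i\<bar>" if i: "i < b" for i
  proof (cases "x [] i = 0")
    case True thus ?thesis using C0 by simp
  next
    case False
    have "\<forall>v\<in>words b n. cmod (path_weight v (subtree [i] x)) \<le> C / cmod (x [] i)"
    proof
      fix v assume "v \<in> words b n"
      hence "cmod (path_weight (i # v) x) \<le> C" using Suc.prems(1) i by (meson Cons_in_words)
      thus "cmod (path_weight v (subtree [i] x)) \<le> C / cmod (x [] i)"
        using False by (simp add: norm_mult field_simps)
    qed
    from Suc.IH[OF this, of "?c s i" "?c t i"] Suc.prems(4)
    have "cmod (tree_cascade b n (subtree [i] x) (?c s i) - tree_cascade b n (subtree [i] x) (?c t i))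
       \<le> C / cmod (x [] i) * real b ^ n * \<bar>?c s i - ?c t i\<bar>" by simp
    thus ?thesis using False by (simp add: norm_mult pos_le_divide_eq mult.commute mult.left_commute)
  qed
  have clamps: "(\<Sum>i<b. \<bar>?c s i - ?c t i\<bar>) = real b * \<bar>s - t\<bar>"
    if "s \<in> {0..1}" "t \<in> {0..1}" "s \<le> t" for s t
  proof -
    have "real b * s \<le> real b * t" using that by (simp add: mult_left_mono)
    hence "(\<Sum>i<b. \<bar>?c s i - ?c t i\<bar>) = (\<Sum>i<b. ?c t i) - (\<Sum>i<b. ?c s i)"
      unfolding sum_subtractf[symmetric]
      by (intro sum.cong refl) (simp add: unit_clamp_mono abs_of_nonpos)
    also have "\<dots> = real b * t - real b * s"
      using that Suc.prems(4) by (simp add: sum_unit_clamp mult_le_cancel_left1)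
    finally show ?thesis using that by (simp add: abs_if algebra_simps)
  qed
  have clamps': "(\<Sum>i<b. \<bar>?c s i - ?c t i\<bar>) = real b * \<bar>s - t\<bar>"
  proof (cases "s \<le> t")
    case False
    hence "(\<Sum>i<b. \<bar>?c t i - ?c s i\<bar>) = real b * \<bar>t - s\<bar>" using clamps[of t s] Suc.prems by simp
    thus ?thesis by (simp add: abs_minus_commute)
  qed (use clamps Suc.prems in simp)
  have "cmod (tree_cascade b (Suc n) x s - tree_cascade b (Suc n) x t) =
      cmod (\<Sum>i<b. x [] i * (tree_cascade b n (subtree [i] x) (?c s i) - tree_cascade b n (subtree [i] x) (?c t i)))"
    by (simp add: sum_subtractf algebra_simps)
  also have "\<dots> \<le> (\<Sum>i<b. C * real b ^ n * \<bar>?c s i - ?c t i\<bar>)"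
    by (intro order_trans[OF norm_sum] sum_mono step) auto
  also have "\<dots> = C * real b ^ Suc n * \<bar>s - t\<bar>"
    using clamps' by (simp add: sum_distrib_left[symmetric])
  finally show ?case .
qed

lemma sum_nonneg_Reals:
  "(\<And>i. i \<in> A \<Longrightarrow> f i \<in> \<real>\<^sub>\<ge>\<^sub>0) \<Longrightarrow> (\<Sum>i\<in>A. f i) \<in> (\<real>\<^sub>\<ge>\<^sub>0 :: complex set)"
  by (simp add: complex_nonneg_Reals_iff sum_nonneg)

lemma tree_cascade_nonneg_mono:
  assumes "\<And>w i. w \<in> lists {..<b} \<Longrightarrow> i < b \<Longrightarrow> x w i \<in> \<real>\<^sub>\<ge>\<^sub>0" "s \<le> t"
  shows "tree_cascade b n x t - tree_cascade b n x s \<in> \<real>\<^sub>\<ge>\<^sub>0"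
  using assms
proof (induction n arbitrary: x s t)
  case 0 thus ?case by (auto simp: complex_nonneg_Reals_iff)
next
  case (Suc n)
  let ?c = "\<lambda>t i. unit_clamp (real b * t - real i)"
  have "tree_cascade b n (subtree [i] x) (?c t i) - tree_cascade b n (subtree [i] x) (?c s i) \<in> \<real>\<^sub>\<ge>\<^sub>0" if "i < b" for i
    using Suc.prems that
    by (intro Suc.IH) (auto simp: subtree_def intro!: unit_clamp_mono mult_left_mono)
  hence "(\<Sum>i<b. x [] i * (tree_cascade b n (subtree [i] x) (?c t i) - tree_cascade b n (subtree [i] x) (?c s i))) \<in> \<real>\<^sub>\<ge>\<^sub>0"
    using Suc.prems(1)[of "[]"] by (intro sum_nonneg_Reals nonneg_Reals_mult_I) auto
  thus ?case by (simp add: sum_subtractf algebra_simps)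
qed

definition conservative :: "nat \<Rightarrow> (nat list \<Rightarrow> nat \<Rightarrow> complex) \<Rightarrow> bool" where
  "conservative b x \<longleftrightarrow> (\<forall>w\<in>lists {..<b}. (\<Sum>i<b. x w i) = 1)"

lemma conservative_subtree:
  "conservative b x \<Longrightarrow> v \<in> lists {..<b} \<Longrightarrow> conservative b (subtree v x)"
  by (auto simp: conservative_def subtree_def)

lemma conservative_root: "conservative b x \<Longrightarrow> (\<Sum>i<b. x [] i) = 1"
  by (auto simp: conservative_def)

lemma tree_cascade_1:
  assumes "conservative b x"
  shows "tree_cascade b n x 1 = 1"
  using assms
proof (induction n arbitrary: x)
  case (Suc n)
  have "tree_cascade b n (subtree [i] x) (unit_clamp (real b * 1 - real i)) = 1" if "i < b" for i
    using Suc that by (simp add: unit_clamp_def conservative_subtree)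
  thus ?case using conservative_root[OF Suc.prems] by simp
qed simp

lemma tree_cascade_Suc_on_cell:
  assumes "conservative b x" "i < b" "s \<in> {0..1}"
  shows "tree_cascade b (Suc n) x ((s + real i) / real b) =
    (\<Sum>k<i. x [] k) + x [] i * tree_cascade b n (subtree [i] x) s"
proof -
  have "tree_cascade b n (subtree [k] x) (unit_clamp (real b * ((s + real i) / real b) - real k)) =
     (if k < i then 1 else if k = i then tree_cascade b n (subtree [i] x) s else 0)" if k: "k < b" for k
  proof -
    consider "k < i" | "k = i" | "i < k" by linarith
    thus ?thesis
    proof cases
      case 1
      hence "1 \<le> s + real i - real k" using assms(3) by auto
      thus ?thesis using 1 assms k
        by (simp add: unit_clamp_def tree_cascade_1 conservative_subtree)
    next
      case 2 thus ?thesis using assms by (simp add: unit_clamp_def)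
    next
      case 3
      hence "s + real i - real k \<le> 0" using assms(3) by auto
      thus ?thesis using 3 assms by (simp add: unit_clamp_def)
    qed
  qed
  hence "tree_cascade b (Suc n) x ((s + real i) / real b) =
     (\<Sum>k<b. (if k < i then x [] k else 0) + (if k = i then x [] i * tree_cascade b n (subtree [i] x) s else 0))"
    by (auto intro!: sum.cong)
  also have "\<dots> = (\<Sum>k<b. if k < i then x [] k else 0) + x [] i * tree_cascade b n (subtree [i] x) s"
    using assms(2) by (simp add: sum.distrib)
  also have "(\<Sum>k<b. if k < i then x [] k else 0) = (\<Sum>k<i. x [] k)"
    using assms(2) by (intro sum.mono_neutral_cong_right) auto
  finally show ?thesis .
qed

lemma unit_interval_cell:
  assumes "t \<in> {0..1}" "0 < b"
  obtains i s where "i < b" "s \<in> {0..1}" "t = (s + real i) / real b"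
proof (cases "t = 1")
  case True
  show ?thesis using assms by (intro that[of "b - 1" 1]) (auto simp: True)
next
  case False
  let ?i = "nat \<lfloor>real b * t\<rfloor>"
  have "real b * t < real b" "0 \<le> real b * t" using False assms by auto
  hence "?i < b" by (simp add: nat_less_iff floor_less_iff)
  moreover have "real b * t - real ?i \<in> {0..1}"
    using \<open>0 \<le> real b * t\<close> by (auto simp: of_nat_floor)  linarith
  ultimately show ?thesis using assms by (intro that[of ?i "real b * t - real ?i"]) auto
qed

text \<open>
  On the cell of a word \<open>v\<close> of length \<open>n\<close> the difference of \<open>F (n + m)\<close> and \<open>F n\<close> is \<open>Q v\<close> times the
  rescaled difference of \<open>F m\<close> for the descendants of \<open>v\<close> and the identity. All estimates of the speed
  of convergence start here.
\<close>

lemma tree_cascade_diff_bound: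
  assumes "conservative b x" "t \<in> {0..1}" "0 < b"
    and "\<And>v s. v \<in> words b n \<Longrightarrow> s \<in> {0..1} \<Longrightarrow>
          cmod (path_weight v x) * cmod (tree_cascade b m (subtree v x) s - of_real s) \<le> C"
  shows "cmod (tree_cascade b (n + m) x t - tree_cascade b n x t) \<le> C"
  using assms
proof (induction n arbitrary: x C t)
  case 0 thus ?case using "0.prems"(4)[of "[]" t] by simp
next
  case (Suc n)
  obtain i s where i: "i < b" and s: "s \<in> {0..1}" and t: "t = (s + real i) / real b"
    using unit_interval_cell[OF Suc.prems(2,3)] .
  have eq: "tree_cascade b (Suc n + m) x t - tree_cascade b (Suc n) x t =
     x [] i * (tree_cascade b (n + m) (subtree [i] x) s - tree_cascade b n (subtree [i] x) s)"
    using tree_cascade_Suc_on_cell[OF Suc.prems(1) i s] unfolding t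
    by (simp add: algebra_simps del: tree_cascade.simps)
  show ?case
  proof (cases "x [] i = 0")
    case True
    obtain v where "v \<in> words b (Suc n)" using words_nonempty[OF Suc.prems(3)] by blast
    from Suc.prems(4)[OF this s] have "0 \<le> C"
      by (meson mult_nonneg_nonneg norm_ge_zero order_trans)
    thus ?thesis using eq True by simp
  next
    case False
    have "cmod (tree_cascade b (n + m) (subtree [i] x) s - tree_cascade b n (subtree [i] x) s) \<le> C / cmod (x [] i)"
    proof (rule Suc.IH)
      fix v r assume v: "v \<in> words b n" and r: "r \<in> {0..1::real}"
      hence "cmod (path_weight (i # v) x) * cmod (tree_cascade b m (subtree (i # v) x) r - of_real r) \<le> C"
        using Suc.prems(4) i by (meson Cons_in_words)
      thus "cmod (path_weight v (subtree [i] x)) *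
         cmod (tree_cascade b m (subtree v (subtree [i] x)) r - of_real r) \<le> C / cmod (x [] i)"
        using False by (simp add: norm_mult field_simps)
    qed (use Suc.prems i s in \<open>auto intro: conservative_subtree\<close>)
    thus ?thesis using False by (subst eq) (simp add: norm_mult pos_le_divide_eq mult.commute)
  qed
qed

text \<open>
  The case \<open>m = 1\<close> of the factor in \<open>tree_cascade_diff_bound\<close>; it explains the expression
  \<open>1 + (\<Sum>i. \<bar>x v i\<bar>)\<close> that accompanies \<open>Q v\<close> in the moment estimates.
\<close>

lemma tree_cascade_1_level_bound:
  assumes "s \<in> {0..1}"
  shows "cmod (tree_cascade b 1 x s - of_real s) \<le> 1 + (\<Sum>i<b. cmod (x [] i))"
proof -
  have "cmod (tree_cascade b 1 x s) \<le> (\<Sum>i<b. cmod (x [] i) * 1)"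
    by (simp add: norm_mult) (intro order_trans[OF norm_sum] sum_mono, auto simp: norm_mult intro: mult_left_le)
  moreover have "cmod (of_real s) \<le> 1" using assms by simp
  ultimately show ?thesis using norm_triangle_ineq4[of "tree_cascade b 1 x s" "of_real s"] by simp
qed

primrec left_end :: "nat \<Rightarrow> nat list \<Rightarrow> real" where
  "left_end b [] = 0"
| "left_end b (i # v) = (left_end b v + real i) / real b"

lemma left_end_range:
  "v \<in> words b n \<Longrightarrow> 0 \<le> left_end b v \<and> left_end b v + 1 / real b ^ n \<le> 1"
proof (induction n arbitrary: v)
  case 0 thus ?case by simp
next
  case (Suc n)
  then obtain i u where v: "v = i # u" "i < b" "u \<in> words b n" by (elim words_Suc_cases)
  have "1 + real i \<le> real b" using v(2) by linarith
  hence "left_end b u + real i + 1 / real b ^ n \<le> real b"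
    using Suc.IH[OF v(3)] by linarith
  hence "(left_end b u + real i + 1 / real b ^ n) / real b \<le> 1" using v(2) by simp
  moreover have "0 \<le> left_end b u" using Suc.IH[OF v(3)] by blast
  ultimately show ?case using v by (simp add: add_divide_distrib mult.commute)
qed

text \<open>
  From generation \<open>n\<close> on the increment over a cell of generation \<open>n\<close> no longer changes, so it is inherited
  by the limit. This turns regularity of the limit into bounds on \<open>Q v\<close>.
\<close>

lemma tree_cascade_increment_on_cell:
  assumes "conservative b x" "v \<in> words b n" "n \<le> m"
  shows "tree_cascade b m x (left_end b v + 1 / real b ^ n) - tree_cascade b m x (left_end b v) = path_weight v x"
  using assms
proof (induction n arbitrary: v x m)
  case 0 thus ?case by (simp add: tree_cascade_1)
next
  case (Suc n)
  then obtain i u where v: "v = i # u" "i < b" "u \<in> words b n" by (elim words_Suc_cases)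
  obtain m' where m: "m = Suc m'" "n \<le> m'" using Suc.prems(3) by (cases m) auto
  have r: "left_end b u \<in> {0..1}" "left_end b u + 1 / real b ^ n \<in> {0..1}"
    using left_end_range[OF v(3)] zero_le_divide_1_iff[of "real b ^ n"]
    by (auto simp del: zero_le_divide_1_iff intro: order_trans[of _ "left_end b u + 1 / real b ^ n"])
  have eq: "left_end b v + 1 / real b ^ Suc n = (left_end b u + 1 / real b ^ n + real i) / real b"
    by (simp add: v add_divide_distrib)
  have "tree_cascade b m x (left_end b v + 1 / real b ^ Suc n) - tree_cascade b m x (left_end b v) =
     x [] i * (tree_cascade b m' (subtree [i] x) (left_end b u + 1 / real b ^ n)
       - tree_cascade b m' (subtree [i] x) (left_end b u))"
    unfolding eq unfolding m v(1) left_end.simps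
    by (simp only: tree_cascade_Suc_on_cell[OF Suc.prems(1) v(2) r(1)] tree_cascade_Suc_on_cell[OF Suc.prems(1) v(2) r(2)])
      (simp add: right_diff_distrib)
  also have "\<dots> = path_weight v x"
    using Suc.IH[OF _ v(3) m(2), of "subtree [i] x"] conservative_subtree[OF Suc.prems(1), of "[i]"] v by simp
  finally show ?case .
qed

text \<open>
  The integrand in the definition of \<open>cascade\<close>, for a fixed tree of weights.
\<close>

definition cell_density :: "nat \<Rightarrow> nat \<Rightarrow> (nat list \<Rightarrow> nat \<Rightarrow> complex) \<Rightarrow> real \<Rightarrow> complex" where
  "cell_density b n x u =
     of_nat b ^ n * (\<Prod>k=1..n. x (prefix_word b u (k - 1)) (digit b u k))"

context
  fixes b i :: nat and u :: real
  assumes i: "i < b" and u: "0 \<le> real b * u - real i" "real b * u - real i < 1"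
begin

lemma digit_1: "digit b u 1 = i"
proof -
  have "\<lfloor>real b * u\<rfloor> = int i" using u by (simp add: floor_eq_iff)
  thus ?thesis using i by (simp add: digit_def nat_mod_distrib)
qed

lemma digit_Suc: "1 \<le> k \<Longrightarrow> digit b u (Suc k) = digit b (real b * u - real i) k"
proof -
  assume "1 \<le> k"
  then obtain j where k: "k = Suc j" by (cases k) auto
  have "real b ^ Suc k * u = real b ^ k * (real b * u - real i) + of_int (int b * (int b ^ j * int i))"
    by (simp add: k algebra_simps)
  hence "\<lfloor>real b ^ Suc k * u\<rfloor> = \<lfloor>real b ^ k * (real b * u - real i)\<rfloor> + int b * (int b ^ j * int i)"
    by (metis floor_add_int)
  thus ?thesis by (simp add: digit_def)
qed

lemma prefix_word_Suc: "prefix_word b u (Suc k) = i # prefix_word b (real b * u - real i) k"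
proof -
  have "prefix_word b u (Suc k) = digit b u 1 # map (digit b u) (map Suc [1..<Suc k])"
    unfolding prefix_word_def by (simp add: upt_conv_Cons map_Suc_upt del: upt_Suc)
  also have "map (digit b u) (map Suc [1..<Suc k]) = prefix_word b (real b * u - real i) k"
    unfolding prefix_word_def map_map o_def by (rule map_cong[OF refl]) (auto simp: digit_Suc)
  finally show ?thesis by (simp only: digit_1)
qed

lemma cell_density_Suc:
  "cell_density b (Suc n) x u =
     of_nat b * x [] i * cell_density b n (subtree [i] x) (real b * u - real i)"
proof -
  let ?t = "\<lambda>k. x (prefix_word b u (k - 1)) (digit b u k)"
  have "(\<Prod>k=1..Suc n. ?t k) = ?t 1 * (\<Prod>k=1..n. ?t (Suc k))"
    by (subst prod.atLeast_Suc_atMost) (simp_all add: prod.shift_bounds_cl_Suc_ivl del: prod.cl_ivl_Suc)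
  also have "?t 1 = x [] i" by (simp add: digit_1[simplified] prefix_word_def)
  also have "(\<Prod>k=1..n. ?t (Suc k)) =
     (\<Prod>k=1..n. subtree [i] x (prefix_word b (real b * u - real i) (k - 1)) (digit b (real b * u - real i) k))"
  proof (rule prod.cong[OF refl])
    fix k assume k: "k \<in> {1..n}"
    then obtain j where "k = Suc j" by (cases k) auto
    thus "?t (Suc k) = subtree [i] x (prefix_word b (real b * u - real i) (k - 1)) (digit b (real b * u - real i) k)"
      using k by (simp add: digit_Suc prefix_word_Suc subtree_def)
  qed
  finally show ?thesis by (simp add: cell_density_def)
qed

end

text \<open>
  The change of variables \<open>y = b u - i\<close> on each cell of generation 1 turns the integral into the recursion
  of \<open>tree_cascade\<close>. Integrability is part of the induction: it splits the integral of the sum over the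
  cells, and the induction provides it without a measurability argument for the digits.
\<close>

lemma cell_density_integral:
  assumes "0 < b"
  shows "integrable lborel (\<lambda>u. indicator {0..<1} u *\<^sub>R cell_density b n x u)"
    and "t \<in> {0..1} \<Longrightarrow>
      (LINT u|lborel. indicator {0..t} u *\<^sub>R (indicator {0..<1} u *\<^sub>R cell_density b n x u)) = tree_cascade b n x t"
proof (induction n arbitrary: x t)
  case 0
  {
    case 1 show ?case by (simp add: cell_density_def)
  next
    case 2
    have "(LINT u|lborel. indicator {0..t} u *\<^sub>R (indicator {0..<1} u *\<^sub>R cell_density b 0 x u)) =
      (LINT u|lborel. indicator {0..t} u *\<^sub>R (1::complex))"
      using 2 AE_lborel_singleton[of 1]
      by (intro integral_cong_AE) (auto simp: cell_density_def indicator_def)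
    thus ?case using 2 by (simp add: scaleR_conv_of_real)
  }
next
  case (Suc n)
  let ?h = "\<lambda>x i u. indicator {0..<1} u *\<^sub>R cell_density b n (subtree [i] x) u"
  have split: "indicator {0..<1} u *\<^sub>R cell_density b (Suc n) x u =
     (\<Sum>i<b. of_nat b * x [] i * ?h x i (- real i + real b * u))" for x u
  proof (cases "u \<in> {0..<1}")
    case True
    let ?i = "nat \<lfloor>real b * u\<rfloor>"
    have "real b * u < real b" "0 \<le> real b * u" using True assms by auto
    hence i: "?i < b" by (simp add: nat_less_iff floor_less_iff)
    have f: "0 \<le> real b * u - real ?i" "real b * u - real ?i < 1"
      using \<open>0 \<le> real b * u\<close> by (auto simp: of_nat_floor) linarith
    have "indicator {0..<1} (- real j + real b * u) = (0::real)" if "j \<noteq> ?i" for j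
      using that by (auto simp: indicator_def) linarith
    hence "(\<Sum>i<b. of_nat b * x [] i * ?h x i (- real i + real b * u)) =
       (\<Sum>i\<in>{?i}. of_nat b * x [] i * ?h x i (- real i + real b * u))"
      using i by (intro sum.mono_neutral_right) auto
    thus ?thesis using f True by (simp add: cell_density_Suc[OF i f])
  next
    case False
    have "indicator {0..<1} (- real i + real b * u) = (0::real)" if "i < b" for i
    proof -
      have "\<not> (0 \<le> - real i + real b * u \<and> - real i + real b * u < 1)"
      proof
        assume a: "0 \<le> - real i + real b * u \<and> - real i + real b * u < 1"
        hence "0 \<le> real b * u" "real b * u < real b * 1" using that by linarith+
        hence "0 \<le> u" "u < 1" using assms by (auto simp: zero_le_mult_iff mult_less_cancel_left)
        thus False using False by simp
      qed
      thus ?thesis by (simp add: indicator_def)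
    qed
    thus ?thesis using False by simp
  qed
  have int: "integrable lborel (\<lambda>u. of_nat b * x [] i * ?h x i (- real i + real b * u))" for x i
    using assms Suc(1)[of "subtree [i] x"] by (intro integrable_mult_right lborel_integrable_real_affine) auto
  {
    case 1 show ?case unfolding split by (intro Bochner_Integration.integrable_sum int)
  next
    case 2
    have part: "(LINT u|lborel. indicator {0..t} u *\<^sub>R ?h x i (- real i + real b * u)) =
       tree_cascade b n (subtree [i] x) (unit_clamp (real b * t - real i)) / of_nat b" for i
    proof -
      let ?f = "\<lambda>y. indicator {0..t} ((y + real i) / real b) *\<^sub>R ?h x i y"
      note [measurable] = borel_measurable_integrable[OF Suc(1)[of "subtree [i] x"]]
      have "(LINT y|lborel. ?f y) = \<bar>real b\<bar> *\<^sub>R (LINT u|lborel. ?f (- real i + real b * u))"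
        using assms by (intro lborel_integral_real_affine) auto
      also have "(\<lambda>u. ?f (- real i + real b * u)) = (\<lambda>u. indicator {0..t} u *\<^sub>R ?h x i (- real i + real b * u))"
        using assms by simp
      finally have "(LINT u|lborel. indicator {0..t} u *\<^sub>R ?h x i (- real i + real b * u)) = (LINT y|lborel. ?f y) / of_nat b"
        using assms by (simp add: scaleR_conv_of_real)
      also have "(LINT y|lborel. ?f y) =
         (LINT y|lborel. indicator {0..unit_clamp (real b * t - real i)} y *\<^sub>R ?h x i y)"
      proof (rule integral_cong_AE)
        show "AE y in lborel. ?f y = indicator {0..unit_clamp (real b * t - real i)} y *\<^sub>R ?h x i y"
          using AE_lborel_singleton[of 0]
        proof eventually_elim
          case (elim y)
          have "(0 \<le> (y + real i) / real b \<and> (y + real i) / real b \<le> t) = (y \<le> unit_clamp (real b * t - real i))"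
            if "0 \<le> y" "y < 1"
            using that elim assms by (auto simp: unit_clamp_def field_simps)
          thus ?case using elim by (auto simp: indicator_def)
        qed
      qed measurable
      finally show ?thesis using Suc(2)[of "unit_clamp (real b * t - real i)" "subtree [i] x"] by simp
    qed
    have int': "integrable lborel (\<lambda>u. indicator {0..t} u *\<^sub>R (of_nat b * x [] i * ?h x i (- real i + real b * u)))" for i
      by (rule integrable_mult_indicator[OF _ int]) simp
    have "(LINT u|lborel. indicator {0..t} u *\<^sub>R (indicator {0..<1} u *\<^sub>R cell_density b (Suc n) x u)) =
      (\<Sum>i<b. (LINT u|lborel. indicator {0..t} u *\<^sub>R (of_nat b * x [] i * ?h x i (- real i + real b * u))))"
      unfolding split scaleR_sum_right by (rule Bochner_Integration.integral_sum[OF int'])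
    also have "\<dots> = (\<Sum>i<b. of_nat b * x [] i * (LINT u|lborel. indicator {0..t} u *\<^sub>R ?h x i (- real i + real b * u)))"
      unfolding mult_scaleR_right[symmetric] by (subst integral_mult_right_zero) rule
    also have "\<dots> = tree_cascade b (Suc n) x t"
      unfolding part using assms by simp
    finally show ?case .
  }
qed

theorem cascade_eq_tree_cascade:
  assumes "0 < b" "t \<in> {0..1}"
  shows "cascade b V n \<omega> t = tree_cascade b n (\<lambda>w. V w \<omega>) t"
proof -
  let ?d = "cell_density b n (\<lambda>w. V w \<omega>)"
  have "(\<lambda>u. indicator {0..<1} u *\<^sub>R ?d u) \<in> borel_measurable lborel"
    using cell_density_integral(1)[OF assms(1)] by (rule borel_measurable_integrable)
  hence [measurable]: "(\<lambda>u. indicator {0..<1} u *\<^sub>R ?d u) \<in> borel_measurable borel" by simp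
  have "(\<lambda>u. indicator {0..<1} u *\<^sub>R ?d u + indicator {1} u *\<^sub>R ?d 1) \<in> borel_measurable borel"
    by measurable
  also have "(\<lambda>u. indicator {0..<1} u *\<^sub>R ?d u + indicator {1} u *\<^sub>R ?d 1) = (\<lambda>u. indicator {0..1} u *\<^sub>R ?d u)"
    by (rule ext) (auto split: split_indicator)
  finally have [measurable]: "(\<lambda>u. indicator {0..1} u *\<^sub>R ?d u) \<in> borel_measurable borel" .
  have eq: "(\<lambda>u. indicator {0..t} u *\<^sub>R ?d u) = (\<lambda>u. indicator {0..t} u *\<^sub>R (indicator {0..1} u *\<^sub>R ?d u))"
    using assms(2) by (auto simp: indicator_def)
  have "cascade b V n \<omega> t = (LINT u|lborel. indicator {0..t} u *\<^sub>R ?d u)"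
    unfolding cascade_def set_lebesgue_integral_def cell_density_def ..
  also have "\<dots> = (LINT u|lborel. indicator {0..t} u *\<^sub>R (indicator {0..<1} u *\<^sub>R ?d u))"
    unfolding eq
  proof (rule integral_cong_AE)
    show "AE u in lborel. indicator {0..t} u *\<^sub>R (indicator {0..1} u *\<^sub>R ?d u) =
        indicator {0..t} u *\<^sub>R (indicator {0..<1} u *\<^sub>R ?d u)"
      using AE_lborel_singleton[of 1] by eventually_elim (auto split: split_indicator)
  qed measurable
  finally show ?thesis using cell_density_integral(2)[OF assms] by simp
qed

text \<open>
  Telescoping the one-step differences. The bound is needed only from a generation \<open>N\<close> on, because the
  random constant \<open>C\<close> of the application improves with \<open>N\<close>.
\<close>

lemma tree_cascade_geometric_tail:
  assumes x: "conservative b x" and b: "0 < b" and \<theta>: "0 \<le> \<theta>" "\<theta> < 1" and C: "0 \<le> C"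
    and level: "\<And>k v. N \<le> k \<Longrightarrow> v \<in> words b k \<Longrightarrow>
      cmod (path_weight v x) * (1 + (\<Sum>i<b. cmod (x v i))) \<le> C * \<theta> ^ k"
    and t: "t \<in> {0..1}" and n: "N \<le> n"
  shows "cmod (tree_cascade b (n + m) x t - tree_cascade b n x t) \<le> C * \<theta> ^ n / (1 - \<theta>)"
proof -
  have one: "cmod (tree_cascade b (k + 1) x t - tree_cascade b k x t) \<le> C * \<theta> ^ k" if "N \<le> k" for k
  proof (rule tree_cascade_diff_bound[OF x t b])
    fix v s assume v: "v \<in> words b k" and s: "s \<in> {0..1::real}"
    have "cmod (path_weight v x) * cmod (tree_cascade b 1 (subtree v x) s - of_real s)
        \<le> cmod (path_weight v x) * (1 + (\<Sum>i<b. cmod (x v i)))"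
      using tree_cascade_1_level_bound[OF s, of b "subtree v x"] by (intro mult_left_mono) auto
    also have "\<dots> \<le> C * \<theta> ^ k" by (rule level[OF that v])
    finally show "cmod (path_weight v x) * cmod (tree_cascade b 1 (subtree v x) s - of_real s) \<le> C * \<theta> ^ k" .
  qed
  have "cmod (tree_cascade b (n + m) x t - tree_cascade b n x t) \<le> C * \<theta> ^ n * (\<Sum>j<m. \<theta> ^ j)"
  proof (induction m)
    case (Suc m)
    have "cmod (tree_cascade b (n + Suc m) x t - tree_cascade b n x t)
       \<le> cmod (tree_cascade b (n + m + 1) x t - tree_cascade b (n + m) x t) + cmod (tree_cascade b (n + m) x t - tree_cascade b n x t)"
      using norm_triangle_ineq[of "tree_cascade b (n + m + 1) x t - tree_cascade b (n + m) x t"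
          "tree_cascade b (n + m) x t - tree_cascade b n x t"] by (simp del: tree_cascade.simps)
    also have "\<dots> \<le> C * \<theta> ^ (n + m) + C * \<theta> ^ n * (\<Sum>j<m. \<theta> ^ j)"
      using n by (intro add_mono one Suc) auto
    finally show ?case by (simp add: algebra_simps power_add)
  qed simp
  also have "\<dots> \<le> C * \<theta> ^ n * (1 / (1 - \<theta>))"
    using sum_le_suminf[of "\<lambda>j. \<theta> ^ j" "{..<m}"] \<theta> C
    by (intro mult_left_mono) (auto simp: suminf_geometric intro!: summable_geometric)
  finally show ?thesis by simp
qed

lemma uniformly_convergent_onI_tail:
  fixes f :: "nat \<Rightarrow> 'b \<Rightarrow> complex"
  assumes "\<And>\<epsilon>. 0 < \<epsilon> \<Longrightarrow> \<exists>n. \<forall>m. \<forall>t\<in>S. cmod (f (n + m) t - f n t) \<le> \<epsilon>"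
  shows "uniformly_convergent_on S f"
proof -
  have "uniformly_Cauchy_on S f"
  proof (rule uniformly_Cauchy_onI)
    fix e :: real assume "0 < e"
    then obtain n where n: "\<forall>m. \<forall>t\<in>S. cmod (f (n + m) t - f n t) \<le> e / 3"
      using assms[of "e / 3"] by auto
    have "dist (f k t) (f l t) < e" if "n \<le> k" "n \<le> l" "t \<in> S" for k l t
    proof -
      have "dist (f k t) (f n t) \<le> e / 3" "dist (f l t) (f n t) \<le> e / 3"
        using n[rule_format, of t "k - n"] n[rule_format, of t "l - n"] that by (auto simp: dist_norm)
      thus ?thesis using dist_triangle2[of "f k t" "f l t" "f n t"] \<open>0 < e\<close> by linarith
    qed
    thus "\<exists>M. \<forall>x\<in>S. \<forall>m\<ge>M. \<forall>n\<ge>M. dist (f m x) (f n x) < e" by blast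
  qed
  thus ?thesis by (rule Cauchy_uniformly_convergent)
qed

lemma holder_on_mono:
  assumes "holder_on \<gamma> {0..1} f" "\<gamma>' \<le> \<gamma>"
  shows "holder_on \<gamma>' {0..1} f"
proof -
  obtain C where C: "\<forall>s\<in>{0..1}. \<forall>t\<in>{0..1}. cmod (f s - f t) \<le> C * \<bar>s - t\<bar> powr \<gamma>"
    using assms(1) unfolding holder_on_def by blast
  have "cmod (f s - f t) \<le> \<bar>C\<bar> * \<bar>s - t\<bar> powr \<gamma>'" if "s \<in> {0..1}" "t \<in> {0..1}" for s t
  proof -
    have "cmod (f s - f t) \<le> C * \<bar>s - t\<bar> powr \<gamma>" using C that by blast
    also have "\<dots> \<le> \<bar>C\<bar> * \<bar>s - t\<bar> powr \<gamma>" by (intro mult_right_mono) auto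
    also have "\<bar>s - t\<bar> powr \<gamma> \<le> \<bar>s - t\<bar> powr \<gamma>'"
    proof (cases "s = t")
      case False
      thus ?thesis using that assms(2) by (intro powr_mono') auto
    qed simp
    finally show ?thesis by (simp add: mult_left_mono)
  qed
  thus ?thesis unfolding holder_on_def by blast
qed

text \<open>
  Two points at distance between \<open>b\<close> to the power \<open>- n - 1\<close> and \<open>b\<close> to the power \<open>- n\<close> are compared through
  the \<open>n\<close>-th approximation: its error and its increment are both of order \<open>\<theta>\<^sup>n\<close>, and \<open>\<theta>\<^sup>n\<close> is comparable to
  the power \<open>\<gamma>\<close> of the distance.
\<close>

lemma holder_onI_geometric:
  fixes F :: "real \<Rightarrow> complex"
  assumes b: "2 \<le> b" and C: "0 \<le> C\<^sub>1" "0 \<le> C\<^sub>2" and \<theta>: "\<theta> = real b powr - \<gamma>"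
    and lim: "\<And>n t. t \<in> {0..1} \<Longrightarrow> cmod (f n t - F t) \<le> C\<^sub>1 * \<theta> ^ n"
    and lip: "\<And>n s t. s \<in> {0..1} \<Longrightarrow> t \<in> {0..1} \<Longrightarrow> cmod (f n s - f n t) \<le> C\<^sub>2 * \<theta> ^ n * real b ^ n * \<bar>s - t\<bar>"
  shows "holder_on \<gamma> {0..1} F"
  unfolding holder_on_def
proof (intro exI ballI)
  fix s t :: real assume s: "s \<in> {0..1}" and t: "t \<in> {0..1}"
  show "cmod (F s - F t) \<le> (2 * C\<^sub>1 + C\<^sub>2) * real b powr \<bar>\<gamma>\<bar> * \<bar>s - t\<bar> powr \<gamma>"
  proof (cases "s = t")
    case False
    define d where "d = \<bar>s - t\<bar>"
    have d: "0 < d" "d \<le> 1" using False s t by (auto simp: d_def)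
    \<comment> \<open>The generation whose cells have length comparable to the distance.\<close>
    define n where "n = nat \<lfloor>- log b d\<rfloor>"
    have "log b d \<le> 0" using d b by simp
    hence n: "real n \<le> - log b d" "- log b d < real n + 1"
      unfolding n_def by linarith+
    have up: "real b ^ n * d \<le> 1"
    proof -
      have "real b ^ n * d = real b powr (real n + log b d)"
        using d b by (simp add: powr_add powr_realpow)
      also have "\<dots> \<le> real b powr 0" using n b by (intro powr_mono) auto
      finally show ?thesis using b by simp
    qed
    have low: "\<theta> ^ n \<le> real b powr \<bar>\<gamma>\<bar> * d powr \<gamma>"
    proof -
      have "\<theta> ^ n = (real b powr - \<gamma>) powr real n"
        using b by (simp add: \<theta> powr_realpow)
      also have "\<dots> = real b powr (- \<gamma> * real n)" by (rule powr_powr)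
      also have "\<dots> \<le> real b powr (\<bar>\<gamma>\<bar> + \<gamma> * log b d)"
      proof (rule powr_mono)
        have "\<gamma> * (- log b d - real n) \<le> \<bar>\<gamma>\<bar> * 1"
        proof -
          have "\<gamma> * (- log b d - real n) \<le> \<bar>\<gamma>\<bar> * \<bar>- log b d - real n\<bar>"
            by (metis abs_ge_self abs_mult)
          also have "\<dots> \<le> \<bar>\<gamma>\<bar> * 1" using n by (intro mult_left_mono) auto
          finally show ?thesis .
        qed
        thus "- \<gamma> * real n \<le> \<bar>\<gamma>\<bar> + \<gamma> * log b d" by (simp add: algebra_simps)
      qed (use b in simp)
      also have "\<dots> = real b powr \<bar>\<gamma>\<bar> * d powr \<gamma>"
      proof -
        have "real b powr (\<gamma> * log b d) = (real b powr log b d) powr \<gamma>"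
          by (simp add: powr_powr mult.commute)
        also have "real b powr log b d = d" using d b by simp
        finally show ?thesis by (simp add: powr_add)
      qed
      finally show ?thesis .
    qed
    have "cmod (F s - F t) \<le> cmod (f n s - F s) + cmod (f n t - F t) + cmod (f n s - f n t)"
    proof -
      have "F s - F t = (f n t - F t) - (f n s - F s) + (f n s - f n t)" by simp
      also have "cmod \<dots> \<le> cmod ((f n t - F t) - (f n s - F s)) + cmod (f n s - f n t)"
        by (rule norm_triangle_ineq)
      finally show ?thesis using norm_triangle_ineq4[of "f n t - F t" "f n s - F s"] by linarith
    qed
    also have "\<dots> \<le> C\<^sub>1 * \<theta> ^ n + C\<^sub>1 * \<theta> ^ n + C\<^sub>2 * \<theta> ^ n * (real b ^ n * d)"
      using lim[OF s] lim[OF t] lip[OF s t] by (intro add_mono) (auto simp: d_def mult.assoc)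
    also have "\<dots> \<le> C\<^sub>1 * \<theta> ^ n + C\<^sub>1 * \<theta> ^ n + C\<^sub>2 * \<theta> ^ n * 1"
      using up C b by (intro add_left_mono mult_left_mono) (auto simp: \<theta>)
    also have "\<dots> = (2 * C\<^sub>1 + C\<^sub>2) * \<theta> ^ n" by (simp add: algebra_simps)
    also have "\<dots> \<le> (2 * C\<^sub>1 + C\<^sub>2) * (real b powr \<bar>\<gamma>\<bar> * d powr \<gamma>)"
      using C by (intro mult_left_mono low) auto
    finally show ?thesis by (simp add: d_def mult.assoc)
  qed simp
qed

text \<open>
  The alternative of the critical case for one vector of weights.
\<close>

definition critical_vector :: "nat \<Rightarrow> real \<Rightarrow> (nat \<Rightarrow> complex) \<Rightarrow> bool" where
  "critical_vector b \<gamma> z \<longleftrightarrow> (\<forall>i<b. cmod (z i) \<le> \<gamma> \<or>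
     cmod (z i) = 1 \<and> ((\<Sum>k<i. z k), (\<Sum>k\<le>i. z k)) \<in> {(0, 1), (1, 0)})"

lemma critical_subtree:
  assumes "\<forall>w\<in>lists {..<b}. critical_vector b \<gamma> (x w)" "v \<in> lists {..<b}"
  shows "\<forall>w\<in>lists {..<b}. critical_vector b \<gamma> (subtree v x w)"
  using assms by (auto simp: subtree_def)

text \<open>
  A cell with weight of modulus 1 is traversed from 0 to 1 or from 1 to 0, so there \<open>F (m + 1)\<close> is a copy
  of \<open>F m\<close> or of \<open>1 - F m\<close> for the child. This is why \<open>F m\<close> and \<open>1 - F m\<close> are bounded together. On the other
  cells the factor \<open>\<gamma>\<close> leaves room for the partial sum, and the constant solves
  \<open>1 + b + \<gamma> B = B\<close>.
\<close>

lemma tree_cascade_critical_bound: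
  assumes x: "conservative b x" and crit: "\<forall>w\<in>lists {..<b}. critical_vector b \<gamma> (x w)"
    and \<gamma>: "0 < \<gamma>" "\<gamma> < 1" and b: "0 < b" and t: "t \<in> {0..1}"
  shows "cmod (tree_cascade b m x t) \<le> (1 + real b) / (1 - \<gamma>) \<and> cmod (1 - tree_cascade b m x t) \<le> (1 + real b) / (1 - \<gamma>)"
  using x crit t
proof (induction m arbitrary: x t)
  case 0
  have "1 - \<gamma> \<le> 1 + real b" using \<gamma> by simp
  hence "1 \<le> (1 + real b) / (1 - \<gamma>)" using \<gamma> by simp
  moreover have "cmod (1 - of_real t) = \<bar>1 - t\<bar>" by (metis norm_of_real of_real_1 of_real_diff)
  ultimately show ?case using 0 by auto
next
  case (Suc m)
  let ?B = "(1 + real b) / (1 - \<gamma>)"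
  obtain i s where i: "i < b" and s: "s \<in> {0..1}" and t: "t = (s + real i) / real b"
    using unit_interval_cell[OF Suc.prems(3) b] .
  let ?f = "tree_cascade b m (subtree [i] x) s"
  have IH: "cmod ?f \<le> ?B" "cmod (1 - ?f) \<le> ?B"
    using Suc.IH[OF conservative_subtree[OF Suc.prems(1)] critical_subtree[OF Suc.prems(2)] s] i
    by auto
  have F: "tree_cascade b (Suc m) x t = (\<Sum>k<i. x [] k) + x [] i * ?f"
    unfolding t by (rule tree_cascade_Suc_on_cell[OF Suc.prems(1) i s])
  have cv: "critical_vector b \<gamma> (x [])" using Suc.prems(2) by simp
  hence le1: "cmod (x [] k) \<le> 1" if "k < b" for k
    using that \<gamma> unfolding critical_vector_def by fastforce
  from cv i consider "cmod (x [] i) \<le> \<gamma>"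
    | "(\<Sum>k<i. x [] k) = 0" "(\<Sum>k\<le>i. x [] k) = 1"
    | "(\<Sum>k<i. x [] k) = 1" "(\<Sum>k\<le>i. x [] k) = 0"
    unfolding critical_vector_def by auto
  thus ?case
  proof cases
    case 1
    have "cmod (\<Sum>k<i. x [] k) \<le> (\<Sum>k<i. 1)"
      using le1 i by (intro order_trans[OF norm_sum] sum_mono) auto
    hence S: "cmod (\<Sum>k<i. x [] k) \<le> real b" using i by simp
    have P: "cmod (x [] i * ?f) \<le> \<gamma> * ?B"
      unfolding norm_mult using 1 IH \<gamma> by (intro mult_mono) auto
    have B: "1 + real b + \<gamma> * ?B = ?B" using \<gamma> by (simp add: field_simps)
    have "cmod (tree_cascade b (Suc m) x t) \<le> real b + \<gamma> * ?B"
      unfolding F by (intro order_trans[OF norm_triangle_ineq] add_mono S P)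
    moreover have "cmod (1 - tree_cascade b (Suc m) x t) \<le> 1 + cmod (tree_cascade b (Suc m) x t)"
      using norm_triangle_ineq4[of 1 "tree_cascade b (Suc m) x t"] by simp
    ultimately show ?thesis using B by linarith
  next
    case 2
    hence "x [] i = 1" by (simp add: lessThan_Suc_atMost[symmetric])
    thus ?thesis using IH F 2 by simp
  next
    case 3
    hence "x [] i = - 1" by (simp add: lessThan_Suc_atMost[symmetric] add_eq_0_iff)
    thus ?thesis using IH F 3 by simp
  qed
qed

text \<open>
  With one bound for all \<open>F m\<close>, a single generation with small products controls all later functions,
  so decay of the products without any rate gives the Cauchy property.
\<close>

lemma tree_cascade_critical_convergent:
  assumes x: "conservative b x" and crit: "\<forall>w\<in>lists {..<b}. critical_vector b \<gamma> (x w)"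
    and \<gamma>: "0 < \<gamma>" "\<gamma> < 1" and b: "0 < b"
    and small: "\<And>\<epsilon>. 0 < \<epsilon> \<Longrightarrow> \<exists>n. \<forall>v\<in>words b n. cmod (path_weight v x) \<le> \<epsilon>"
  shows "uniformly_convergent_on {0..1} (\<lambda>n. tree_cascade b n x)"
proof (rule uniformly_convergent_onI_tail)
  fix \<epsilon> :: real assume \<epsilon>: "0 < \<epsilon>"
  let ?B = "(1 + real b) / (1 - \<gamma>)"
  have B: "0 < ?B" using \<gamma> by simp
  then obtain n where n: "\<forall>v\<in>words b n. cmod (path_weight v x) \<le> \<epsilon> / (?B + 1)"
    using small[of "\<epsilon> / (?B + 1)"] \<epsilon> by (auto simp: add_pos_pos)
  have "cmod (tree_cascade b (n + m) x t - tree_cascade b n x t) \<le> \<epsilon>" if t: "t \<in> {0..1}" for m t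
  proof (rule tree_cascade_diff_bound[OF x t b])
    fix v s assume v: "v \<in> words b n" and s: "s \<in> {0..1::real}"
    have "conservative b (subtree v x)" "\<forall>w\<in>lists {..<b}. critical_vector b \<gamma> (subtree v x w)"
      using conservative_subtree[OF x] critical_subtree[OF crit] words_in_lists[OF v] by blast+
    hence "cmod (tree_cascade b m (subtree v x) s) \<le> ?B"
      using tree_cascade_critical_bound \<gamma> b s by blast
    hence "cmod (tree_cascade b m (subtree v x) s - of_real s) \<le> ?B + 1"
      using norm_triangle_ineq4[of "tree_cascade b m (subtree v x) s" "of_real s"] s by simp
    hence "cmod (path_weight v x) * cmod (tree_cascade b m (subtree v x) s - of_real s) \<le> \<epsilon> / (?B + 1) * (?B + 1)"
      using n v \<epsilon> B by (intro mult_mono) auto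
    thus "cmod (path_weight v x) * cmod (tree_cascade b m (subtree v x) s - of_real s) \<le> \<epsilon>" using B by simp
  qed
  thus "\<exists>n. \<forall>m. \<forall>t\<in>{0..1}. cmod (tree_cascade b (n + m) x t - tree_cascade b n x t) \<le> \<epsilon>" by blast
qed

text \<open>
  A cell of generation \<open>n\<close> has length \<open>b\<close> to the power \<open>- n\<close> and the limit has increment \<open>Q v\<close> over it.
\<close>

lemma path_weight_bound_of_holder:
  assumes x: "conservative b x" and b: "0 < b"
    and lim: "\<And>t. t \<in> {0..1} \<Longrightarrow> (\<lambda>n. tree_cascade b n x t) \<longlonglongrightarrow> F t"
    and hol: "holder_on \<alpha> {0..1} F"
  obtains C where "\<And>n v. v \<in> words b n \<Longrightarrow> cmod (path_weight v x) * (real b powr \<alpha>) ^ n \<le> C"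
proof -
  obtain C where C: "\<forall>s\<in>{0..1}. \<forall>t\<in>{0..1}. cmod (F s - F t) \<le> C * \<bar>s - t\<bar> powr \<alpha>"
    using hol unfolding holder_on_def by blast
  have "cmod (path_weight v x) * (real b powr \<alpha>) ^ n \<le> C" if v: "v \<in> words b n" for n v
  proof -
    let ?l = "left_end b v" and ?r = "left_end b v + 1 / real b ^ n"
    have pos: "0 < 1 / real b ^ n" using b by simp
    have lr: "?l \<in> {0..1}" "?r \<in> {0..1}"
      using left_end_range[OF v] pos by (auto simp del: zero_less_divide_1_iff intro: order_trans)
    have "(\<lambda>m. tree_cascade b m x ?r - tree_cascade b m x ?l) \<longlonglongrightarrow> F ?r - F ?l"
      by (intro tendsto_diff lim lr)
    moreover have "eventually (\<lambda>m. tree_cascade b m x ?r - tree_cascade b m x ?l = path_weight v x) sequentially"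
      using eventually_ge_at_top[of n] by eventually_elim (rule tree_cascade_increment_on_cell[OF x v])
    ultimately have "(\<lambda>m. path_weight v x) \<longlonglongrightarrow> F ?r - F ?l"
      by (simp add: tendsto_cong)
    hence "path_weight v x = F ?r - F ?l" by (simp add: LIMSEQ_const_iff)
    moreover have "cmod (F ?r - F ?l) \<le> C * \<bar>?r - ?l\<bar> powr \<alpha>" using C lr by blast
    ultimately have "cmod (path_weight v x) \<le> C * \<bar>?r - ?l\<bar> powr \<alpha>" by (simp only:)
    also have "\<bar>?r - ?l\<bar> powr \<alpha> = 1 / (real b powr \<alpha>) ^ n"
    proof -
      have "(real b ^ n) powr \<alpha> = (real b powr \<alpha>) ^ n"
        using b by (simp add: powr_realpow[symmetric] powr_powr mult.commute powr_power)
      thus ?thesis using b by (simp add: powr_divide)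
    qed
    finally show ?thesis using b by (simp add: field_simps)
  qed
  thus thesis by (rule that)
qed

section \<open>The space of weighted trees and the scaling property\<close>

text \<open>
  Trees of weights are indexed by the words over the alphabet and undefined elsewhere, so that the family
  of all weights is a random element of a countable product space.
\<close>

definition tree_space :: "nat \<Rightarrow> (nat list \<Rightarrow> nat \<Rightarrow> complex) measure" where
  "tree_space b = Pi\<^sub>M (lists {..<b}) (\<lambda>_. weight_space b)"

lemma measurable_component_weight_space [measurable]:
  "i < b \<Longrightarrow> (\<lambda>z. z i) \<in> borel_measurable (weight_space b)"
  unfolding weight_space_def by measurable

lemma measurable_vertex_tree_space [measurable]:
  "w \<in> lists {..<b} \<Longrightarrow> (\<lambda>x. x w) \<in> tree_space b \<rightarrow>\<^sub>M weight_space b"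
  unfolding tree_space_def by measurable

lemma measurable_weight_tree_space [measurable]:
  "w \<in> lists {..<b} \<Longrightarrow> i < b \<Longrightarrow> (\<lambda>x. x w i) \<in> borel_measurable (tree_space b)"
  by (rule measurable_compose[OF measurable_vertex_tree_space measurable_component_weight_space])

lemma measurable_subtree [measurable]:
  assumes "v \<in> lists {..<b}"
  shows "subtree v \<in> tree_space b \<rightarrow>\<^sub>M tree_space b"
proof -
  have "(\<lambda>x w. x (v @ w)) \<in> tree_space b \<rightarrow>\<^sub>M tree_space b"
    unfolding tree_space_def
  proof (rule measurable_PiM_single')
    show "(\<lambda>x. x (v @ w)) \<in> Pi\<^sub>M (lists {..<b}) (\<lambda>_. weight_space b) \<rightarrow>\<^sub>M weight_space b"
      if "w \<in> lists {..<b}" for w using that assms by (intro measurable_component_singleton) auto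
    show "(\<lambda>x w. x (v @ w)) \<in> space (Pi\<^sub>M (lists {..<b}) (\<lambda>_. weight_space b))
        \<rightarrow> (\<Pi>\<^sub>E i\<in>lists {..<b}. space (weight_space b))"
      using assms by (auto simp: space_PiM PiE_def Pi_def extensional_def)
  qed
  moreover have "(subtree v :: (nat list \<Rightarrow> nat \<Rightarrow> complex) \<Rightarrow> _) = (\<lambda>x w. x (v @ w))"
    by (auto simp: subtree_def fun_eq_iff)
  ultimately show ?thesis by simp
qed

lemma measurable_path_weight [measurable]:
  "v \<in> lists {..<b} \<Longrightarrow> path_weight v \<in> borel_measurable (tree_space b)"
proof (induction v)
  case (Cons i v)
  hence [measurable]: "path_weight v \<in> borel_measurable (tree_space b)" "[] \<in> lists {..<b}" "[i] \<in> lists {..<b}" "i < b"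
    by auto
  have "(\<lambda>x. x [] i * path_weight v (subtree [i] x)) \<in> borel_measurable (tree_space b)" by measurable
  moreover have "path_weight (i # v) = (\<lambda>x. x [] i * path_weight v (subtree [i] x))" by auto
  ultimately show ?case by simp
qed (simp add: path_weight_def)

lemma measurable_tree_cascade [measurable]: "(\<lambda>x. tree_cascade b n x t) \<in> borel_measurable (tree_space b)"
proof (induction n arbitrary: t)
  case (Suc n)
  have "(\<lambda>x. tree_cascade b n (subtree [i] x) s) \<in> borel_measurable (tree_space b)" if "i < b" for i s
    by (rule measurable_compose[OF measurable_subtree Suc]) (use that in auto)
  thus ?case by (auto intro!: borel_measurable_sum borel_measurable_times measurable_weight_tree_space)
qed simp

definition convergent_trees :: "nat \<Rightarrow> (nat list \<Rightarrow> nat \<Rightarrow> complex) set" where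
  "convergent_trees b =
     {x \<in> space (tree_space b). uniformly_convergent_on {0..1} (\<lambda>n. tree_cascade b n x)}"

text \<open>
  By continuity the Cauchy property may be tested at the images of the rational numbers under
  \<open>unit_clamp\<close>, which are dense in the unit interval; this makes it a countable condition.
\<close>

lemma convergent_trees_sets [measurable]: "convergent_trees b \<in> sets (tree_space b)"
proof -
  let ?d = "\<lambda>x m n t. dist (tree_cascade b m x (unit_clamp t)) (tree_cascade b n x (unit_clamp t))"
  have "uniformly_convergent_on {0..1} (\<lambda>n. tree_cascade b n x) \<longleftrightarrow>
      (\<forall>k. \<exists>N. \<forall>m\<in>{N..}. \<forall>n\<in>{N..}. \<forall>q\<in>\<rat>. ?d x m n q \<le> 1 / real (Suc k))" (is "?L \<longleftrightarrow> ?R") for x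
  proof
    assume ?L
    hence cau: "uniformly_Cauchy_on {0..1} (\<lambda>n. tree_cascade b n x)" by (rule uniformly_convergent_Cauchy)
    have "\<exists>N. \<forall>m\<in>{N..}. \<forall>n\<in>{N..}. \<forall>q\<in>\<rat>. ?d x m n q \<le> 1 / real (Suc k)" for k
    proof -
      obtain N where "\<forall>t\<in>{0..1}. \<forall>m\<ge>N. \<forall>n\<ge>N. dist (tree_cascade b m x t) (tree_cascade b n x t) < 1 / real (Suc k)"
        using cau unfolding uniformly_Cauchy_on_def by (meson of_nat_0_less_iff zero_less_Suc zero_less_divide_1_iff)
      thus ?thesis by (intro exI[of _ N]) (auto intro: less_imp_le)
    qed
    thus ?R by blast
  next
    assume R: ?R
    show ?L
    proof (rule Cauchy_uniformly_convergent, rule uniformly_Cauchy_onI)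
      fix e :: real assume "0 < e"
      then obtain k where k: "1 / real (Suc k) < e" using nat_approx_posE by blast
      obtain N where N: "\<forall>m\<in>{N..}. \<forall>n\<in>{N..}. \<forall>q\<in>\<rat>. ?d x m n q \<le> 1 / real (Suc k)" using R by blast
      have "dist (tree_cascade b m x t) (tree_cascade b n x t) < e" if "t \<in> {0..1}" "N \<le> m" "N \<le> n" for t m n
      proof -
        have cont: "continuous_on UNIV (\<lambda>t. tree_cascade b m x (unit_clamp t))" for m
          by (rule continuous_on_compose2[OF continuous_on_tree_cascade[of UNIV]])
             (auto simp: unit_clamp_def intro!: continuous_intros)
        have "closed {s. ?d x m n s \<le> 1 / real (Suc k)}"
          by (intro closed_Collect_le continuous_intros cont)
        hence "closure \<rat> \<subseteq> {s. ?d x m n s \<le> 1 / real (Suc k)}"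
          using N that by (intro closure_minimal) auto
        hence "?d x m n t \<le> 1 / real (Suc k)" using Rats_closure_real by auto
        moreover have "unit_clamp t = t" using that by (simp add: unit_clamp_def)
        ultimately show ?thesis using k by simp
      qed
      thus "\<exists>M. \<forall>t\<in>{0..1}. \<forall>m\<ge>M. \<forall>n\<ge>M. dist (tree_cascade b m x t) (tree_cascade b n x t) < e" by blast
    qed
  qed
  hence "convergent_trees b = {x \<in> space (tree_space b).
      \<forall>k. \<exists>N. \<forall>m\<in>{N..}. \<forall>n\<in>{N..}. \<forall>q\<in>\<rat>. ?d x m n q \<le> 1 / real (Suc k)}"
    unfolding convergent_trees_def by simp
  also have "\<dots> \<in> sets (tree_space b)"
    using countable_rat by measurable
  finally show ?thesis .
qed

text \<open>
  Outside the measurable set of trees with uniform convergence the value is 0, so that every outcome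
  gives a continuous function. Because the limit is a fixed measurable function of the tree, trees with
  the same law have limits with the same law.
\<close>

definition limit_cascade :: "nat \<Rightarrow> (nat list \<Rightarrow> nat \<Rightarrow> complex) \<Rightarrow> real \<Rightarrow> complex" where
  "limit_cascade b x = (\<lambda>t\<in>{0..1}. if x \<in> convergent_trees b then lim (\<lambda>n. tree_cascade b n x t) else 0)"

lemma measurable_limit_cascade [measurable]: "limit_cascade b \<in> tree_space b \<rightarrow>\<^sub>M path_space"
proof -
  have "(\<lambda>x. \<lambda>t\<in>{0..1}. if x \<in> convergent_trees b then lim (\<lambda>n. tree_cascade b n x t) else 0)
     \<in> tree_space b \<rightarrow>\<^sub>M path_space"
    unfolding path_space_def by (intro measurable_restrict) measurable
  thus ?thesis by (simp add: limit_cascade_def[abs_def])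
qed

lemma limit_cascade_uniform_limit:
  assumes "x \<in> convergent_trees b"
  shows "uniform_limit {0..1} (\<lambda>n. tree_cascade b n x) (limit_cascade b x) sequentially"
proof -
  have "uniform_limit {0..1} (\<lambda>n. tree_cascade b n x) (\<lambda>t. lim (\<lambda>n. tree_cascade b n x t)) sequentially"
    using assms by (simp add: convergent_trees_def uniformly_convergent_uniform_limit_iff)
  thus ?thesis
    by (rule uniform_limit_cong'[THEN iffD1, rotated 2]) (auto simp: limit_cascade_def assms)
qed

lemma limit_cascade_LIMSEQ:
  assumes "x \<in> convergent_trees b" "t \<in> {0..1}"
  shows "(\<lambda>n. tree_cascade b n x t) \<longlonglongrightarrow> limit_cascade b x t"
  by (rule tendsto_uniform_limitI[OF limit_cascade_uniform_limit[OF assms(1)] assms(2)])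

lemma continuous_limit_cascade: "continuous_on {0..1} (limit_cascade b x)"
proof (cases "x \<in> convergent_trees b")
  case True
  show ?thesis
    by (rule uniform_limit_theorem[OF _ limit_cascade_uniform_limit[OF True]])
       (auto intro!: always_eventually continuous_on_tree_cascade)
next
  case False
  have "continuous_on {0..1} (\<lambda>_::real. 0::complex)" by simp
  thus ?thesis by (rule continuous_on_cong[THEN iffD1, rotated 2]) (auto simp: limit_cascade_def False)
qed

lemma limit_cascade_on_cell:
  assumes x: "x \<in> convergent_trees b" "conservative b x" and i: "i < b"
    and sub: "subtree [i] x \<in> convergent_trees b" and s: "s \<in> {0..1}"
  shows "limit_cascade b x ((s + real i) / real b) = (\<Sum>k<i. x [] k) + x [] i * limit_cascade b (subtree [i] x) s"
proof -
  have "s + real i \<le> real b" using s i by auto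
  hence r: "(s + real i) / real b \<in> {0..1}" using s i by auto
  have "(\<lambda>n. tree_cascade b (Suc n) x ((s + real i) / real b)) \<longlonglongrightarrow> limit_cascade b x ((s + real i) / real b)"
    by (rule LIMSEQ_Suc[OF limit_cascade_LIMSEQ[OF x(1) r]])
  moreover have "(\<lambda>n. tree_cascade b (Suc n) x ((s + real i) / real b)) \<longlonglongrightarrow>
      (\<Sum>k<i. x [] k) + x [] i * limit_cascade b (subtree [i] x) s"
    unfolding tree_cascade_Suc_on_cell[OF x(2) i s] by (intro tendsto_intros limit_cascade_LIMSEQ[OF sub s])
  ultimately show ?thesis by (rule LIMSEQ_unique)
qed

lemma limit_cascade_0: "limit_cascade b x 0 = 0"
  by (simp add: limit_cascade_def)

locale cascade_weights = prob_space M for M :: "'a measure" +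
  fixes b :: nat and V :: "nat list \<Rightarrow> 'a \<Rightarrow> nat \<Rightarrow> complex"
  assumes b2: "2 \<le> b"
    and indep: "indep_vars (\<lambda>_. weight_space b) V (lists {..<b})"
    and same_law: "w \<in> lists {..<b} \<Longrightarrow> distr M (weight_space b) (V w) = distr M (weight_space b) (V [])"
    and sum_weights: "AE \<omega> in M. (\<Sum>i<b. V [] \<omega> i) = 1"
begin

lemma b_pos: "0 < b" using b2 by simp

lemma measurable_V [measurable]: "w \<in> lists {..<b} \<Longrightarrow> V w \<in> M \<rightarrow>\<^sub>M weight_space b"
  using indep by (auto simp: indep_vars_def)

lemma measurable_root [measurable]: "V [] \<in> M \<rightarrow>\<^sub>M weight_space b"
  by (rule measurable_V) simp

lemma measurable_root_component [measurable]: "i < b \<Longrightarrow> (\<lambda>\<omega>. V [] \<omega> i) \<in> borel_measurable M"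
  by (rule measurable_compose[OF measurable_root measurable_component_weight_space])

definition tree :: "'a \<Rightarrow> nat list \<Rightarrow> nat \<Rightarrow> complex" where
  "tree \<omega> = (\<lambda>w\<in>lists {..<b}. V w \<omega>)"

lemma measurable_tree [measurable]: "tree \<in> M \<rightarrow>\<^sub>M tree_space b"
  unfolding tree_def[abs_def] tree_space_def by (intro measurable_restrict measurable_V)

lemma tree_apply: "w \<in> lists {..<b} \<Longrightarrow> tree \<omega> w = V w \<omega>"
  by (simp add: tree_def)

lemma tree_root [simp]: "tree \<omega> [] = V [] \<omega>"
  by (simp add: tree_def)

lemma cascade_eq_tree: "t \<in> {0..1} \<Longrightarrow> cascade b V n \<omega> t = tree_cascade b n (tree \<omega>) t"
  using cascade_eq_tree_cascade[OF b_pos] tree_cascade_cong[of b "tree \<omega>" "\<lambda>w. V w \<omega>"] by (simp add: tree_apply)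

abbreviation branch :: "nat \<Rightarrow> 'a \<Rightarrow> nat list \<Rightarrow> nat \<Rightarrow> complex" where
  "branch i \<omega> \<equiv> subtree [i] (tree \<omega>)"

lemma measurable_branch [measurable]: "i < b \<Longrightarrow> branch i \<in> M \<rightarrow>\<^sub>M tree_space b"
  by (rule measurable_compose[OF measurable_tree measurable_subtree]) simp

text \<open>
  Both trees are families of independent vectors with the common law, hence have the same product law.
\<close>

lemma branch_law:
  assumes i: "i < b"
  shows "distr M (tree_space b) (branch i) = distr M (tree_space b) tree"
proof -
  let ?L = "lists {..<b}"
  have "indep_vars (\<lambda>w. Pi\<^sub>M {i # w} (\<lambda>_. weight_space b)) (\<lambda>w \<omega>. restrict (\<lambda>u. V u \<omega>) {i # w}) ?L"
    using i by (intro indep_vars_restrict[OF indep]) (auto simp: disjoint_family_on_def)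
  hence "indep_vars (\<lambda>_. weight_space b) (\<lambda>w \<omega>. (restrict (\<lambda>u. V u \<omega>) {i # w}) (i # w)) ?L"
    by (rule indep_vars_compose2) (auto intro: measurable_component_singleton)
  hence ind: "indep_vars (\<lambda>_. weight_space b) (\<lambda>w. V (i # w)) ?L" by simp
  have br: "branch i = (\<lambda>\<omega>. \<lambda>w\<in>?L. V (i # w) \<omega>)"
    using i by (auto simp: tree_def subtree_def fun_eq_iff)
  have "distr M (tree_space b) (branch i) = Pi\<^sub>M ?L (\<lambda>w. distr M (weight_space b) (V (i # w)))"
    using ind i unfolding br tree_space_def
    by (subst (asm) indep_vars_iff_distr_eq_PiM') auto
  also have "\<dots> = Pi\<^sub>M ?L (\<lambda>w. distr M (weight_space b) (V w))"
  proof (rule PiM_cong[OF refl])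
    fix w assume "w \<in> ?L"
    thus "distr M (weight_space b) (V (i # w)) = distr M (weight_space b) (V w)"
      using same_law[of w] same_law[of "i # w"] i by simp
  qed
  also have "\<dots> = distr M (tree_space b) tree"
    using indep unfolding tree_def[abs_def] tree_space_def
    by (subst (asm) indep_vars_iff_distr_eq_PiM') auto
  finally show ?thesis .
qed

lemma AE_branch:
  assumes "AE \<omega> in M. tree \<omega> \<in> E" "E \<in> sets (tree_space b)" "i < b"
  shows "AE \<omega> in M. branch i \<omega> \<in> E"
proof -
  have E: "{x \<in> space (tree_space b). x \<in> E} \<in> sets (tree_space b)"
    using assms(2) by simp
  have "AE x in distr M (tree_space b) tree. x \<in> E"
    using assms(1) E by (subst AE_distr_iff) auto
  hence "AE x in distr M (tree_space b) (branch i). x \<in> E" by (simp only: branch_law[OF assms(3)])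
  thus ?thesis using E assms(3) by (subst (asm) AE_distr_iff) auto
qed

lemma prob_branch:
  assumes "E \<in> sets (tree_space b)" "i < b"
  shows "\<P>(\<omega> in M. branch i \<omega> \<in> E) = \<P>(\<omega> in M. tree \<omega> \<in> E)"
proof -
  have "measure (distr M (tree_space b) (branch i)) E = measure (distr M (tree_space b) tree) E"
    by (simp add: branch_law assms)
  thus ?thesis using assms
    by (simp add: measure_distr vimage_def Int_def conj_commute)
qed

lemma AE_all_vertices:
  assumes "AE \<omega> in M. P (V [] \<omega>)" "{z \<in> space (weight_space b). P z} \<in> sets (weight_space b)"
  shows "AE \<omega> in M. \<forall>w\<in>lists {..<b}. P (tree \<omega> w)"
proof (rule AE_ball_countable[THEN iffD2])
  show "\<forall>w\<in>lists {..<b}. AE \<omega> in M. P (tree \<omega> w)"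
  proof
    fix w assume w: "w \<in> lists {..<b}"
    have "AE z in distr M (weight_space b) (V []). P z"
      using assms by (subst AE_distr_iff) auto
    hence "AE z in distr M (weight_space b) (V w). P z" by (simp only: same_law[OF w])
    thus "AE \<omega> in M. P (tree \<omega> w)"
      using assms(2) w by (subst (asm) AE_distr_iff) (auto simp: tree_apply)
  qed
qed simp

lemma AE_conservative: "AE \<omega> in M. conservative b (tree \<omega>)"
proof -
  have "{z \<in> space (weight_space b). (\<Sum>i<b. z i) = 1} \<in> sets (weight_space b)" by measurable
  from AE_all_vertices[OF sum_weights this] show ?thesis by (simp add: conservative_def)
qed

text \<open>
  The events that depend only on the root vector, and those that depend only on the descendants of the
  child \<open>i\<close>, indexed as in \<open>scaling_property\<close>.
\<close>

definition block_events :: "nat option \<Rightarrow> 'a set set" where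
  "block_events j = (case j of
     None \<Rightarrow> {V [] -` A \<inter> space M | A. A \<in> sets (weight_space b)}
   | Some i \<Rightarrow> {branch i -` E \<inter> space M | E. E \<in> sets (tree_space b)})"

text \<open>
  The root and the sets of words starting with \<open>i\<close>, for the letters \<open>i\<close>, are disjoint sets of indices.
\<close>

lemma indep_blocks: "indep_sets block_events (insert None (Some ` {..<b}))"
proof -
  let ?L = "lists {..<b}" and ?J = "insert None (Some ` {..<b})"
  let ?K = "\<lambda>j. case j of None \<Rightarrow> {[]} | Some i \<Rightarrow> (#) i ` ?L"
  let ?X = "\<lambda>j \<omega>. restrict (\<lambda>w. V w \<omega>) (?K j)"
  let ?N = "\<lambda>j. Pi\<^sub>M (?K j) (\<lambda>_. weight_space b)"
  have "indep_vars ?N ?X ?J"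
    by (rule indep_vars_restrict[OF indep]) (auto simp: disjoint_family_on_def split: option.splits)
  hence "indep_sets (\<lambda>j. {?X j -` A \<inter> space M | A. A \<in> sets (?N j)}) ?J"
    by (simp add: indep_vars_def2)
  thus ?thesis
  proof (rule indep_sets_mono_sets)
    fix j assume j: "j \<in> ?J"
    show "block_events j \<subseteq> {?X j -` A \<inter> space M | A. A \<in> sets (?N j)}"
    proof (cases j)
      case None
      show ?thesis
      proof
        fix B assume "B \<in> block_events j"
        then obtain A where A: "B = V [] -` A \<inter> space M" "A \<in> sets (weight_space b)"
          by (auto simp: block_events_def None)
        have m: "(\<lambda>x. x []) \<in> ?N j \<rightarrow>\<^sub>M weight_space b"
          using None by (auto intro: measurable_component_singleton)
        have X: "?X j \<in> M \<rightarrow>\<^sub>M ?N j" using None by (intro measurable_restrict) auto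
        have "B = ?X j -` ((\<lambda>x. x []) -` A \<inter> space (?N j)) \<inter> space M"
          using measurable_space[OF X] None A by auto
        thus "B \<in> {?X j -` A \<inter> space M | A. A \<in> sets (?N j)}"
          using measurable_sets[OF m A(2)] by blast
      qed
    next
      case (Some i)
      hence i: "i < b" using j by auto
      show ?thesis
      proof
        fix B assume "B \<in> block_events j"
        then obtain E where E: "B = branch i -` E \<inter> space M" "E \<in> sets (tree_space b)"
          by (auto simp: block_events_def Some)
        have m: "(\<lambda>x. \<lambda>w\<in>?L. x (i # w)) \<in> ?N j \<rightarrow>\<^sub>M tree_space b"
          unfolding tree_space_def using Some by (intro measurable_restrict measurable_component_singleton) auto
        have X: "?X j \<in> M \<rightarrow>\<^sub>M ?N j" using Some i by (intro measurable_restrict) (auto intro!: measurable_V)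
        have "branch i \<omega> = (\<lambda>w\<in>?L. ?X j \<omega> (i # w))" for \<omega>
          using i by (auto simp: Some tree_def subtree_def fun_eq_iff)
        hence "B = ?X j -` ((\<lambda>x. \<lambda>w\<in>?L. x (i # w)) -` E \<inter> space (?N j)) \<inter> space M"
          using measurable_space[OF X] E by auto
        thus "B \<in> {?X j -` A \<inter> space M | A. A \<in> sets (?N j)}"
          using measurable_sets[OF m E(2)] by blast
      qed
    qed
  qed
qed

lemma root_event: "A \<in> sets (weight_space b) \<Longrightarrow> {\<omega> \<in> space M. V [] \<omega> \<in> A} \<in> block_events None"
  by (auto simp: block_events_def)

lemma branch_event: "E \<in> sets (tree_space b) \<Longrightarrow> {\<omega> \<in> space M. branch i \<omega> \<in> E} \<in> block_events (Some i)"
  by (auto simp: block_events_def)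

lemma prob_root_branch:
  assumes "A \<in> sets (weight_space b)" "E \<in> sets (tree_space b)" "i < b"
  shows "\<P>(\<omega> in M. V [] \<omega> \<in> A \<and> branch i \<omega> \<in> E) =
    \<P>(\<omega> in M. V [] \<omega> \<in> A) * \<P>(\<omega> in M. tree \<omega> \<in> E)"
proof -
  let ?A = "\<lambda>j. case j of None \<Rightarrow> {\<omega> \<in> space M. V [] \<omega> \<in> A} | Some k \<Rightarrow> {\<omega> \<in> space M. branch k \<omega> \<in> E}"
  have "prob (\<Inter>j\<in>{None, Some i}. ?A j) = (\<Prod>j\<in>{None, Some i}. prob (?A j))"
    using assms by (intro indep_setsD[OF indep_blocks]) (auto intro: root_event branch_event)
  moreover have "(\<Inter>j\<in>{None, Some i}. ?A j) = {\<omega> \<in> space M. V [] \<omega> \<in> A \<and> branch i \<omega> \<in> E}" by auto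
  ultimately show ?thesis using assms by (simp add: prob_branch)
qed

lemma prob_root_two_branches:
  assumes "A \<in> sets (weight_space b)" "E \<in> sets (tree_space b)" "i < b" "j < b" "i \<noteq> j"
  shows "\<P>(\<omega> in M. V [] \<omega> \<in> A \<and> branch i \<omega> \<in> E \<and> branch j \<omega> \<in> E) =
    \<P>(\<omega> in M. V [] \<omega> \<in> A) * \<P>(\<omega> in M. tree \<omega> \<in> E)\<^sup>2"
proof -
  let ?A = "\<lambda>j. case j of None \<Rightarrow> {\<omega> \<in> space M. V [] \<omega> \<in> A} | Some k \<Rightarrow> {\<omega> \<in> space M. branch k \<omega> \<in> E}"
  have "prob (\<Inter>j\<in>{None, Some i, Some j}. ?A j) = (\<Prod>j\<in>{None, Some i, Some j}. prob (?A j))"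
    using assms by (intro indep_setsD[OF indep_blocks]) (auto intro: root_event branch_event)
  moreover have "(\<Inter>j\<in>{None, Some i, Some j}. ?A j) =
      {\<omega> \<in> space M. V [] \<omega> \<in> A \<and> branch i \<omega> \<in> E \<and> branch j \<omega> \<in> E}" by auto
  ultimately show ?thesis using assms by (simp add: prob_branch power2_eq_square)
qed

text \<open>
  The branching property in the form used for moments.
\<close>

lemma nn_integral_root_branch:
  assumes g [measurable]: "g \<in> borel_measurable (weight_space b)"
    and h [measurable]: "(h :: _ \<Rightarrow> ennreal) \<in> borel_measurable (tree_space b)" and i: "i < b"
  shows "(\<integral>\<^sup>+\<omega>. g (V [] \<omega>) * h (branch i \<omega>) \<partial>M) = (\<integral>\<^sup>+\<omega>. g (V [] \<omega>) \<partial>M) * (\<integral>\<^sup>+\<omega>. h (tree \<omega>) \<partial>M)"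
proof -
  let ?J = "{None, Some i}"
  let ?X = "\<lambda>j \<omega>. case j of None \<Rightarrow> g (V [] \<omega>) | Some k \<Rightarrow> h (branch k \<omega>)"
  have "indep_vars (\<lambda>_. borel) ?X ?J"
    unfolding indep_vars_def2
  proof
    show "\<forall>j\<in>?J. random_variable borel (?X j)" using i by auto
    show "indep_sets (\<lambda>j. {?X j -` A \<inter> space M | A. A \<in> sets borel}) ?J"
    proof (rule indep_sets_mono[OF indep_blocks])
      fix j assume j: "j \<in> ?J"
      show "{?X j -` A \<inter> space M | A. A \<in> sets borel} \<subseteq> block_events j"
      proof
        fix B assume "B \<in> {?X j -` A \<inter> space M | A. A \<in> sets borel}"
        then obtain A where A: "B = ?X j -` A \<inter> space M" "A \<in> sets borel" by blast
        show "B \<in> block_events j"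
        proof (cases j)
          case None
          have eq: "B = V [] -` (g -` A \<inter> space (weight_space b)) \<inter> space M"
            using measurable_space[OF measurable_root] A None by auto
          show ?thesis unfolding eq None block_events_def option.case
            using measurable_sets[OF g A(2)] by blast
        next
          case (Some k)
          hence "k = i" using j by auto
          have eq: "B = branch i -` (h -` A \<inter> space (tree_space b)) \<inter> space M"
            using measurable_space[OF measurable_branch[OF i]] A Some \<open>k = i\<close> by auto
          show ?thesis unfolding eq Some \<open>k = i\<close> block_events_def option.case
            using measurable_sets[OF h A(2)] by blast
        qed
      qed
    qed (use i in auto)
  qed
  hence "(\<integral>\<^sup>+\<omega>. (\<Prod>j\<in>?J. ?X j \<omega>) \<partial>M) = (\<Prod>j\<in>?J. \<integral>\<^sup>+\<omega>. ?X j \<omega> \<partial>M)"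
    by (intro indep_vars_nn_integral) auto
  hence "(\<integral>\<^sup>+\<omega>. g (V [] \<omega>) * h (branch i \<omega>) \<partial>M) = (\<integral>\<^sup>+\<omega>. g (V [] \<omega>) \<partial>M) * (\<integral>\<^sup>+\<omega>. h (branch i \<omega>) \<partial>M)"
    by simp
  also have "(\<integral>\<^sup>+\<omega>. h (branch i \<omega>) \<partial>M) = (\<integral>\<^sup>+x. h x \<partial>distr M (tree_space b) (branch i))"
    using i by (simp add: nn_integral_distr)
  also have "\<dots> = (\<integral>\<^sup>+\<omega>. h (tree \<omega>) \<partial>M)"
    using i by (simp add: branch_law nn_integral_distr)
  finally show ?thesis .
qed

definition limit_process :: "'a \<Rightarrow> real \<Rightarrow> complex" where
  "limit_process \<omega> = limit_cascade b (tree \<omega>)"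

lemma random_function_limit_process: "random_function M limit_process"
proof -
  have "limit_process \<in> M \<rightarrow>\<^sub>M path_space"
    unfolding limit_process_def[abs_def] by measurable
  thus ?thesis by (simp add: random_function_def limit_process_def continuous_limit_cascade)
qed

lemma limit_process_uniform_limit:
  assumes "tree \<omega> \<in> convergent_trees b"
  shows "uniform_limit {0..1} (\<lambda>n. cascade b V n \<omega>) (limit_process \<omega>) sequentially"
  using limit_cascade_uniform_limit[OF assms] unfolding limit_process_def
  by (rule uniform_limit_cong'[THEN iffD1, rotated 2]) (simp_all add: cascade_eq_tree)

text \<open>
  The copies are the limits for the trees of descendants of the children of the root. Stated under
  almost sure uniform convergence, because it serves the moment case and the critical case alike.
\<close>

theorem limit_process_scaling:
  assumes conv: "AE \<omega> in M. tree \<omega> \<in> convergent_trees b"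
  shows "scaling_property M b (V []) limit_process"
  unfolding scaling_property_def
proof (intro exI conjI)
  let ?G = "\<lambda>i \<omega>. limit_cascade b (branch i \<omega>)"
  show "\<forall>i<b. random_function M (?G i) \<and> distr M path_space (?G i) = distr M path_space limit_process"
  proof (intro allI impI conjI)
    fix i assume i: "i < b"
    have [measurable]: "branch i \<in> M \<rightarrow>\<^sub>M tree_space b" using i by (rule measurable_branch)
    have "?G i \<in> M \<rightarrow>\<^sub>M path_space" by measurable
    thus "random_function M (?G i)" by (simp add: random_function_def continuous_limit_cascade)
    have "distr M path_space (?G i) = distr (distr M (tree_space b) (branch i)) path_space (limit_cascade b)"
      by (subst distr_distr) (simp_all add: o_def)
    also have "\<dots> = distr (distr M (tree_space b) tree) path_space (limit_cascade b)"
      by (simp add: branch_law i)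
    also have "\<dots> = distr M path_space limit_process"
      by (subst distr_distr) (simp_all add: o_def limit_process_def[abs_def])
    finally show "distr M path_space (?G i) = distr M path_space limit_process" .
  qed
  show "indep_sets (\<lambda>j. case j of None \<Rightarrow> sets (vimage_algebra (space M) (V []) (weight_space b))
      | Some i \<Rightarrow> sets (vimage_algebra (space M) (?G i) path_space)) (insert None (Some ` {..<b}))"
  proof (rule indep_sets_mono_sets[OF indep_blocks])
    fix j assume j: "j \<in> insert None (Some ` {..<b})"
    show "(case j of None \<Rightarrow> sets (vimage_algebra (space M) (V []) (weight_space b))
      | Some i \<Rightarrow> sets (vimage_algebra (space M) (?G i) path_space)) \<subseteq> block_events j"
    proof (cases j)
      case None
      have "V [] \<in> space M \<rightarrow> space (weight_space b)" using measurable_space[OF measurable_root] by auto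
      thus ?thesis by (auto simp: None block_events_def sets_vimage_algebra2)
    next
      case (Some i)
      hence i: "i < b" using j by auto
      have sp: "branch i \<omega> \<in> space (tree_space b)" if "\<omega> \<in> space M" for \<omega>
        using measurable_space[OF measurable_branch[OF i] that] .
      hence "?G i \<in> space M \<rightarrow> space path_space"
        using measurable_space[OF measurable_limit_cascade] by auto
      moreover have "?G i -` A \<inter> space M \<in> block_events j" if "A \<in> sets path_space" for A
      proof -
        have eq: "?G i -` A \<inter> space M = branch i -` (limit_cascade b -` A \<inter> space (tree_space b)) \<inter> space M"
          using sp by auto
        show ?thesis unfolding Some eq block_events_def option.case
          using measurable_sets[OF measurable_limit_cascade that] by blast
      qed
      ultimately show ?thesis by (auto simp: Some sets_vimage_algebra2)
    qed
  qed
  have "AE \<omega> in M. \<forall>i\<in>{..<b}. branch i \<omega> \<in> convergent_trees b"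
    by (rule AE_finite_allI) (auto intro: AE_branch[OF conv])
  with conv AE_conservative
  show "AE \<omega> in M. \<forall>i<b. \<forall>t\<in>{real i / real b..(real i + 1) / real b}.
      limit_process \<omega> t = limit_process \<omega> (real i / real b) + V [] \<omega> i * ?G i \<omega> (inv (similitude b i) t)"
  proof eventually_elim
    case (elim \<omega>)
    show ?case
    proof (intro allI impI ballI)
      fix i t assume i: "i < b" and t: "t \<in> {real i / real b..(real i + 1) / real b}"
      have "similitude b i (real b * t - real i) = t" "inj (similitude b i)"
        using b_pos by (auto simp: similitude_def inj_def)
      hence inv: "inv (similitude b i) t = real b * t - real i" by (metis inv_f_f)
      have s: "real b * t - real i \<in> {0..1}" using t b_pos by (auto simp: field_simps)
      have sub: "branch i \<omega> \<in> convergent_trees b" using elim i by simp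
      note cell = limit_cascade_on_cell[OF elim(1) elim(2) i sub]
      have "limit_process \<omega> (real i / real b) = (\<Sum>k<i. V [] \<omega> k)"
        using cell[of 0] by (simp add: limit_process_def limit_cascade_0)
      moreover have "limit_process \<omega> t = (\<Sum>k<i. V [] \<omega> k) + V [] \<omega> i * ?G i \<omega> (real b * t - real i)"
        using cell[OF s] b_pos by (simp add: limit_process_def)
      ultimately show "limit_process \<omega> t =
          limit_process \<omega> (real i / real b) + V [] \<omega> i * ?G i \<omega> (inv (similitude b i) t)"
        by (simp add: inv)
    qed
  qed
qed

end

section \<open>Moments of order \<open>p\<close>: convergence and Hoelder continuity\<close>

text \<open>
  The sum over the words \<open>v\<close> of length \<open>n\<close> of \<open>(\<bar>Q v\<bar> (1 + \<Sum>i. \<bar>x v i\<bar>))\<^sup>p\<close>, arranged by the first letter so that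
  the branching property applies to each term.
\<close>

primrec level_sum :: "nat \<Rightarrow> real \<Rightarrow> nat \<Rightarrow> (nat list \<Rightarrow> nat \<Rightarrow> complex) \<Rightarrow> ennreal" where
  "level_sum b p 0 x = ennreal ((1 + (\<Sum>i<b. cmod (x [] i))) powr p)"
| "level_sum b p (Suc n) x =
     (\<Sum>i<b. ennreal (cmod (x [] i) powr p) * level_sum b p n (subtree [i] x))"

lemma level_sum_ge:
  "v \<in> words b n \<Longrightarrow>
     ennreal ((cmod (path_weight v x) * (1 + (\<Sum>i<b. cmod (x v i)))) powr p) \<le> level_sum b p n x"
proof (induction n arbitrary: v x)
  case 0 thus ?case by simp
next
  case (Suc n)
  then obtain i u where v: "v = i # u" "i < b" "u \<in> words b n" by (elim words_Suc_cases)
  let ?r = "cmod (path_weight u (subtree [i] x)) * (1 + (\<Sum>j<b. cmod (x v j)))"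
  have r: "ennreal (?r powr p) \<le> level_sum b p n (subtree [i] x)"
    using Suc.IH[OF v(3), of "subtree [i] x"] by (simp add: v subtree_def)
  have "(cmod (path_weight v x) * (1 + (\<Sum>j<b. cmod (x v j)))) powr p = (cmod (x [] i) * ?r) powr p"
    by (simp add: v norm_mult mult.assoc)
  also have "\<dots> = cmod (x [] i) powr p * ?r powr p"
    by (rule powr_mult)
  also have "ennreal \<dots> \<le> ennreal (cmod (x [] i) powr p) * level_sum b p n (subtree [i] x)"
    using mult_left_mono[OF r, of "ennreal (cmod (x [] i) powr p)"] by (simp add: ennreal_mult')
  also have "\<dots> \<le> level_sum b p (Suc n) x"
    using v(2) by (simp, intro member_le_sum) auto
  finally show ?case .
qed

lemma measurable_weight_power:
  "i < b \<Longrightarrow> (\<lambda>z. ennreal (cmod (z i) powr p)) \<in> borel_measurable (weight_space b)"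
  by measurable

lemma measurable_level_sum [measurable]: "level_sum b p n \<in> borel_measurable (tree_space b)"
proof (induction n)
  case 0
  have "(\<lambda>z. ennreal ((1 + (\<Sum>i<b. cmod (z i))) powr p)) \<in> borel_measurable (weight_space b)"
    by measurable
  from measurable_compose[OF measurable_vertex_tree_space[of "[]"] this]
  have "(\<lambda>x. ennreal ((1 + (\<Sum>i<b. cmod (x [] i))) powr p)) \<in> borel_measurable (tree_space b)"
    by simp
  thus ?case by (simp add: level_sum.simps[abs_def])
next
  case (Suc n)
  have "(\<lambda>x. level_sum b p n (subtree [i] x)) \<in> borel_measurable (tree_space b)" if "i < b" for i
    by (rule measurable_compose[OF measurable_subtree Suc]) (use that in auto)
  moreover have "(\<lambda>x. ennreal (cmod (x [] i) powr p)) \<in> borel_measurable (tree_space b)" if "i < b" for i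
    by (rule measurable_compose[OF measurable_vertex_tree_space measurable_weight_power[OF that]]) simp
  ultimately have "(\<lambda>x. \<Sum>i<b. ennreal (cmod (x [] i) powr p) * level_sum b p n (subtree [i] x))
      \<in> borel_measurable (tree_space b)"
    by (intro borel_measurable_sum borel_measurable_times_ennreal) auto
  thus ?case by (simp add: level_sum.simps[abs_def])
qed

text \<open>
  The factors make all generations comparable with \<open>\<theta>\<^sup>n\<close>. Bounding a maximum over \<open>k \<ge> n\<close> by a single sum
  avoids Minkowski's inequality in the proof of \<open>L\<^sup>p\<close> convergence.
\<close>

definition level_tail :: "nat \<Rightarrow> real \<Rightarrow> real \<Rightarrow> nat \<Rightarrow> (nat list \<Rightarrow> nat \<Rightarrow> complex) \<Rightarrow> ennreal" where
  "level_tail b p \<theta> n x = (\<Sum>k. ennreal ((1 / \<theta> powr p) ^ (n + k)) * level_sum b p (n + k) x)"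

lemma measurable_level_tail [measurable]: "level_tail b p \<theta> n \<in> borel_measurable (tree_space b)"
  unfolding level_tail_def[abs_def] by measurable

lemma level_tail_bound:
  assumes fin: "level_tail b p \<theta> n x < \<infinity>" and v: "v \<in> words b k" and k: "n \<le> k"
    and p: "0 < p" and \<theta>: "0 < \<theta>"
  shows "cmod (path_weight v x) * (1 + (\<Sum>i<b. cmod (x v i)))
      \<le> enn2real (level_tail b p \<theta> n x) powr (1 / p) * \<theta> ^ k"
proof -
  let ?q = "cmod (path_weight v x) * (1 + (\<Sum>i<b. cmod (x v i)))"
  let ?T = "enn2real (level_tail b p \<theta> n x)"
  have q0: "0 \<le> ?q" by (intro mult_nonneg_nonneg add_nonneg_nonneg sum_nonneg) auto
  have pos: "0 < (1 / \<theta> powr p) ^ k" using \<theta> by simp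
  have "ennreal ((1 / \<theta> powr p) ^ k * ?q powr p) = ennreal ((1 / \<theta> powr p) ^ k) * ennreal (?q powr p)"
    using pos by (intro ennreal_mult) auto
  also have "\<dots> \<le> ennreal ((1 / \<theta> powr p) ^ k) * level_sum b p k x"
    by (intro mult_left_mono level_sum_ge v) auto
  also have "\<dots> \<le> level_tail b p \<theta> n x"
    unfolding level_tail_def
    using sum_le_suminf[of "\<lambda>k. ennreal ((1 / \<theta> powr p) ^ (n + k)) * level_sum b p (n + k) x" "{k - n}"] k
    by simp
  also have "\<dots> = ennreal ?T" using fin by simp
  finally have "(1 / \<theta> powr p) ^ k * ?q powr p \<le> ?T" by simp
  hence "?q powr p \<le> ?T * (\<theta> powr p) ^ k" using pos \<theta> by (simp add: field_simps)
  hence "(?q powr p) powr (1 / p) \<le> (?T * (\<theta> powr p) ^ k) powr (1 / p)"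
    using p by (intro powr_mono2) auto
  also have "(?q powr p) powr (1 / p) = ?q" using p q0 by (simp add: powr_powr)
  also have "(?T * (\<theta> powr p) ^ k) powr (1 / p) = ?T powr (1 / p) * \<theta> ^ k"
  proof -
    have "(\<theta> powr p) ^ k = (\<theta> ^ k) powr p"
      using \<theta> by (simp add: powr_realpow[symmetric] powr_powr mult.commute)
    thus ?thesis using p \<theta> by (simp add: powr_mult powr_powr)
  qed
  finally show ?thesis .
qed

lemma tree_cascade_tail_bound:
  assumes "conservative b x" "level_tail b p \<theta> N x < \<infinity>" "0 < p" "0 < \<theta>" "\<theta> < 1" "0 < b"
    and "t \<in> {0..1}" "N \<le> n"
  shows "cmod (tree_cascade b (n + m) x t - tree_cascade b n x t)
      \<le> enn2real (level_tail b p \<theta> N x) powr (1 / p) * \<theta> ^ n / (1 - \<theta>)"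
  using assms by (intro tree_cascade_geometric_tail[where N = N] level_tail_bound) auto

context cascade_weights
begin

definition moment :: "real \<Rightarrow> ennreal" where
  "moment p = (\<integral>\<^sup>+\<omega>. (\<Sum>i<b. ennreal (cmod (V [] \<omega> i) powr p)) \<partial>M)"

lemma phi_eq: "phi M b (V []) p =
   (if moment p = \<infinity> then -\<infinity> else if moment p = 0 then \<infinity> else ereal (- log (real b) (enn2real (moment p))))"
  by (simp add: phi_def moment_def Let_def)

text \<open>
  The weights sum to 1, so they cannot all vanish.
\<close>

lemma moment_nonzero: "moment p \<noteq> 0"
proof
  assume "moment p = 0"
  hence "AE \<omega> in M. (\<Sum>i<b. ennreal (cmod (V [] \<omega> i) powr p)) = 0"
    unfolding moment_def by (subst (asm) nn_integral_0_iff_AE) auto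
  with sum_weights have "AE \<omega> in M. False"
  proof eventually_elim
    case (elim \<omega>)
    have "\<forall>i\<in>{..<b}. ennreal (cmod (V [] \<omega> i) powr p) = 0"
      using elim(2) by (subst (asm) sum_eq_0_iff) auto
    hence "\<forall>i<b. V [] \<omega> i = 0" by simp
    thus ?case using elim(1) by simp
  qed
  thus False using not_AE_zero_E AE_False emeasure_space_1 by simp
qed

lemma moment_less_of_phi:
  assumes "ereal c < phi M b (V []) p"
  shows "moment p < ennreal (real b powr - c)"
proof -
  have fin: "moment p \<noteq> \<infinity>" using assms by (auto simp: phi_eq)
  define m where "m = enn2real (moment p)"
  have m: "moment p = ennreal m" "0 < m"
    using fin moment_nonzero[of p] by (auto simp: m_def less_top enn2real_positive_iff zero_less_iff_neq_zero)
  have "c < - log b m" using assms fin moment_nonzero[of p] by (simp add: phi_eq m_def)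
  hence "log b m < - c" by simp
  hence "m < real b powr - c" using m b2 by (subst (asm) log_less_iff) auto
  thus ?thesis using m by (simp add: ennreal_less_iff)
qed

lemma top_level_moment_finite:
  assumes p: "0 < p" and fin: "moment p < \<infinity>"
  shows "(\<integral>\<^sup>+\<omega>. level_sum b p 0 (tree \<omega>) \<partial>M) < \<infinity>"
proof -
  have pt: "(1 + (\<Sum>i<b. cmod (z i))) powr p \<le> (1 + real b) powr p * (1 + (\<Sum>i<b. cmod (z i) powr p))" for z
  proof -
    let ?S = "1 + (\<Sum>i<b. cmod (z i) powr p)"
    let ?R = "?S powr (1 / p)"
    have S: "1 \<le> ?S" by (simp add: sum_nonneg)
    have "1 \<le> ?R" using S p by (intro ge_one_powr_ge_zero) auto
    moreover have "cmod (z i) \<le> ?R" if "i < b" for i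
    proof -
      have "cmod (z i) powr p \<le> (\<Sum>i<b. cmod (z i) powr p)"
        using that by (intro member_le_sum) auto
      hence "cmod (z i) powr p \<le> ?S" by simp
      hence "(cmod (z i) powr p) powr (1 / p) \<le> ?R" using p by (intro powr_mono2) auto
      thus ?thesis using p by (simp add: powr_powr)
    qed
    hence "(\<Sum>i<b. cmod (z i)) \<le> real b * ?R"
      using sum_bounded_above[of "{..<b}" "\<lambda>i. cmod (z i)" ?R] by simp
    ultimately have "1 + (\<Sum>i<b. cmod (z i)) \<le> (1 + real b) * ?R" by (simp add: algebra_simps)
    hence "(1 + (\<Sum>i<b. cmod (z i))) powr p \<le> ((1 + real b) * ?R) powr p"
      using p by (intro powr_mono2) (auto intro!: add_nonneg_nonneg sum_nonneg)
    also have "\<dots> = (1 + real b) powr p * ?S"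
      using p S by (simp add: powr_mult powr_powr)
    finally show ?thesis .
  qed
  have "(\<integral>\<^sup>+\<omega>. level_sum b p 0 (tree \<omega>) \<partial>M)
     \<le> (\<integral>\<^sup>+\<omega>. ennreal ((1 + real b) powr p) * (1 + (\<Sum>i<b. ennreal (cmod (V [] \<omega> i) powr p))) \<partial>M)"
  proof (rule nn_integral_mono)
    fix \<omega>
    have "level_sum b p 0 (tree \<omega>) \<le> ennreal ((1 + real b) powr p * (1 + (\<Sum>i<b. cmod (V [] \<omega> i) powr p)))"
      using pt[of "V [] \<omega>"] by (simp add: ennreal_leI)
    also have "\<dots> = ennreal ((1 + real b) powr p) * (1 + (\<Sum>i<b. ennreal (cmod (V [] \<omega> i) powr p)))"
      by (subst ennreal_mult) (auto simp: sum_nonneg ennreal_plus sum_ennreal)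
    finally show "level_sum b p 0 (tree \<omega>) \<le> \<dots>" .
  qed
  also have "\<dots> = ennreal ((1 + real b) powr p) * (1 + moment p)"
    unfolding moment_def by (subst nn_integral_cmult) (auto simp: nn_integral_add emeasure_space_1)
  also have "\<dots> < \<infinity>" using fin by (simp add: ennreal_mult_less_top)
  finally show ?thesis .
qed

lemma nn_integral_level_sum:
  "(\<integral>\<^sup>+\<omega>. level_sum b p n (tree \<omega>) \<partial>M) = moment p ^ n * (\<integral>\<^sup>+\<omega>. level_sum b p 0 (tree \<omega>) \<partial>M)"
proof (induction n)
  case (Suc n)
  have g: "(\<lambda>z. ennreal (cmod (z i) powr p)) \<in> borel_measurable (weight_space b)" if "i < b" for i
    using that by (rule measurable_weight_power)
  have gh: "(\<lambda>\<omega>. ennreal (cmod (V [] \<omega> i) powr p) * level_sum b p n (branch i \<omega>)) \<in> borel_measurable M"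
    if "i < b" for i
    using measurable_compose[OF measurable_root g[OF that]]
      measurable_compose[OF measurable_branch[OF that] measurable_level_sum] by (intro borel_measurable_times_ennreal)
  have "(\<integral>\<^sup>+\<omega>. level_sum b p (Suc n) (tree \<omega>) \<partial>M) =
     (\<Sum>i<b. \<integral>\<^sup>+\<omega>. ennreal (cmod (V [] \<omega> i) powr p) * level_sum b p n (branch i \<omega>) \<partial>M)"
    unfolding level_sum.simps tree_root by (rule nn_integral_sum) (use gh in auto)
  also have "\<dots> = (\<Sum>i<b. (\<integral>\<^sup>+\<omega>. ennreal (cmod (V [] \<omega> i) powr p) \<partial>M) * (\<integral>\<^sup>+\<omega>. level_sum b p n (tree \<omega>) \<partial>M))"
    by (intro sum.cong refl nn_integral_root_branch[OF g]) auto
  also have "\<dots> = moment p * (\<integral>\<^sup>+\<omega>. level_sum b p n (tree \<omega>) \<partial>M)"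
    unfolding moment_def by (subst nn_integral_sum) (auto simp: sum_distrib_right)
  finally show ?case by (simp add: Suc mult.assoc)
qed simp

lemma level_tail_expectation:
  assumes p: "0 < p" and \<theta>: "0 < \<theta>" and mom: "moment p < ennreal (\<theta> powr p)"
  shows "(\<integral>\<^sup>+\<omega>. level_tail b p \<theta> n (tree \<omega>) \<partial>M) < \<infinity>"
    and "(\<lambda>n. \<integral>\<^sup>+\<omega>. level_tail b p \<theta> n (tree \<omega>) \<partial>M) \<longlonglongrightarrow> 0"
proof -
  define m where "m = enn2real (moment p)"
  have fin: "moment p < \<infinity>" using less_trans[OF mom, of \<infinity>] by simp
  have m: "moment p = ennreal m" "0 \<le> m" using fin by (auto simp: m_def)
  have "m < \<theta> powr p" using mom m by (simp add: ennreal_less_iff)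
  define r where "r = m / \<theta> powr p"
  have r: "0 \<le> r" "r < 1" using m \<theta> \<open>m < \<theta> powr p\<close> by (auto simp: r_def)
  define K where "K = enn2real (\<integral>\<^sup>+\<omega>. level_sum b p 0 (tree \<omega>) \<partial>M)"
  have K: "(\<integral>\<^sup>+\<omega>. level_sum b p 0 (tree \<omega>) \<partial>M) = ennreal K" "0 \<le> K"
    using top_level_moment_finite[OF p fin] by (auto simp: K_def)
  have E: "(\<integral>\<^sup>+\<omega>. level_tail b p \<theta> n (tree \<omega>) \<partial>M) = ennreal (K * r ^ n / (1 - r))" for n
  proof -
    have "(\<integral>\<^sup>+\<omega>. level_tail b p \<theta> n (tree \<omega>) \<partial>M) =
       (\<Sum>k. \<integral>\<^sup>+\<omega>. ennreal ((1 / \<theta> powr p) ^ (n + k)) * level_sum b p (n + k) (tree \<omega>) \<partial>M)"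
      unfolding level_tail_def by (subst nn_integral_suminf) auto
    also have "\<dots> = (\<Sum>k. ennreal ((1 / \<theta> powr p) ^ (n + k)) * (ennreal m ^ (n + k) * ennreal K))"
      by (subst nn_integral_cmult) (auto simp: nn_integral_level_sum[of p "n + _"] m K simp del: level_sum.simps)
    also have "(\<lambda>k. ennreal ((1 / \<theta> powr p) ^ (n + k)) * (ennreal m ^ (n + k) * ennreal K)) =
        (\<lambda>k. ennreal (K * r ^ n * r ^ k))"
      using m K \<theta> by (auto simp: ennreal_power ennreal_mult[symmetric] r_def power_add power_divide field_simps)
    also have "(\<Sum>k. ennreal (K * r ^ n * r ^ k)) = ennreal (\<Sum>k. K * r ^ n * r ^ k)"
      using r K by (intro suminf_ennreal2) (auto intro!: summable_mult summable_geometric)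
    also have "(\<Sum>k. K * r ^ n * r ^ k) = K * r ^ n / (1 - r)"
      using r by (subst suminf_mult) (auto simp: suminf_geometric intro!: summable_geometric)
    finally show ?thesis .
  qed
  show "(\<integral>\<^sup>+\<omega>. level_tail b p \<theta> n (tree \<omega>) \<partial>M) < \<infinity>" by (simp add: E)
  have "(\<lambda>n. K * r ^ n / (1 - r)) \<longlonglongrightarrow> K * 0 / (1 - r)"
    using r by (intro tendsto_intros LIMSEQ_realpow_zero) auto
  hence "(\<lambda>n. ennreal (K * r ^ n / (1 - r))) \<longlonglongrightarrow> ennreal 0"
    by (intro tendsto_ennrealI) simp
  thus "(\<lambda>n. \<integral>\<^sup>+\<omega>. level_tail b p \<theta> n (tree \<omega>) \<partial>M) \<longlonglongrightarrow> 0" by (simp add: E)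
qed

lemma AE_level_tail_finite:
  assumes "0 < p" "0 < \<theta>" "moment p < ennreal (\<theta> powr p)"
  shows "AE \<omega> in M. level_tail b p \<theta> n (tree \<omega>) < \<infinity>"
proof -
  have "AE \<omega> in M. level_tail b p \<theta> n (tree \<omega>) \<noteq> \<infinity>"
    using level_tail_expectation(1)[OF assms, of n] by (intro nn_integral_noteq_infinite) auto
  thus ?thesis by (simp add: less_top)
qed

lemma convergent_of_level_tail:
  assumes "\<omega> \<in> space M" "conservative b (tree \<omega>)" "level_tail b p \<theta> N (tree \<omega>) < \<infinity>" "0 < p" "0 < \<theta>" "\<theta> < 1"
  shows "tree \<omega> \<in> convergent_trees b"
    and "N \<le> n \<Longrightarrow> t \<in> {0..1} \<Longrightarrow> cmod (tree_cascade b n (tree \<omega>) t - limit_process \<omega> t)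
      \<le> enn2real (level_tail b p \<theta> N (tree \<omega>)) powr (1 / p) * \<theta> ^ n / (1 - \<theta>)"
proof -
  let ?\<tau> = "enn2real (level_tail b p \<theta> N (tree \<omega>)) powr (1 / p)"
  have bd: "cmod (tree_cascade b (n + m) (tree \<omega>) t - tree_cascade b n (tree \<omega>) t) \<le> ?\<tau> * \<theta> ^ n / (1 - \<theta>)"
    if "t \<in> {0..1}" "N \<le> n" for t n m
    using assms that b_pos by (intro tree_cascade_tail_bound) auto
  have "uniformly_convergent_on {0..1} (\<lambda>n. tree_cascade b n (tree \<omega>))"
  proof (rule uniformly_convergent_onI_tail)
    fix \<epsilon> :: real assume "0 < \<epsilon>"
    have "(\<lambda>n. ?\<tau> * \<theta> ^ n / (1 - \<theta>)) \<longlonglongrightarrow> ?\<tau> * 0 / (1 - \<theta>)"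
      using assms by (intro tendsto_intros LIMSEQ_realpow_zero) auto
    hence "eventually (\<lambda>n. ?\<tau> * \<theta> ^ n / (1 - \<theta>) < \<epsilon>) sequentially"
      using \<open>0 < \<epsilon>\<close> by (intro order_tendstoD) auto
    then obtain n where "N \<le> n" "?\<tau> * \<theta> ^ n / (1 - \<theta>) < \<epsilon>"
      by (metis (no_types, lifting) eventually_sequentially nle_le)
    thus "\<exists>n. \<forall>m. \<forall>t\<in>{0..1}. cmod (tree_cascade b (n + m) (tree \<omega>) t - tree_cascade b n (tree \<omega>) t) \<le> \<epsilon>"
      using bd by (meson less_imp_le order_trans)
  qed
  thus conv: "tree \<omega> \<in> convergent_trees b"
    using measurable_space[OF measurable_tree assms(1)] by (simp add: convergent_trees_def)
  show "cmod (tree_cascade b n (tree \<omega>) t - limit_process \<omega> t) \<le> ?\<tau> * \<theta> ^ n / (1 - \<theta>)" if "N \<le> n" "t \<in> {0..1}" for n t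
  proof -
    have "(\<lambda>m. tree_cascade b (m + n) (tree \<omega>) t) \<longlonglongrightarrow> limit_process \<omega> t"
      unfolding limit_process_def by (rule LIMSEQ_ignore_initial_segment[OF limit_cascade_LIMSEQ[OF conv that(2)]])
    hence "(\<lambda>m. cmod (tree_cascade b (m + n) (tree \<omega>) t - tree_cascade b n (tree \<omega>) t)) \<longlonglongrightarrow> cmod (limit_process \<omega> t - tree_cascade b n (tree \<omega>) t)"
      by (intro tendsto_intros)
    hence "cmod (limit_process \<omega> t - tree_cascade b n (tree \<omega>) t) \<le> ?\<tau> * \<theta> ^ n / (1 - \<theta>)"
      using bd[OF that(2,1)] by (intro LIMSEQ_le_const2) (auto simp: add.commute)
    thus ?thesis by (simp add: norm_minus_commute)
  qed
qed

text \<open>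
  Any \<open>\<theta>\<close> whose power \<open>p\<close> lies strictly between the moment and 1 will do.
\<close>

lemma moment_rate:
  assumes p: "0 < p" and mom: "moment p < 1"
  obtains \<theta> where "0 < \<theta>" "\<theta> < 1" "moment p < ennreal (\<theta> powr p)"
proof -
  define m where "m = enn2real (moment p)"
  have m: "moment p = ennreal m" "0 \<le> m" using less_trans[OF mom, of \<infinity>] by (auto simp: m_def)
  have "m < 1" using mom m by (simp add: ennreal_less_one_iff)
  define \<theta> where "\<theta> = ((1 + m) / 2) powr (1 / p)"
  have "\<theta> powr p = (1 + m) / 2" using p m by (simp add: \<theta>_def powr_powr)
  moreover have "\<theta> < 1" using powr_less_mono2[of "1 / p" "(1 + m) / 2" 1] p m \<open>m < 1\<close> by (simp add: \<theta>_def)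
  moreover have "0 < \<theta>" using m by (simp add: \<theta>_def)
  ultimately show thesis using m \<open>m < 1\<close> by (intro that[of \<theta>]) (auto simp: ennreal_less_iff)
qed

lemma moment_less_1_of_phi: "0 < phi M b (V []) p \<Longrightarrow> moment p < 1"
  using moment_less_of_phi[of 0 p] b2 by (simp add: zero_ereal_def)

lemma AE_convergent:
  assumes p: "0 < p" and mom: "moment p < 1"
  shows "AE \<omega> in M. tree \<omega> \<in> convergent_trees b"
proof -
  obtain \<theta> where \<theta>: "0 < \<theta>" "\<theta> < 1" "moment p < ennreal (\<theta> powr p)" using moment_rate[OF assms] .
  show ?thesis
    using AE_space AE_conservative AE_level_tail_finite[OF p \<theta>(1,3), of 0]
    by eventually_elim (rule convergent_of_level_tail[OF _ _ _ p \<theta>(1,2)])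
qed

text \<open>
  The supremum of \<open>\<bar>F n - F\<bar>\<close> to the power \<open>p\<close> is at most a constant times \<open>level_tail\<close> from generation \<open>n\<close>
  on, whose expectation is the tail of a geometric series.
\<close>

theorem cascade_Lp_convergence:
  assumes p: "0 < p" and mom: "moment p < 1"
  shows "(\<lambda>n. \<integral>\<^sup>+\<omega>. ennreal (sup_norm (\<lambda>t. cascade b V n \<omega> t - limit_process \<omega> t) powr p) \<partial>M) \<longlonglongrightarrow> 0"
proof -
  obtain \<theta> where \<theta>: "0 < \<theta>" "\<theta> < 1" "moment p < ennreal (\<theta> powr p)" using moment_rate[OF assms] .
  let ?c = "(1 / (1 - \<theta>)) powr p"
  let ?I = "\<lambda>n. \<integral>\<^sup>+\<omega>. ennreal (sup_norm (\<lambda>t. cascade b V n \<omega> t - limit_process \<omega> t) powr p) \<partial>M"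
  have bd: "?I n \<le> ennreal ?c * (\<integral>\<^sup>+\<omega>. level_tail b p \<theta> n (tree \<omega>) \<partial>M)" for n
  proof -
    have "?I n \<le> (\<integral>\<^sup>+\<omega>. ennreal ?c * level_tail b p \<theta> n (tree \<omega>) \<partial>M)"
    proof (rule nn_integral_mono_AE)
      show "AE \<omega> in M. ennreal (sup_norm (\<lambda>t. cascade b V n \<omega> t - limit_process \<omega> t) powr p)
          \<le> ennreal ?c * level_tail b p \<theta> n (tree \<omega>)"
        using AE_space AE_conservative AE_level_tail_finite[OF p \<theta>(1,3), of n]
      proof eventually_elim
        case (elim \<omega>)
        define T where "T = enn2real (level_tail b p \<theta> n (tree \<omega>))"
        have T: "level_tail b p \<theta> n (tree \<omega>) = ennreal T" "0 \<le> T" using elim by (auto simp: T_def)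
        let ?s = "sup_norm (\<lambda>t. cascade b V n \<omega> t - limit_process \<omega> t)"
        have le: "cmod (cascade b V n \<omega> t - limit_process \<omega> t) \<le> T powr (1 / p) / (1 - \<theta>)"
          if t: "t \<in> {0..1}" for t
        proof -
          have "cmod (tree_cascade b n (tree \<omega>) t - limit_process \<omega> t) \<le> T powr (1 / p) * \<theta> ^ n / (1 - \<theta>)"
            using convergent_of_level_tail(2)[OF elim p \<theta>(1,2) order_refl t] by (simp add: T_def)
          also have "\<dots> \<le> T powr (1 / p) * 1 / (1 - \<theta>)"
            using \<theta> by (intro divide_right_mono mult_left_mono power_le_one) auto
          finally show ?thesis using t by (simp add: cascade_eq_tree)
        qed
        hence "?s \<le> T powr (1 / p) / (1 - \<theta>)"
          unfolding sup_norm_def by (intro cSUP_least) auto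
        moreover have "0 \<le> ?s"
        proof -
          have "cmod (cascade b V n \<omega> 0 - limit_process \<omega> 0) \<le> ?s"
            unfolding sup_norm_def using le by (intro cSUP_upper bdd_aboveI2) auto
          thus ?thesis using norm_ge_zero order_trans by blast
        qed
        ultimately have "?s powr p \<le> (T powr (1 / p) * (1 / (1 - \<theta>))) powr p"
          using p by (intro powr_mono2) auto
        also have "\<dots> = ?c * T"
          using p T by (subst powr_mult) (simp add: powr_powr mult.commute)
        finally have "ennreal (?s powr p) \<le> ennreal (?c * T)" by (rule ennreal_leI)
        also have "\<dots> = ennreal ?c * ennreal T" using T by (intro ennreal_mult) auto
        finally show ?case by (simp only: T(1))
      qed
    qed
    thus ?thesis by (simp add: nn_integral_cmult)
  qed
  have "(\<lambda>n. ennreal ?c * (\<integral>\<^sup>+\<omega>. level_tail b p \<theta> n (tree \<omega>) \<partial>M)) \<longlonglongrightarrow> ennreal ?c * 0"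
    by (rule ennreal_tendsto_cmult[OF _ level_tail_expectation(2)[OF p \<theta>(1,3)]]) simp
  hence "(\<lambda>n. ennreal ?c * (\<integral>\<^sup>+\<omega>. level_tail b p \<theta> n (tree \<omega>) \<partial>M)) \<longlonglongrightarrow> 0" by simp
  thus ?thesis
    by (rule tendsto_sandwich[OF _ _ tendsto_const, rotated 2]) (use bd in \<open>auto intro: always_eventually\<close>)
qed

theorem limit_process_nonneg_mono:
  assumes conv: "AE \<omega> in M. tree \<omega> \<in> convergent_trees b"
    and nonneg: "AE \<omega> in M. \<forall>i<b. V [] \<omega> i \<in> \<real>\<^sub>\<ge>\<^sub>0"
  shows "AE \<omega> in M. limit_process \<omega> ` {0..1} \<subseteq> \<real> \<and> mono_on {0..1} (\<lambda>t. Re (limit_process \<omega> t))"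
proof -
  have "{z \<in> space (weight_space b). z i \<in> \<real>\<^sub>\<ge>\<^sub>0} \<in> sets (weight_space b)" if "i < b" for i
    using borel_closed[OF closed_nonneg_Reals_complex]
    by (intro measurable_sets_Collect[OF measurable_component_weight_space[OF that]]) simp
  hence "{z \<in> space (weight_space b). \<forall>i\<in>{..<b}. z i \<in> \<real>\<^sub>\<ge>\<^sub>0} \<in> sets (weight_space b)"
    by (intro sets.sets_Collect_finite_All) auto
  hence "{z \<in> space (weight_space b). \<forall>i<b. z i \<in> \<real>\<^sub>\<ge>\<^sub>0} \<in> sets (weight_space b)"
    by (simp only: Ball_def lessThan_iff)
  from AE_all_vertices[OF nonneg this] conv show ?thesis
  proof eventually_elim
    case (elim \<omega>)
    have inc: "limit_process \<omega> t - limit_process \<omega> s \<in> \<real>\<^sub>\<ge>\<^sub>0"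
      if "s \<in> {0..1}" "t \<in> {0..1}" "s \<le> t" for s t
    proof (rule closed_sequentially[OF closed_nonneg_Reals_complex])
      show "tree_cascade b n (tree \<omega>) t - tree_cascade b n (tree \<omega>) s \<in> \<real>\<^sub>\<ge>\<^sub>0" for n
        using elim(1) that(3) by (intro tree_cascade_nonneg_mono) auto
      show "(\<lambda>n. tree_cascade b n (tree \<omega>) t - tree_cascade b n (tree \<omega>) s) \<longlonglongrightarrow> limit_process \<omega> t - limit_process \<omega> s"
        unfolding limit_process_def by (intro tendsto_intros limit_cascade_LIMSEQ elim(2) that)
    qed
    have "limit_process \<omega> t \<in> \<real>" if "t \<in> {0..1}" for t
      using inc[of 0 t] that by (auto simp: limit_process_def limit_cascade_0 elim: nonneg_Reals_cases)
    moreover have "Re (limit_process \<omega> s) \<le> Re (limit_process \<omega> t)"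
      if "s \<in> {0..1}" "t \<in> {0..1}" "s \<le> t" for s t
      using inc[OF that] by (simp add: complex_nonneg_Reals_iff)
    ultimately show ?case by (auto simp: mono_on_def)
  qed
qed

text \<open>
  The choice \<open>\<theta> = b powr - \<gamma>\<close> makes the approximation error and the increments of \<open>F n\<close> over cells of
  generation \<open>n\<close> both of order \<open>\<theta>\<^sup>n\<close>.
\<close>

lemma AE_holder_of_moment:
  assumes q: "0 < q" and \<gamma>: "0 < \<gamma>" and mom: "moment q < ennreal (real b powr - (\<gamma> * q))"
  shows "AE \<omega> in M. holder_on \<gamma> {0..1} (limit_process \<omega>)"
proof -
  define \<theta> where "\<theta> = real b powr - \<gamma>"
  have \<theta>: "0 < \<theta>" "\<theta> < 1" using b2 \<gamma> powr_less_cancel_iff[of "real b" "-\<gamma>" 0] by (auto simp: \<theta>_def)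
  have mom': "moment q < ennreal (\<theta> powr q)" using mom by (simp add: \<theta>_def powr_powr)
  show ?thesis
    using AE_space AE_conservative AE_level_tail_finite[OF q \<theta>(1) mom', of 0]
  proof eventually_elim
    case (elim \<omega>)
    define \<tau> where "\<tau> = enn2real (level_tail b q \<theta> 0 (tree \<omega>)) powr (1 / q)"
    show ?case
    proof (rule holder_onI_geometric[OF b2 _ _ \<theta>_def])
      show "0 \<le> \<tau> / (1 - \<theta>)" "0 \<le> \<tau>" using \<theta> by (auto simp: \<tau>_def)
      show "cmod (tree_cascade b n (tree \<omega>) t - limit_process \<omega> t) \<le> \<tau> / (1 - \<theta>) * \<theta> ^ n"
        if "t \<in> {0..1}" for n t
        using convergent_of_level_tail(2)[OF elim q \<theta> _ that, of n] by (simp add: \<tau>_def)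
      show "cmod (tree_cascade b n (tree \<omega>) s - tree_cascade b n (tree \<omega>) t) \<le> \<tau> * \<theta> ^ n * real b ^ n * \<bar>s - t\<bar>"
        if "s \<in> {0..1}" "t \<in> {0..1}" for n s t
      proof (rule tree_cascade_lipschitz[OF _ that b_pos])
        show "\<forall>v\<in>words b n. cmod (path_weight v (tree \<omega>)) \<le> \<tau> * \<theta> ^ n"
        proof
          fix v assume v: "v \<in> words b n"
          have "cmod (path_weight v (tree \<omega>)) * 1
              \<le> cmod (path_weight v (tree \<omega>)) * (1 + (\<Sum>i<b. cmod (tree \<omega> v i)))"
            by (intro mult_left_mono) (auto simp: sum_nonneg)
          also have "\<dots> \<le> \<tau> * \<theta> ^ n"
            unfolding \<tau>_def by (rule level_tail_bound[OF elim(3) v _ q \<theta>(1)]) simp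
          finally show "cmod (path_weight v (tree \<omega>)) \<le> \<tau> * \<theta> ^ n" by simp
        qed
      qed
    qed
  qed
qed

definition real_moment :: "real \<Rightarrow> real" where
  "real_moment r = (LINT \<omega>|M. (\<Sum>i<b. cmod (V [] \<omega> i) powr r))"

lemma measurable_power_sum [measurable]: "(\<lambda>\<omega>. \<Sum>i<b. cmod (V [] \<omega> i) powr r) \<in> borel_measurable M"
  by measurable

lemma power_sum_le:
  assumes "0 \<le> r" "r \<le> p"
  shows "(\<Sum>i<b. cmod (z i) powr r) \<le> real b + (\<Sum>i<b. cmod (z i) powr p)"
proof -
  have "cmod (z i) powr r \<le> 1 + cmod (z i) powr p" for i
  proof (cases "cmod (z i) \<le> 1")
    case True
    hence "cmod (z i) powr r \<le> 1 powr r" using assms by (intro powr_mono2) auto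
    moreover have "0 \<le> cmod (z i) powr p" by simp
    ultimately show ?thesis unfolding powr_one_eq_one by linarith
  next
    case False
    hence "cmod (z i) powr r \<le> cmod (z i) powr p" using assms by (intro powr_mono) auto
    thus ?thesis by simp
  qed
  hence "(\<Sum>i<b. cmod (z i) powr r) \<le> (\<Sum>i<b. 1 + cmod (z i) powr p)" by (intro sum_mono)
  thus ?thesis by (simp add: sum.distrib)
qed

lemma integrable_power_sum:
  assumes fin: "moment p < \<infinity>" and r: "0 \<le> r" "r \<le> p"
  shows "integrable M (\<lambda>\<omega>. \<Sum>i<b. cmod (V [] \<omega> i) powr r)"
proof -
  have "integrable M (\<lambda>\<omega>. \<Sum>i<b. cmod (V [] \<omega> i) powr p)"
    using fin by (intro integrableI_bounded) (auto simp: moment_def sum_ennreal sum_nonneg)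
  hence "integrable M (\<lambda>\<omega>. real b + (\<Sum>i<b. cmod (V [] \<omega> i) powr p))" by simp
  thus ?thesis
    by (rule Bochner_Integration.integrable_bound)
       (use power_sum_le[OF r] in \<open>auto simp: sum_nonneg intro!: AE_I2 order_trans[OF _ abs_ge_self]\<close>)
qed

lemma moment_eq_real_moment:
  assumes "moment p < \<infinity>" "0 \<le> r" "r \<le> p"
  shows "moment r = ennreal (real_moment r)" "0 < real_moment r"
    "phi M b (V []) r = ereal (- log b (real_moment r))"
proof -
  show m: "moment r = ennreal (real_moment r)"
    unfolding moment_def real_moment_def
    using nn_integral_eq_integral[OF integrable_power_sum[OF assms]] by (simp add: sum_ennreal sum_nonneg)
  show pos: "0 < real_moment r" using moment_nonzero[of r] by (simp add: m ennreal_eq_0_iff not_le)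
  show "phi M b (V []) r = ereal (- log b (real_moment r))"
    using pos by (simp add: phi_eq m ennreal_eq_0_iff)
qed

text \<open>
  Dominated convergence; \<open>power_sum_le\<close> provides the dominating function.
\<close>

lemma continuous_on_real_moment:
  assumes fin: "moment p < \<infinity>"
  shows "continuous_on {1..p} real_moment"
  unfolding continuous_on_sequentially
proof (intro allI ballI impI)
  fix x a assume a: "a \<in> {1..p}" and x: "(\<forall>n. x n \<in> {1..p}) \<and> x \<longlonglongrightarrow> a"
  show "(real_moment \<circ> x) \<longlonglongrightarrow> real_moment a"
    unfolding real_moment_def o_def
  proof (rule integral_dominated_convergence[where w = "\<lambda>\<omega>. real b + (\<Sum>i<b. cmod (V [] \<omega> i) powr p)"])
    have "1 \<le> p" using a by simp
    thus "integrable M (\<lambda>\<omega>. real b + (\<Sum>i<b. cmod (V [] \<omega> i) powr p))"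
      using integrable_power_sum[OF fin, of p] by simp
    show "AE \<omega> in M. (\<lambda>n. \<Sum>i<b. cmod (V [] \<omega> i) powr x n) \<longlonglongrightarrow> (\<Sum>i<b. cmod (V [] \<omega> i) powr a)"
    proof (rule AE_I2, rule tendsto_sum)
      fix \<omega> i
      show "(\<lambda>n. cmod (V [] \<omega> i) powr x n) \<longlonglongrightarrow> cmod (V [] \<omega> i) powr a"
        using x by (cases "V [] \<omega> i = 0") (auto intro!: tendsto_intros)
    qed
    show "AE \<omega> in M. norm (\<Sum>i<b. cmod (V [] \<omega> i) powr x n) \<le> real b + (\<Sum>i<b. cmod (V [] \<omega> i) powr p)" for n
    proof (rule AE_I2)
      fix \<omega>
      have "0 \<le> x n" "x n \<le> p" using x by (auto intro: order_trans[of 0 1])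
      thus "norm (\<Sum>i<b. cmod (V [] \<omega> i) powr x n) \<le> real b + (\<Sum>i<b. cmod (V [] \<omega> i) powr p)"
        using power_sum_le[of "x n" p] by (simp add: sum_nonneg)
    qed
  qed auto
qed

lemma real_moment_1_ge:
  assumes fin: "moment p < \<infinity>" "1 \<le> p"
  shows "1 \<le> real_moment 1"
proof -
  have "(LINT \<omega>|M. 1) \<le> real_moment 1"
    unfolding real_moment_def
  proof (rule integral_mono_AE)
    show "integrable M (\<lambda>\<omega>. \<Sum>i<b. cmod (V [] \<omega> i) powr 1)" by (rule integrable_power_sum[OF assms(1)]) (use assms(2) in auto)
    show "AE \<omega> in M. 1 \<le> (\<Sum>i<b. cmod (V [] \<omega> i) powr 1)"
      using sum_weights
    proof eventually_elim
      case (elim \<omega>)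
      thus ?case using norm_sum[of "V [] \<omega>" "{..<b}"] by simp
    qed
  qed simp
  thus ?thesis by (simp add: prob_space)
qed

text \<open>
  The quotient of \<open>phi\<close> and its argument is continuous on the closed interval from 1 to \<open>p\<close>. It is not
  positive at 1, because the moment of order 1 is at least 1, but positive at \<open>p\<close>; so its maximum is
  attained away from 1. Rational exponents suffice for a statement about all exponents at once.
\<close>

theorem optimal_holder_exponent:
  assumes p: "1 < p" and pos: "0 < phi M b (V []) p"
  obtains q where "q \<in> {1<..p}"
    "\<forall>r\<in>{1<..p}. phi M b (V []) r / ereal r \<le> phi M b (V []) q / ereal q"
    "AE \<omega> in M. \<forall>\<gamma>. 0 < \<gamma> \<and> ereal \<gamma> < phi M b (V []) q / ereal q \<longrightarrow> holder_on \<gamma> {0..1} (limit_process \<omega>)"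
proof -
  have fin: "moment p < \<infinity>" using less_trans[OF moment_less_1_of_phi[OF pos], of \<infinity>] by simp
  define f where "f = (\<lambda>r. - log b (real_moment r) / r)"
  have phi_f: "phi M b (V []) r / ereal r = ereal (f r)" "0 < real_moment r" if "r \<in> {1..p}" for r
    using moment_eq_real_moment[OF fin, of r] that by (auto simp: f_def)
  have "continuous_on {1..p} f"
    unfolding f_def using phi_f(2) b2
    by (intro continuous_intros continuous_on_real_moment[OF fin]) (auto simp: less_le)
  then obtain q where q: "q \<in> {1..p}" and max: "\<forall>r\<in>{1..p}. f r \<le> f q"
    using continuous_attains_sup[of "{1..p}" f] p by auto
  have "0 < ereal (- log b (real_moment p))"
    using pos moment_eq_real_moment(3)[OF fin, of p] p by simp
  hence "0 < f p" using p by (auto simp: f_def intro!: divide_neg_pos)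
  moreover have "f 1 \<le> 0" using real_moment_1_ge[OF fin] p b2 by (simp add: f_def)
  moreover have "f p \<le> f q" using max p by simp
  ultimately have "q \<noteq> 1" "0 < f q" by auto
  have q': "q \<in> {1<..p}" using q \<open>q \<noteq> 1\<close> by auto
  have rat: "AE \<omega> in M. \<forall>\<gamma>\<in>\<rat> \<inter> {0<..<f q}. holder_on \<gamma> {0..1} (limit_process \<omega>)"
  proof (rule AE_ball_countable[THEN iffD2])
    show "countable (\<rat> \<inter> {0<..<f q})" using countable_rat by (rule countable_Int1)
    show "\<forall>\<gamma>\<in>\<rat> \<inter> {0<..<f q}. AE \<omega> in M. holder_on \<gamma> {0..1} (limit_process \<omega>)"
    proof
      fix \<gamma> assume \<gamma>: "\<gamma> \<in> \<rat> \<inter> {0<..<f q}"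
      have "ereal (\<gamma> * q) < phi M b (V []) q"
      proof -
        have "\<gamma> * q < f q * q" using \<gamma> q by (intro mult_strict_right_mono) auto
        also have "f q * q = - log b (real_moment q)" using q by (simp add: f_def)
        finally show ?thesis using q moment_eq_real_moment(3)[OF fin, of q] by simp
      qed
      from moment_less_of_phi[OF this]
      show "AE \<omega> in M. holder_on \<gamma> {0..1} (limit_process \<omega>)"
        using \<gamma> q by (intro AE_holder_of_moment[of q]) (auto simp: mult.commute)
    qed
  qed
  show thesis
  proof (rule that[OF q'])
    show "\<forall>r\<in>{1<..p}. phi M b (V []) r / ereal r \<le> phi M b (V []) q / ereal q"
      using phi_f(1) max q by auto
    show "AE \<omega> in M. \<forall>\<gamma>. 0 < \<gamma> \<and> ereal \<gamma> < phi M b (V []) q / ereal q \<longrightarrow> holder_on \<gamma> {0..1} (limit_process \<omega>)"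
      using rat
    proof eventually_elim
      case (elim \<omega>)
      show ?case
      proof (intro allI impI)
        fix \<gamma> assume \<gamma>: "0 < \<gamma> \<and> ereal \<gamma> < phi M b (V []) q / ereal q"
        hence "\<gamma> < f q" using phi_f(1)[OF q] by simp
        then obtain \<gamma>' where "\<gamma>' \<in> \<rat>" "\<gamma> < \<gamma>'" "\<gamma>' < f q" using Rats_dense_in_real by blast
        hence "holder_on \<gamma>' {0..1} (limit_process \<omega>)" using elim \<gamma> by simp
        thus "holder_on \<gamma> {0..1} (limit_process \<omega>)" using \<open>\<gamma> < \<gamma>'\<close> by (rule holder_on_mono[OF _ less_imp_le])
      qed
    qed
  qed
qed

end

section \<open>The moment function in the critical case\<close>

lemma powr_tendsto_of_bool_at_top:
  assumes "0 \<le> (y::real)" "y \<le> 1"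
  shows "((\<lambda>p. y powr p) \<longlongrightarrow> of_bool (y = 1)) at_top"
proof -
  consider "y = 0" | "y = 1" | "0 < y" "y < 1" using assms by linarith
  thus ?thesis
  proof cases
    case 3
    have "((\<lambda>p. exp (ln y * p)) \<longlongrightarrow> 0) at_top"
      using 3 by (intro filterlim_compose[OF exp_at_bot] filterlim_tendsto_neg_mult_at_bot[OF tendsto_const])
        (auto intro: filterlim_ident)
    thus ?thesis using 3 by (simp add: powr_def mult.commute)
  qed auto
qed

context cascade_weights
begin

lemma prob_eq_1_bounded_weights:
  "\<P>(\<omega> in M. \<forall>i<b. cmod (V [] \<omega> i) \<le> 1) = 1 \<longleftrightarrow> (AE \<omega> in M. \<forall>i<b. cmod (V [] \<omega> i) \<le> 1)"
proof (rule prob_Collect_eq_1)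
  have "{\<omega> \<in> space M. \<forall>i\<in>{..<b}. cmod (V [] \<omega> i) \<le> 1} \<in> events"
    by (intro sets.sets_Collect_finite_All) auto
  thus "{\<omega> \<in> space M. \<forall>i<b. cmod (V [] \<omega> i) \<le> 1} \<in> events" by (simp only: Ball_def lessThan_iff)
qed

text \<open>
  The number of root weights of modulus 1; the critical case says that its mean is 1.
\<close>

definition unit_count :: "'a \<Rightarrow> real" where
  "unit_count \<omega> = (\<Sum>i<b. of_bool (cmod (V [] \<omega> i) = 1))"

lemma measurable_unit_count [measurable]: "unit_count \<in> borel_measurable M"
  unfolding unit_count_def[abs_def] by measurable

lemma integrable_unit_count: "integrable M unit_count"
proof (rule integrable_const_bound[where B = "real b"])
  show "AE \<omega> in M. norm (unit_count \<omega>) \<le> real b"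
  proof (rule AE_I2)
    fix \<omega>
    have "unit_count \<omega> \<le> (\<Sum>i<b. 1)" unfolding unit_count_def by (intro sum_mono) auto
    thus "norm (unit_count \<omega>) \<le> real b" by (simp add: unit_count_def sum_nonneg)
  qed
qed simp

lemma expectation_unit_count:
  "(LINT \<omega>|M. unit_count \<omega>) = (\<Sum>i<b. \<P>(\<omega> in M. cmod (V [] \<omega> i) = 1))"
proof -
  have eq: "of_bool (cmod (V [] \<omega> i) = 1) = indicator {\<omega> \<in> space M. cmod (V [] \<omega> i) = 1} \<omega>"
    if "\<omega> \<in> space M" for \<omega> i
    using that by (simp add: indicator_def)
  have "(LINT \<omega>|M. unit_count \<omega>) =
      (LINT \<omega>|M. (\<Sum>i<b. indicator {\<omega> \<in> space M. cmod (V [] \<omega> i) = 1} \<omega>))"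
    unfolding unit_count_def by (intro Bochner_Integration.integral_cong sum.cong refl eq)
  also have "\<dots> = (\<Sum>i<b. LINT \<omega>|M. indicator {\<omega> \<in> space M. cmod (V [] \<omega> i) = 1} \<omega>)"
    by (rule Bochner_Integration.integral_sum) (auto simp: emeasure_eq_measure)
  also have "\<dots> = (\<Sum>i<b. \<P>(\<omega> in M. cmod (V [] \<omega> i) = 1))"
    by (intro sum.cong) (auto simp: Int_absorb2 subset_eq)
  finally show ?thesis .
qed

text \<open>
  A random variable with mean 1 that stays on one side of 1 is equal to 1. Used in both directions below
  to exploit non-degeneracy.
\<close>

lemma AE_unit_count_eq_1:
  assumes E: "(LINT \<omega>|M. unit_count \<omega>) = 1"
    and "(AE \<omega> in M. 1 \<le> unit_count \<omega>) \<or> (AE \<omega> in M. unit_count \<omega> \<le> 1)"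
  shows "AE \<omega> in M. unit_count \<omega> = 1"
  using assms(2)
proof
  assume ge: "AE \<omega> in M. 1 \<le> unit_count \<omega>"
  have "(LINT \<omega>|M. unit_count \<omega> - 1) = 0" using E integrable_unit_count by (simp add: prob_space)
  hence "AE \<omega> in M. unit_count \<omega> - 1 = 0"
    using ge integrable_unit_count by (subst (asm) integral_nonneg_eq_0_iff_AE) auto
  thus ?thesis by simp
next
  assume le: "AE \<omega> in M. unit_count \<omega> \<le> 1"
  have "(LINT \<omega>|M. 1 - unit_count \<omega>) = 0" using E integrable_unit_count by (simp add: prob_space)
  hence "AE \<omega> in M. 1 - unit_count \<omega> = 0"
    using le integrable_unit_count by (subst (asm) integral_nonneg_eq_0_iff_AE) auto
  thus ?thesis by simp
qed

lemma prob_card_unit_eq_1: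
  "\<P>(\<omega> in M. card {i. i < b \<and> cmod (V [] \<omega> i) = 1} = 1) = 1 \<longleftrightarrow> (AE \<omega> in M. unit_count \<omega> = 1)"
proof -
  have "unit_count \<omega> = real (card {i. i < b \<and> cmod (V [] \<omega> i) = 1})" for \<omega>
  proof -
    have "{..<b} \<inter> {i. cmod (V [] \<omega> i) = 1} = {i. i < b \<and> cmod (V [] \<omega> i) = 1}" by auto
    thus ?thesis by (simp add: unit_count_def of_bool_def sum.If_cases)
  qed
  hence eq: "card {i. i < b \<and> cmod (V [] \<omega> i) = 1} = 1 \<longleftrightarrow> unit_count \<omega> = 1" for \<omega> by simp
  show ?thesis unfolding eq by (rule prob_Collect_eq_1) measurable
qed

lemma moment_finite_of_bounded:
  assumes bd: "AE \<omega> in M. \<forall>i<b. cmod (V [] \<omega> i) \<le> 1" and p: "0 \<le> p"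
  shows "moment p < \<infinity>"
proof -
  have "moment p \<le> (\<integral>\<^sup>+\<omega>. ennreal (real b) \<partial>M)"
    unfolding moment_def
  proof (rule nn_integral_mono_AE)
    show "AE \<omega> in M. (\<Sum>i<b. ennreal (cmod (V [] \<omega> i) powr p)) \<le> ennreal (real b)"
      using bd
    proof eventually_elim
      case (elim \<omega>)
      have "cmod (V [] \<omega> i) powr p \<le> 1" if "i < b" for i
        using powr_mono2[of p "cmod (V [] \<omega> i)" 1] elim that p by simp
      hence "(\<Sum>i<b. cmod (V [] \<omega> i) powr p) \<le> (\<Sum>i<b. 1)" by (intro sum_mono) auto
      thus ?case by (simp add: sum_ennreal ennreal_leI)
    qed
  qed
  also have "\<dots> < \<infinity>" by (simp add: emeasure_space_1)
  finally show ?thesis .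
qed

lemma real_moment_tendsto:
  assumes bd: "AE \<omega> in M. \<forall>i<b. cmod (V [] \<omega> i) \<le> 1"
  shows "(real_moment \<longlongrightarrow> (\<Sum>i<b. \<P>(\<omega> in M. cmod (V [] \<omega> i) = 1))) at_top"
  unfolding expectation_unit_count[symmetric] real_moment_def[abs_def]
proof (rule integral_dominated_convergence_at_top[where w = "\<lambda>_. real b"])
  show "AE \<omega> in M. ((\<lambda>p. \<Sum>i<b. cmod (V [] \<omega> i) powr p) \<longlongrightarrow> unit_count \<omega>) at_top"
    using bd
  proof eventually_elim
    case (elim \<omega>)
    show ?case unfolding unit_count_def
      using elim by (intro tendsto_sum powr_tendsto_of_bool_at_top) auto
  qed
  show "\<forall>\<^sub>F p in at_top. AE \<omega> in M. norm (\<Sum>i<b. cmod (V [] \<omega> i) powr p) \<le> real b"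
    using eventually_ge_at_top[of "0::real"]
  proof eventually_elim
    case (elim p)
    show ?case using bd
    proof eventually_elim
      case (elim \<omega>)
      have "cmod (V [] \<omega> i) powr p \<le> 1" if "i < b" for i
        using powr_mono2[of p "cmod (V [] \<omega> i)" 1] elim that \<open>0 \<le> p\<close> by simp
      hence "(\<Sum>i<b. cmod (V [] \<omega> i) powr p) \<le> (\<Sum>i<b. 1)" by (intro sum_mono) auto
      thus ?case by (simp add: sum_nonneg)
    qed
  qed
qed auto

lemma phi_bounded_weights:
  assumes bd: "AE \<omega> in M. \<forall>i<b. cmod (V [] \<omega> i) \<le> 1" and p: "0 \<le> p"
  shows "0 < real_moment p" "phi M b (V []) p = ereal (- log b (real_moment p))"
  using moment_eq_real_moment[OF moment_finite_of_bounded[OF bd p] p order_refl] by simp_all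

text \<open>
  If some weight were larger than \<open>c > 1\<close> with positive probability, the moment of order \<open>p\<close> would grow at
  least like \<open>c powr p\<close>, whereas it is eventually less than \<open>b\<close>.
\<close>

lemma bounded_weights_of_phi_limit:
  assumes lim: "(phi M b (V []) \<longlongrightarrow> 0) at_top"
  shows "AE \<omega> in M. \<forall>i<b. cmod (V [] \<omega> i) \<le> 1"
proof -
  have "\<forall>\<^sub>F p in at_top. ereal (- 1) < phi M b (V []) p"
    using lim by (rule order_tendstoD) simp
  hence ev: "\<forall>\<^sub>F p in at_top. moment p < ennreal (real b)"
    by eventually_elim (use b2 in \<open>auto dest: moment_less_of_phi\<close>)
  have null: "AE \<omega> in M. \<not> 1 + 1 / real (Suc k) \<le> cmod (V [] \<omega> i)" if i: "i < b" for i k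
  proof -
    define c where "c = 1 + 1 / real (Suc k)"
    let ?A = "{\<omega> \<in> space M. c \<le> cmod (V [] \<omega> i)}"
    have A: "?A \<in> events" using i by measurable
    have c: "1 < c" by (simp add: c_def)
    have le: "c powr p * prob ?A \<le> real b" if p: "0 \<le> p" "moment p < ennreal (real b)" for p
    proof -
      have "ennreal (c powr p * prob ?A) = (\<integral>\<^sup>+\<omega>. ennreal (c powr p) * indicator ?A \<omega> \<partial>M)"
        using A by (simp add: nn_integral_cmult_indicator emeasure_eq_measure ennreal_mult)
      also have "\<dots> \<le> moment p"
        unfolding moment_def
      proof (rule nn_integral_mono)
        fix \<omega> assume "\<omega> \<in> space M"
        show "ennreal (c powr p) * indicator ?A \<omega> \<le> (\<Sum>i<b. ennreal (cmod (V [] \<omega> i) powr p))"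
        proof (cases "\<omega> \<in> ?A")
          case True
          hence "ennreal (c powr p) \<le> ennreal (cmod (V [] \<omega> i) powr p)"
            using p c by (intro ennreal_leI powr_mono2) auto
          also have "\<dots> \<le> (\<Sum>i<b. ennreal (cmod (V [] \<omega> i) powr p))"
            using i by (intro member_le_sum) auto
          finally show ?thesis using True by simp
        qed simp
      qed
      also have "\<dots> \<le> ennreal (real b)" using p by simp
      finally show ?thesis by (simp add: ennreal_le_iff)
    qed
    have "prob ?A = 0"
    proof (rule ccontr)
      assume "prob ?A \<noteq> 0"
      hence pos: "0 < prob ?A" by (simp add: zero_less_measure_iff)
      have "filterlim (\<lambda>p. c powr p) at_top at_top"
      proof -
        have "filterlim (\<lambda>p::real. ln c * p) at_top at_top"
          by (rule filterlim_tendsto_pos_mult_at_top[OF tendsto_const ln_gt_zero[OF c] filterlim_ident])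
        hence "filterlim (\<lambda>p. exp (ln c * p)) at_top at_top" by (rule filterlim_compose[OF exp_at_top])
        moreover have "exp (ln c * p) = c powr p" for p using c by (simp add: powr_def mult.commute)
        ultimately show ?thesis by simp
      qed
      hence "\<forall>\<^sub>F p in at_top. real b / prob ?A < c powr p" by (simp add: filterlim_at_top_dense)
      with ev eventually_ge_at_top[of "0::real"] have "\<forall>\<^sub>F p::real in at_top. False"
      proof eventually_elim
        case (elim p)
        thus ?case using le[of p] pos by (simp add: pos_divide_less_eq)
      qed
      thus False by simp
    qed
    thus ?thesis using A unfolding c_def[symmetric] by (subst (asm) prob_eq_0) (auto elim: AE_mp intro: AE_I2)
  qed
  have "AE \<omega> in M. \<forall>i\<in>{..<b}. \<forall>k. \<not> 1 + 1 / real (Suc k) \<le> cmod (V [] \<omega> i)"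
    using null by (intro AE_finite_allI) (auto simp: AE_all_countable)
  thus ?thesis
  proof eventually_elim
    case (elim \<omega>)
    show ?case
    proof (intro allI impI)
      fix i assume i: "i < b"
      show "cmod (V [] \<omega> i) \<le> 1"
      proof (rule ccontr)
        assume "\<not> cmod (V [] \<omega> i) \<le> 1"
        then obtain k where "1 / real (Suc k) < cmod (V [] \<omega> i) - 1"
          using nat_approx_posE[of "cmod (V [] \<omega> i) - 1"] by auto
        thus False using elim i by (auto simp: not_le dest!: bspec[of _ _ i] spec[of _ k])
      qed
    qed
  qed
qed

text \<open>
  For weights of modulus at most 1 the moments converge to the mean number of weights of modulus 1, so
  \<open>phi\<close> tends to 0 exactly when this mean is 1.
\<close>

theorem phi_limit_iff:
  "(phi M b (V []) \<longlongrightarrow> 0) at_top \<longleftrightarrow>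
     (AE \<omega> in M. \<forall>i<b. cmod (V [] \<omega> i) \<le> 1) \<and> (\<Sum>i<b. \<P>(\<omega> in M. cmod (V [] \<omega> i) = 1)) = 1"
proof
  assume lim: "(phi M b (V []) \<longlongrightarrow> 0) at_top"
  note bd = bounded_weights_of_phi_limit[OF lim]
  have "\<forall>\<^sub>F p in at_top. phi M b (V []) p = ereal (- log b (real_moment p))"
    using eventually_ge_at_top[of "0::real"] by eventually_elim (rule phi_bounded_weights[OF bd])
  from Lim_transform_eventually[OF lim this]
  have "((\<lambda>p. - log b (real_moment p)) \<longlongrightarrow> 0) at_top" by (simp add: zero_ereal_def)
  from tendsto_minus[OF this] have "((\<lambda>p. real b powr log b (real_moment p)) \<longlongrightarrow> real b powr 0) at_top"
    using b2 by (intro tendsto_powr[OF tendsto_const]) auto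
  moreover have "\<forall>\<^sub>F p in at_top. real b powr log b (real_moment p) = real_moment p"
    using eventually_ge_at_top[of "0::real"]
    by eventually_elim (use phi_bounded_weights(1)[OF bd] b2 in auto)
  ultimately have "(real_moment \<longlongrightarrow> real b powr 0) at_top" by (rule Lim_transform_eventually)
  hence "(real_moment \<longlongrightarrow> 1) at_top" using b2 by simp
  from tendsto_unique[OF _ real_moment_tendsto[OF bd] this]
  show "(AE \<omega> in M. \<forall>i<b. cmod (V [] \<omega> i) \<le> 1) \<and> (\<Sum>i<b. \<P>(\<omega> in M. cmod (V [] \<omega> i) = 1)) = 1"
    using bd by simp
next
  assume *: "(AE \<omega> in M. \<forall>i<b. cmod (V [] \<omega> i) \<le> 1) \<and> (\<Sum>i<b. \<P>(\<omega> in M. cmod (V [] \<omega> i) = 1)) = 1"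
  hence bd: "AE \<omega> in M. \<forall>i<b. cmod (V [] \<omega> i) \<le> 1" by blast
  have "((\<lambda>p. - log b (real_moment p)) \<longlongrightarrow> - log b 1) at_top"
    using real_moment_tendsto[OF bd] * b2 by (intro tendsto_intros) auto
  hence "((\<lambda>p. ereal (- log b (real_moment p))) \<longlongrightarrow> 0) at_top" by (simp add: zero_ereal_def)
  moreover have "\<forall>\<^sub>F p in at_top. ereal (- log b (real_moment p)) = phi M b (V []) p"
    using eventually_ge_at_top[of "0::real"] by eventually_elim (simp add: phi_bounded_weights[OF bd])
  ultimately show "(phi M b (V []) \<longlongrightarrow> 0) at_top" by (rule Lim_transform_eventually)
qed

text \<open>
  If all weights had modulus 0 or 1, at least one would have modulus 1, since they sum to 1; then the
  number of weights of modulus 1 would be at least its mean, hence constant.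
\<close>

lemma not_all_weights_degenerate:
  assumes E: "(LINT \<omega>|M. unit_count \<omega>) = 1" and nd: "\<not> (AE \<omega> in M. unit_count \<omega> = 1)"
  shows "\<not> (AE \<omega> in M. \<forall>i<b. cmod (V [] \<omega> i) = 0 \<or> cmod (V [] \<omega> i) = 1)"
proof
  assume "AE \<omega> in M. \<forall>i<b. cmod (V [] \<omega> i) = 0 \<or> cmod (V [] \<omega> i) = 1"
  with sum_weights have "AE \<omega> in M. 1 \<le> unit_count \<omega>"
  proof eventually_elim
    case (elim \<omega>)
    have "\<exists>i<b. V [] \<omega> i \<noteq> 0" using elim(1) by (metis lessThan_iff sum.neutral zero_neq_one)
    then obtain i where i: "i < b" "cmod (V [] \<omega> i) = 1" using elim(2) by auto
    have "(of_bool (cmod (V [] \<omega> i) = 1) :: real) \<le> unit_count \<omega>"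
      unfolding unit_count_def using i by (intro member_le_sum) auto
    thus ?case using i by simp
  qed
  thus False using AE_unit_count_eq_1[OF E] nd by blast
qed

lemma powr_eq_imp_degenerate:
  assumes "0 \<le> (y::real)" "y \<le> 1" "p < q" "y powr p = y powr q"
  shows "y = 0 \<or> y = 1"
proof (rule ccontr)
  assume "\<not> (y = 0 \<or> y = 1)"
  hence "y powr q < y powr p" using assms by (intro powr_less_mono') auto
  thus False using assms by simp
qed

text \<open>
  Equality of two moments would force \<open>\<bar>W i\<bar> powr p = \<bar>W i\<bar> powr q\<close>, that is, \<open>\<bar>W i\<bar>\<close> equal to 0 or 1 for all \<open>i\<close>.
\<close>

lemma real_moment_strict_antimono:
  assumes bd: "AE \<omega> in M. \<forall>i<b. cmod (V [] \<omega> i) \<le> 1"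
    and E: "(LINT \<omega>|M. unit_count \<omega>) = 1" and nd: "\<not> (AE \<omega> in M. unit_count \<omega> = 1)"
    and p: "0 \<le> p" "p < q"
  shows "real_moment q < real_moment p"
proof (rule ccontr)
  assume "\<not> real_moment q < real_moment p"
  have int: "integrable M (\<lambda>\<omega>. \<Sum>i<b. cmod (V [] \<omega> i) powr r)" if "0 \<le> r" for r
    by (rule integrable_power_sum[OF moment_finite_of_bounded[OF bd that] that order_refl])
  let ?d = "\<lambda>\<omega>. (\<Sum>i<b. cmod (V [] \<omega> i) powr p - cmod (V [] \<omega> i) powr q)"
  have intd: "integrable M ?d"
    using int[of p] int[of q] p by (simp add: sum_subtractf)
  have nonneg: "0 \<le> cmod (V [] \<omega> i) powr p - cmod (V [] \<omega> i) powr q" if "cmod (V [] \<omega> i) \<le> 1" for \<omega> i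
    using p that by (cases "V [] \<omega> i = 0") (auto intro!: powr_mono')
  have nn: "AE \<omega> in M. 0 \<le> ?d \<omega>"
    using bd by eventually_elim (auto intro!: sum_nonneg nonneg)
  have "(LINT \<omega>|M. ?d \<omega>) = real_moment p - real_moment q"
    using int[of p] int[of q] p by (simp add: sum_subtractf real_moment_def)
  moreover have "0 \<le> (LINT \<omega>|M. ?d \<omega>)" using nn by (rule integral_nonneg_AE)
  ultimately have "(LINT \<omega>|M. ?d \<omega>) = 0" using \<open>\<not> real_moment q < real_moment p\<close> by simp
  hence "AE \<omega> in M. ?d \<omega> = 0" using integral_nonneg_eq_0_iff_AE[OF intd nn] by simp
  with bd have "AE \<omega> in M. \<forall>i<b. cmod (V [] \<omega> i) = 0 \<or> cmod (V [] \<omega> i) = 1"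
  proof eventually_elim
    case (elim \<omega>)
    have "\<forall>i\<in>{..<b}. cmod (V [] \<omega> i) powr p - cmod (V [] \<omega> i) powr q = 0"
      using elim(2) by (subst (asm) sum_nonneg_eq_0_iff) (use nonneg elim(1) in auto)
    thus ?case using elim(1) p by (auto dest!: powr_eq_imp_degenerate[rotated 3])
  qed
  thus False using not_all_weights_degenerate[OF E nd] by blast
qed

theorem critical_phi_strict_mono:
  assumes bd: "AE \<omega> in M. \<forall>i<b. cmod (V [] \<omega> i) \<le> 1"
    and E: "(LINT \<omega>|M. unit_count \<omega>) = 1" and nd: "\<not> (AE \<omega> in M. unit_count \<omega> = 1)"
  shows "strict_mono_on {0..} (phi M b (V []))"
proof (rule strict_mono_onI)
  fix r s :: real assume "r \<in> {0..}" "s \<in> {0..}" "r < s"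
  thus "phi M b (V []) r < phi M b (V []) s"
    using real_moment_strict_antimono[OF bd E nd, of r s] phi_bounded_weights[OF bd] b2 by simp
qed

theorem critical_phi_negative:
  assumes bd: "AE \<omega> in M. \<forall>i<b. cmod (V [] \<omega> i) \<le> 1"
    and E: "(LINT \<omega>|M. unit_count \<omega>) = 1" and nd: "\<not> (AE \<omega> in M. unit_count \<omega> = 1)"
    and p: "0 \<le> p"
  shows "phi M b (V []) p < 0"
proof -
  have "(LINT \<omega>|M. unit_count \<omega>) \<le> real_moment (p + 1)"
    unfolding real_moment_def
  proof (rule integral_mono_AE[OF integrable_unit_count])
    show "integrable M (\<lambda>\<omega>. \<Sum>i<b. cmod (V [] \<omega> i) powr (p + 1))"
      using p by (intro integrable_power_sum[OF moment_finite_of_bounded[OF bd, of "p + 1"]]) auto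
    show "AE \<omega> in M. unit_count \<omega> \<le> (\<Sum>i<b. cmod (V [] \<omega> i) powr (p + 1))"
      unfolding unit_count_def by (intro AE_I2 sum_mono) simp
  qed
  also have "\<dots> < real_moment p" using real_moment_strict_antimono[OF bd E nd p, of "p + 1"] by simp
  finally have "1 < real_moment p" by (simp only: E)
  thus ?thesis using phi_bounded_weights[OF bd p] b2 by (simp add: zero_ereal_def)
qed

text \<open>
  Otherwise the number of weights of modulus 1 would be at most its mean, hence constant.
\<close>

lemma two_unit_weights:
  assumes E: "(LINT \<omega>|M. unit_count \<omega>) = 1" and nd: "\<not> (AE \<omega> in M. unit_count \<omega> = 1)"
  shows "\<exists>i<b. \<exists>j<b. i \<noteq> j \<and> 0 < \<P>(\<omega> in M. cmod (V [] \<omega> i) = 1 \<and> cmod (V [] \<omega> j) = 1)"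
proof (rule ccontr)
  assume "\<not> ?thesis"
  hence zero: "\<P>(\<omega> in M. cmod (V [] \<omega> i) = 1 \<and> cmod (V [] \<omega> j) = 1) = 0"
    if "i < b" "j < b" "i \<noteq> j" for i j
    using that zero_less_measure_iff by blast
  have null: "AE \<omega> in M. \<not> (cmod (V [] \<omega> i) = 1 \<and> cmod (V [] \<omega> j) = 1)"
    if "i < b" "j < b" "i \<noteq> j" for i j
  proof -
    have "{\<omega> \<in> space M. cmod (V [] \<omega> i) = 1 \<and> cmod (V [] \<omega> j) = 1} \<in> events" using that by measurable
    from prob_eq_0[OF this] zero[OF that] show ?thesis by (auto elim: AE_mp intro: AE_I2)
  qed
  have "AE \<omega> in M. \<forall>i\<in>{..<b}. \<forall>j\<in>{..<b} - {i}. \<not> (cmod (V [] \<omega> i) = 1 \<and> cmod (V [] \<omega> j) = 1)"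
    using null by (intro AE_finite_allI) auto
  hence "AE \<omega> in M. unit_count \<omega> \<le> 1"
  proof eventually_elim
    case (elim \<omega>)
    show ?case
    proof (cases "\<exists>i<b. cmod (V [] \<omega> i) = 1")
      case True
      then obtain i where i: "i < b" "cmod (V [] \<omega> i) = 1" by blast
      hence "unit_count \<omega> = (\<Sum>j\<in>{i}. of_bool (cmod (V [] \<omega> j) = 1))"
        unfolding unit_count_def using elim by (intro sum.mono_neutral_right) auto
      also have "\<dots> \<le> 1" by (simp del: sum_of_bool_eq)
      finally show ?thesis .
    next
      case False
      hence "unit_count \<omega> = (\<Sum>j<b. 0)" unfolding unit_count_def by (intro sum.cong) auto
      thus ?thesis by simp
    qed
  qed
  thus False using AE_unit_count_eq_1[OF E] nd by blast
qed

end

section \<open>Extinction and loss of Hoelder continuity in the critical case\<close>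

lemma path_weight_append:
  "path_weight (u @ w) x = path_weight u x * path_weight w (subtree u x)"
  by (induction u arbitrary: x) auto

lemma path_weight_le_1:
  assumes "\<And>w i. w \<in> lists {..<b} \<Longrightarrow> i < b \<Longrightarrow> cmod (x w i) \<le> 1" "v \<in> lists {..<b}"
  shows "cmod (path_weight v x) \<le> 1"
  using assms
proof (induction v arbitrary: x)
  case (Cons i v)
  have "cmod (path_weight v (subtree [i] x)) \<le> 1"
    using Cons.prems by (intro Cons.IH) (auto simp: subtree_def)
  moreover have "cmod (x [] i) \<le> 1" using Cons.prems by auto
  ultimately show ?case by (simp add: norm_mult mult_le_one)
qed simp

text \<open>
  Weights of modulus at most 1 make \<open>\<bar>Q v\<bar>\<close> decrease along each branch. This allows one to pass to a
  generation that serves all children of the root at once.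
\<close>

lemma level_bound_antimono:
  assumes x: "\<And>w i. w \<in> lists {..<b} \<Longrightarrow> i < b \<Longrightarrow> cmod (x w i) \<le> 1"
    and c: "\<forall>v\<in>words b n. cmod (path_weight v x) \<le> c" and nm: "n \<le> m"
  shows "\<forall>v\<in>words b m. cmod (path_weight v x) \<le> c"
proof
  fix v assume v: "v \<in> words b m"
  have t: "take n v \<in> words b n" "drop n v \<in> lists {..<b}"
    using v nm by (auto simp: words_def dest: in_set_takeD in_set_dropD)
  have "cmod (path_weight v x) = cmod (path_weight (take n v) x) * cmod (path_weight (drop n v) (subtree (take n v) x))"
    using path_weight_append[of "take n v" "drop n v" x] by (simp add: norm_mult)
  also have "\<dots> \<le> cmod (path_weight (take n v) x) * 1"
    using t(1) by (intro mult_left_mono path_weight_le_1[OF _ t(2)]) (auto simp: subtree_def words_def intro!: x)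
  also have "\<dots> \<le> c" using c t(1) by simp
  finally show "cmod (path_weight v x) \<le> c" .
qed

definition surviving_trees :: "nat \<Rightarrow> real \<Rightarrow> (nat list \<Rightarrow> nat \<Rightarrow> complex) set" where
  "surviving_trees b y = {x \<in> space (tree_space b). \<forall>n. \<exists>v\<in>words b n. y < cmod (path_weight v x)}"

lemma surviving_trees_sets [measurable]: "surviving_trees b y \<in> sets (tree_space b)"
  unfolding surviving_trees_def
proof (intro sets.sets_Collect_countable_All sets.sets_Collect_finite_Ex finite_words)
  fix n v assume "v \<in> words b n"
  hence [measurable]: "path_weight v \<in> borel_measurable (tree_space b)"
    by (intro measurable_path_weight words_in_lists)
  show "{x \<in> space (tree_space b). y < cmod (path_weight v x)} \<in> sets (tree_space b)" by measurable
qed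

text \<open>
  The event \<open>K > \<beta>\<^sup>n\<close>, where \<open>K\<close> is the supremum of \<open>\<bar>Q v\<bar> \<beta> ^ length v\<close> over all words.
\<close>

definition exceeding_trees :: "nat \<Rightarrow> real \<Rightarrow> nat \<Rightarrow> (nat list \<Rightarrow> nat \<Rightarrow> complex) set" where
  "exceeding_trees b \<beta> n =
     {x \<in> space (tree_space b). \<exists>v\<in>lists {..<b}. \<beta> ^ n < cmod (path_weight v x) * \<beta> ^ length v}"

lemma exceeding_trees_sets [measurable]: "exceeding_trees b \<beta> n \<in> sets (tree_space b)"
  unfolding exceeding_trees_def
proof (intro sets.sets_Collect_countable_Ex' countable_lists countable_finite)
  fix v assume "v \<in> lists {..<b}"
  hence [measurable]: "path_weight v \<in> borel_measurable (tree_space b)" by (rule measurable_path_weight)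
  show "{x \<in> space (tree_space b). \<beta> ^ n < cmod (path_weight v x) * \<beta> ^ length v} \<in> sets (tree_space b)"
    by measurable
qed simp

lemma exceeding_trees_decseq: "1 < \<beta> \<Longrightarrow> n \<le> m \<Longrightarrow> exceeding_trees b \<beta> m \<subseteq> exceeding_trees b \<beta> n"
  unfolding exceeding_trees_def using power_increasing[of n m \<beta>] by (blast intro: le_less_trans less_imp_le)

lemma exceeding_trees_of_branch:
  assumes x: "x \<in> space (tree_space b)" and i: "i < b" and \<beta>: "0 < \<beta>"
    and sub: "subtree [i] x \<in> exceeding_trees b \<beta> m" and w: "\<beta> ^ n \<le> cmod (x [] i) * \<beta> ^ Suc m" "x [] i \<noteq> 0"
  shows "x \<in> exceeding_trees b \<beta> n"
proof -
  obtain v where v: "v \<in> lists {..<b}" "\<beta> ^ m < cmod (path_weight v (subtree [i] x)) * \<beta> ^ length v"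
    using sub by (auto simp: exceeding_trees_def)
  have "\<beta> ^ n \<le> cmod (x [] i) * \<beta> * \<beta> ^ m" using w by (simp add: mult.assoc)
  also have "\<dots> < cmod (x [] i) * \<beta> * (cmod (path_weight v (subtree [i] x)) * \<beta> ^ length v)"
    using v(2) \<beta> w(2) by (intro mult_strict_left_mono) auto
  also have "\<dots> = cmod (path_weight (i # v) x) * \<beta> ^ length (i # v)" by (simp add: norm_mult)
  finally show ?thesis using x v(1) i unfolding exceeding_trees_def by (auto intro!: bexI[of _ "i # v"])
qed

definition unbounded_trees :: "nat \<Rightarrow> real \<Rightarrow> (nat list \<Rightarrow> nat \<Rightarrow> complex) set" where
  "unbounded_trees b \<beta> = (\<Inter>n. exceeding_trees b \<beta> n)"

lemma unbounded_trees_sets [measurable]: "unbounded_trees b \<beta> \<in> sets (tree_space b)"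
  unfolding unbounded_trees_def by (intro sets.countable_INT) auto

lemma unbounded_trees_of_branch:
  assumes x: "x \<in> space (tree_space b)" and i: "i < b" and \<beta>: "1 < \<beta>"
    and sub: "subtree [i] x \<in> unbounded_trees b \<beta>" and w: "x [] i \<noteq> 0"
  shows "x \<in> unbounded_trees b \<beta>"
  unfolding unbounded_trees_def
proof
  fix n
  obtain m where "\<beta> ^ n / cmod (x [] i) < \<beta> ^ m" using real_arch_pow[OF \<beta>] by blast
  also have "\<beta> ^ m \<le> \<beta> ^ Suc m" using \<beta> by (intro power_increasing) auto
  finally have "\<beta> ^ n \<le> cmod (x [] i) * \<beta> ^ Suc m" using w by (simp add: field_simps)
  thus "x \<in> exceeding_trees b \<beta> n"
    using sub \<beta> w by (intro exceeding_trees_of_branch[OF x i, of _ m]) (auto simp: unbounded_trees_def)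
qed

lemma not_unbounded_of_bound:
  assumes \<beta>: "1 < \<beta>" and C: "\<And>n v. v \<in> words b n \<Longrightarrow> cmod (path_weight v x) * \<beta> ^ n \<le> C"
  shows "x \<notin> unbounded_trees b \<beta>"
proof
  assume x: "x \<in> unbounded_trees b \<beta>"
  obtain n where n: "C < \<beta> ^ n" using real_arch_pow[OF \<beta>] by blast
  obtain v where "v \<in> lists {..<b}" "\<beta> ^ n < cmod (path_weight v x) * \<beta> ^ length v"
    using x by (auto simp: unbounded_trees_def exceeding_trees_def)
  thus False using C[of v "length v"] n by (simp add: words_def)
qed

text \<open>
  Where \<open>u\<close> is small the recursion gives \<open>u (n + 1) \<ge> u n / 2\<close>, so \<open>u (n + l)\<close> is at least \<open>u n\<close> divided by \<open>2\<^sup>l\<close>;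
  monotonicity and the recursion give \<open>\<eta> * u (n + l) \<le> c * (u n)\<^sup>2\<close>. Together they keep \<open>u\<close> away from 0.
\<close>

lemma no_slowly_decaying_sequence:
  fixes u :: "nat \<Rightarrow> real"
  assumes pos: "\<And>n. 0 < u n" and dec: "\<And>n. u (Suc n) \<le> u n" and lim: "u \<longlonglongrightarrow> 0"
    and \<eta>: "0 < \<eta>" and c: "0 \<le> c"
    and rec: "\<And>n. u n + \<eta> * u (n + l) - c * (u n)\<^sup>2 \<le> u (Suc n)"
  shows False
proof -
  have "eventually (\<lambda>n. u n < 1 / (2 * (c + 1))) sequentially" "eventually (\<lambda>n. u n < \<eta> / (2 ^ l * (c + 1))) sequentially"
    using lim c \<eta> by (auto intro!: order_tendstoD(2)[OF lim])
  then obtain N where N: "\<And>n. N \<le> n \<Longrightarrow> u n < 1 / (2 * (c + 1))" "u N < \<eta> / (2 ^ l * (c + 1))"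
    unfolding eventually_sequentially by (metis le_trans nle_le)
  have half: "u n / 2 \<le> u (Suc n)" if "N \<le> n" for n
  proof -
    have "c * u n \<le> (c + 1) * (1 / (2 * (c + 1)))"
      using N(1)[OF that] pos[of n] c by (intro mult_mono) (auto intro: less_imp_le)
    moreover have "(c + 1) * (1 / (2 * (c + 1))) = 1 / 2" using c by (simp add: field_simps)
    ultimately have "c * u n \<le> 1 / 2" by linarith
    hence "c * u n * u n \<le> 1 / 2 * u n" using pos[of n] by (intro mult_right_mono) auto
    moreover have "0 \<le> \<eta> * u (n + l)" using \<eta> pos[of "n + l"] by simp
    ultimately show ?thesis using rec[of n] by (simp add: power2_eq_square mult.assoc)
  qed
  have "u N / 2 ^ k \<le> u (N + k)" for k
  proof (induction k)
    case (Suc k)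
    have "u N / 2 ^ Suc k = (u N / 2 ^ k) / 2" by simp
    also have "\<dots> \<le> u (N + k) / 2" using Suc by (intro divide_right_mono) auto
    also have "\<dots> \<le> u (N + Suc k)" using half[of "N + k"] by simp
    finally show ?case .
  qed simp
  hence "\<eta> * (u N / 2 ^ l) \<le> \<eta> * u (N + l)" using \<eta> by (intro mult_left_mono) auto
  also have "\<dots> \<le> c * (u N)\<^sup>2" using rec[of N] dec[of N] by linarith
  also have "\<dots> \<le> (c + 1) * (u N)\<^sup>2" by (intro mult_right_mono) auto
  finally have "(\<eta> / 2 ^ l) * u N \<le> ((c + 1) * u N) * u N" by (simp add: power2_eq_square algebra_simps)
  hence "\<eta> / 2 ^ l \<le> (c + 1) * u N" using pos[of N] by (rule mult_right_le_imp_le)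
  moreover have "(c + 1) * u N < (c + 1) * (\<eta> / (2 ^ l * (c + 1)))"
    using N(2) c by (intro mult_strict_left_mono) auto
  moreover have "(c + 1) * (\<eta> / (2 ^ l * (c + 1))) = \<eta> / 2 ^ l" using c by simp
  ultimately show False by linarith
qed

context prob_space
begin

lemma prob_union_le_minus_pair:
  assumes "finite I" "\<And>i. i \<in> I \<Longrightarrow> A i \<in> events" "i \<in> I" "j \<in> I" "i \<noteq> j"
  shows "prob (\<Union>i\<in>I. A i) + prob (A i \<inter> A j) \<le> (\<Sum>i\<in>I. prob (A i))"
proof -
  have ev: "(\<Union>i\<in>I - {i}. A i) \<in> events" using assms by (intro sets.finite_UN) auto
  have un: "(\<Union>i\<in>I. A i) = A i \<union> (\<Union>i\<in>I - {i}. A i)" using assms(3) by auto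
  have "prob (A i \<inter> A j) \<le> prob (A i \<inter> (\<Union>i\<in>I - {i}. A i))"
    using assms ev by (intro finite_measure_mono) auto
  moreover have "prob (\<Union>i\<in>I. A i) = prob (A i) + prob (\<Union>i\<in>I - {i}. A i) - prob (A i \<inter> (\<Union>i\<in>I - {i}. A i))"
    unfolding un using assms ev by (intro measure_Un3) (auto simp: fmeasurable_eq_sets)
  moreover have "prob (\<Union>i\<in>I - {i}. A i) \<le> (\<Sum>i\<in>I - {i}. prob (A i))"
    using assms by (intro finite_measure_subadditive_finite) auto
  moreover have "(\<Sum>i\<in>I. prob (A i)) = prob (A i) + (\<Sum>i\<in>I - {i}. prob (A i))"
    using assms by (simp add: sum.remove)
  ultimately show ?thesis by linarith
qed

text \<open>
  The second Bonferroni inequality with the square of the number of events as a crude count of the pairs.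
\<close>

lemma prob_union_ge:
  assumes "finite I" "\<And>i. i \<in> I \<Longrightarrow> A i \<in> events" and d: "0 \<le> d"
    and "\<And>i j. i \<in> I \<Longrightarrow> j \<in> I \<Longrightarrow> i \<noteq> j \<Longrightarrow> prob (A i \<inter> A j) \<le> d"
  shows "(\<Sum>i\<in>I. prob (A i)) - (real (card I))\<^sup>2 * d \<le> prob (\<Union>i\<in>I. A i)"
  using assms(1,2,4)
proof (induction I rule: finite_induct)
  case empty thus ?case by simp
next
  case (insert a I)
  have Aa: "A a \<in> events" and AI: "\<And>i. i \<in> I \<Longrightarrow> A i \<in> events" using insert.prems(1) by blast+
  have IH: "(\<Sum>i\<in>I. prob (A i)) - (real (card I))\<^sup>2 * d \<le> prob (\<Union>i\<in>I. A i)"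
    by (rule insert.IH) (use insert.prems in blast)+
  have U: "(\<Union>i\<in>I. A i) \<in> events" using insert.hyps(1) AI by (rule sets.finite_UN)
  have "A a \<inter> (\<Union>i\<in>I. A i) = (\<Union>i\<in>I. A a \<inter> A i)" by blast
  hence "prob (A a \<inter> (\<Union>i\<in>I. A i)) = prob (\<Union>i\<in>I. A a \<inter> A i)" by simp
  also have "\<dots> \<le> (\<Sum>i\<in>I. prob (A a \<inter> A i))"
    using insert.hyps(1) Aa AI by (intro finite_measure_subadditive_finite image_subsetI sets.Int)
  also have "\<dots> \<le> (\<Sum>i\<in>I. d)"
    using insert.hyps(2) by (intro sum_mono insert.prems(2)) auto
  finally have int: "prob (A a \<inter> (\<Union>i\<in>I. A i)) \<le> real (card I) * d" by simp
  have un: "prob (A a \<union> (\<Union>i\<in>I. A i)) = prob (A a) + prob (\<Union>i\<in>I. A i) - prob (A a \<inter> (\<Union>i\<in>I. A i))"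
    using Aa U by (intro measure_Un3) (auto simp: fmeasurable_eq_sets)
  have "(real (card (insert a I)))\<^sup>2 * d = (real (card I))\<^sup>2 * d + 2 * (real (card I) * d) + d"
    using insert.hyps by (simp add: power2_eq_square algebra_simps)
  moreover have "0 \<le> real (card I) * d" using d by simp
  moreover have "(\<Sum>i\<in>insert a I. prob (A i)) = prob (A a) + (\<Sum>i\<in>I. prob (A i))"
    using insert.hyps by simp
  moreover have "prob (\<Union>i\<in>insert a I. A i) = prob (A a \<union> (\<Union>i\<in>I. A i))" by simp
  ultimately show ?case using int un IH d by linarith
qed

end

context cascade_weights
begin

lemma unit_set: "i < b \<Longrightarrow> {z \<in> space (weight_space b). cmod (z i) = 1} \<in> sets (weight_space b)"
  by measurable

lemma root_in_space: "\<omega> \<in> space M \<Longrightarrow> V [] \<omega> \<in> space (weight_space b)"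
  by (rule measurable_space[OF measurable_root])

lemma tree_in_space: "\<omega> \<in> space M \<Longrightarrow> tree \<omega> \<in> space (tree_space b)"
  by (rule measurable_space[OF measurable_tree])

lemma prob_root_branch_pred:
  assumes R: "{z \<in> space (weight_space b). R z} \<in> sets (weight_space b)" and E: "E \<in> sets (tree_space b)" and i: "i < b"
  shows "\<P>(\<omega> in M. R (V [] \<omega>) \<and> branch i \<omega> \<in> E) = \<P>(\<omega> in M. R (V [] \<omega>)) * \<P>(\<omega> in M. tree \<omega> \<in> E)"
proof -
  have "{\<omega> \<in> space M. R (V [] \<omega>)} = {\<omega> \<in> space M. V [] \<omega> \<in> {z \<in> space (weight_space b). R z}}"
    "{\<omega> \<in> space M. R (V [] \<omega>) \<and> branch i \<omega> \<in> E} =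
     {\<omega> \<in> space M. V [] \<omega> \<in> {z \<in> space (weight_space b). R z} \<and> branch i \<omega> \<in> E}"
    using root_in_space by auto
  thus ?thesis using prob_root_branch[OF R E i] by simp
qed

lemma prob_root_two_branches_pred:
  assumes R: "{z \<in> space (weight_space b). R z} \<in> sets (weight_space b)" and E: "E \<in> sets (tree_space b)"
    and ij: "i < b" "j < b" "i \<noteq> j"
  shows "\<P>(\<omega> in M. R (V [] \<omega>) \<and> branch i \<omega> \<in> E \<and> branch j \<omega> \<in> E) =
    \<P>(\<omega> in M. R (V [] \<omega>)) * \<P>(\<omega> in M. tree \<omega> \<in> E)\<^sup>2"
proof -
  have "{\<omega> \<in> space M. R (V [] \<omega>)} = {\<omega> \<in> space M. V [] \<omega> \<in> {z \<in> space (weight_space b). R z}}"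
    "{\<omega> \<in> space M. R (V [] \<omega>) \<and> branch i \<omega> \<in> E \<and> branch j \<omega> \<in> E} =
     {\<omega> \<in> space M. V [] \<omega> \<in> {z \<in> space (weight_space b). R z} \<and> branch i \<omega> \<in> E \<and> branch j \<omega> \<in> E}"
    using root_in_space by auto
  thus ?thesis using prob_root_two_branches[OF R E ij] by simp
qed

lemma tree_event_measurable: "E \<in> sets (tree_space b) \<Longrightarrow> {\<omega> \<in> space M. tree \<omega> \<in> E} \<in> events"
  using measurable_sets[OF measurable_tree] by (simp add: vimage_def Int_def conj_commute)

lemma branch_event_measurable:
  "E \<in> sets (tree_space b) \<Longrightarrow> i < b \<Longrightarrow> {\<omega> \<in> space M. branch i \<omega> \<in> E} \<in> events"
  using measurable_sets[OF measurable_branch] by (simp add: vimage_def Int_def conj_commute)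

lemma root_event_measurable:
  assumes "{z \<in> space (weight_space b). R z} \<in> sets (weight_space b)"
  shows "{\<omega> \<in> space M. R (V [] \<omega>)} \<in> events"
  using measurable_sets_Collect[OF measurable_root assms] .

lemma root_branch_event:
  assumes "{z \<in> space (weight_space b). R z} \<in> sets (weight_space b)" "E \<in> sets (tree_space b)" "i < b"
  shows "{\<omega> \<in> space M. R (V [] \<omega>) \<and> branch i \<omega> \<in> E} \<in> events"
  by (intro sets.sets_Collect_conj root_event_measurable branch_event_measurable assms)

lemma AE_not_in_null_tree_event:
  assumes "E \<in> sets (tree_space b)" "\<P>(\<omega> in M. tree \<omega> \<in> E) = 0"
  shows "AE \<omega> in M. tree \<omega> \<notin> E"
  using prob_eq_0[OF tree_event_measurable[OF assms(1)]] assms(2) by (auto elim: AE_mp intro: AE_I2)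

end

locale critical_cascade = cascade_weights +
  assumes weights_le_1: "AE \<omega> in M. \<forall>i<b. cmod (V [] \<omega> i) \<le> 1"
    and unit_sum: "(\<Sum>i<b. \<P>(\<omega> in M. cmod (V [] \<omega> i) = 1)) = 1"
    and nondegenerate: "\<not> (AE \<omega> in M. unit_count \<omega> = 1)"
begin

lemma unit_expectation: "(LINT \<omega>|M. unit_count \<omega>) = 1"
  using unit_sum by (simp only: expectation_unit_count)

lemma AE_weights_le_1: "AE \<omega> in M. \<forall>w\<in>lists {..<b}. \<forall>i<b. cmod (tree \<omega> w i) \<le> 1"
proof (rule AE_all_vertices[OF weights_le_1])
  have "{z \<in> space (weight_space b). \<forall>i\<in>{..<b}. cmod (z i) \<le> 1} \<in> sets (weight_space b)"
    by (intro sets.sets_Collect_finite_All) auto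
  thus "{z \<in> space (weight_space b). \<forall>i<b. cmod (z i) \<le> 1} \<in> sets (weight_space b)"
    by (simp only: Ball_def lessThan_iff)
qed

text \<open>
  The expected number of children with weight of modulus 1 and descendants in \<open>E\<close> is the probability of
  \<open>E\<close> itself. If \<open>E\<close> requires such a child, this union bound must be sharp, but two such children occur
  together with probability at least \<open>\<rho> u\<^sup>2\<close>, where \<open>u\<close> is the probability of \<open>E\<close> and \<open>\<rho> > 0\<close> that of two given
  root weights having modulus 1.
\<close>

lemma null_of_unit_branches:
  assumes E: "E \<in> sets (tree_space b)"
    and cover: "AE \<omega> in M. tree \<omega> \<in> E \<longrightarrow> (\<exists>i<b. cmod (V [] \<omega> i) = 1 \<and> branch i \<omega> \<in> E)"
  shows "\<P>(\<omega> in M. tree \<omega> \<in> E) = 0"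
proof -
  let ?u = "\<P>(\<omega> in M. tree \<omega> \<in> E)"
  obtain i j where ij: "i < b" "j < b" "i \<noteq> j"
    and \<rho>: "0 < \<P>(\<omega> in M. cmod (V [] \<omega> i) = 1 \<and> cmod (V [] \<omega> j) = 1)" (is "0 < ?\<rho>")
    using two_unit_weights[OF unit_expectation nondegenerate] by blast
  let ?A = "\<lambda>i. {\<omega> \<in> space M. cmod (V [] \<omega> i) = 1 \<and> branch i \<omega> \<in> E}"
  have ev: "?A i \<in> events" if "i < b" for i
    using that by (intro root_branch_event unit_set E)
  have "?u \<le> prob (\<Union>i\<in>{..<b}. ?A i)"
  proof (rule finite_measure_mono_AE)
    show "AE \<omega> in M. \<omega> \<in> {\<omega> \<in> space M. tree \<omega> \<in> E} \<longrightarrow> \<omega> \<in> (\<Union>i\<in>{..<b}. ?A i)"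
      using cover by eventually_elim auto
    show "(\<Union>i\<in>{..<b}. ?A i) \<in> events" using ev by (intro sets.finite_UN) auto
  qed
  moreover have "prob (\<Union>i\<in>{..<b}. ?A i) + prob (?A i \<inter> ?A j) \<le> (\<Sum>i<b. prob (?A i))"
    using ij ev by (intro prob_union_le_minus_pair) auto
  moreover have "(\<Sum>i<b. prob (?A i)) = (\<Sum>i<b. \<P>(\<omega> in M. cmod (V [] \<omega> i) = 1) * ?u)"
    by (intro sum.cong refl prob_root_branch_pred unit_set E) auto
  moreover have "\<dots> = ?u" using unit_sum by (simp add: sum_distrib_right[symmetric])
  moreover have "prob (?A i \<inter> ?A j) = ?\<rho> * ?u\<^sup>2"
  proof -
    have "?A i \<inter> ?A j = {\<omega> \<in> space M. (cmod (V [] \<omega> i) = 1 \<and> cmod (V [] \<omega> j) = 1) \<and> branch i \<omega> \<in> E \<and> branch j \<omega> \<in> E}"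
      by auto
    moreover have "{z \<in> space (weight_space b). cmod (z i) = 1 \<and> cmod (z j) = 1} \<in> sets (weight_space b)"
      by (intro sets.sets_Collect_conj unit_set ij)
    ultimately show ?thesis 
      using prob_root_two_branches_pred[OF _ E ij, of "\<lambda>z. cmod (z i) = 1 \<and> cmod (z j) = 1"] by simp
  qed
  ultimately have "?\<rho> * ?u\<^sup>2 \<le> 0" by linarith
  hence "?u\<^sup>2 \<le> 0" using \<rho> by (simp add: mult_le_0_iff)
  thus ?thesis by simp
qed

text \<open>
  Induction on \<open>k\<close>. To exceed \<open>\<gamma>\<close> to the power \<open>k + 1\<close> through a weight of modulus at most \<open>\<gamma>\<close>, the
  descendants would have to exceed \<open>\<gamma>\<^sup>k\<close>, which is excluded; so \<open>null_of_unit_branches\<close> applies. The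
  child may a priori depend on the generation; monotonicity along branches makes it uniform.
\<close>

lemma no_survival:
  assumes \<gamma>: "0 < \<gamma>" "\<gamma> < 1"
    and alt: "AE \<omega> in M. \<forall>i<b. cmod (V [] \<omega> i) \<le> \<gamma> \<or> cmod (V [] \<omega> i) = 1"
  shows "\<P>(\<omega> in M. tree \<omega> \<in> surviving_trees b (\<gamma> ^ k)) = 0"
proof (induction k)
  case 0
  have "{\<omega> \<in> space M. tree \<omega> \<in> surviving_trees b (\<gamma> ^ 0)} = {}"
    by (auto simp: surviving_trees_def intro!: exI[of _ "0::nat"])
  thus ?case by (simp only: measure_empty)
next
  case (Suc k)
  have "AE \<omega> in M. tree \<omega> \<in> - surviving_trees b (\<gamma> ^ k) \<inter> space (tree_space b)"
    using AE_space AE_not_in_null_tree_event[OF surviving_trees_sets Suc]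
    by eventually_elim (simp add: tree_in_space)
  moreover have "- surviving_trees b (\<gamma> ^ k) \<inter> space (tree_space b) \<in> sets (tree_space b)"
    by (metis surviving_trees_sets sets.compl_sets Compl_eq_Diff_UNIV Diff_eq inf_commute)
  ultimately have "AE \<omega> in M. branch i \<omega> \<in> - surviving_trees b (\<gamma> ^ k) \<inter> space (tree_space b)" if "i < b" for i
    using that by (rule AE_branch)
  hence "AE \<omega> in M. \<forall>i\<in>{..<b}. branch i \<omega> \<in> - surviving_trees b (\<gamma> ^ k) \<inter> space (tree_space b)"
    by (intro AE_finite_allI) auto
  with alt AE_weights_le_1
  have "AE \<omega> in M. tree \<omega> \<in> surviving_trees b (\<gamma> ^ Suc k) \<longrightarrow>
      (\<exists>i<b. cmod (V [] \<omega> i) = 1 \<and> branch i \<omega> \<in> surviving_trees b (\<gamma> ^ Suc k))"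
  proof eventually_elim
    case (elim \<omega>)
    let ?y = "\<gamma> ^ Suc k"
    show ?case
    proof (rule impI, rule ccontr)
      assume surv: "tree \<omega> \<in> surviving_trees b ?y"
        and no: "\<not> (\<exists>i<b. cmod (V [] \<omega> i) = 1 \<and> branch i \<omega> \<in> surviving_trees b ?y)"
      have "\<exists>n. \<forall>v\<in>words b n. cmod (V [] \<omega> i) * cmod (path_weight v (branch i \<omega>)) \<le> ?y" if i: "i < b" for i
      proof (cases "cmod (V [] \<omega> i) = 1")
        case True
        hence "branch i \<omega> \<notin> surviving_trees b ?y" using no i by blast
        moreover have "branch i \<omega> \<in> space (tree_space b)" using elim i by auto
        ultimately obtain n where "\<forall>v\<in>words b n. cmod (path_weight v (branch i \<omega>)) \<le> ?y"
          unfolding surviving_trees_def by (auto simp: not_less)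
        thus ?thesis using True by auto
      next
        case False
        hence small: "cmod (V [] \<omega> i) \<le> \<gamma>" using elim i by blast
        have "branch i \<omega> \<in> space (tree_space b)" "branch i \<omega> \<notin> surviving_trees b (\<gamma> ^ k)" using elim i by auto
        then obtain n where "\<forall>v\<in>words b n. cmod (path_weight v (branch i \<omega>)) \<le> \<gamma> ^ k"
          unfolding surviving_trees_def by (auto simp: not_less)
        hence "\<forall>v\<in>words b n. cmod (V [] \<omega> i) * cmod (path_weight v (branch i \<omega>)) \<le> \<gamma> * \<gamma> ^ k"
          using small \<gamma> by (auto intro!: mult_mono)
        thus ?thesis by auto
      qed
      then obtain N where N: "\<And>i. i < b \<Longrightarrow>
          \<forall>v\<in>words b (N i). cmod (V [] \<omega> i) * cmod (path_weight v (branch i \<omega>)) \<le> ?y" by metis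
      \<comment> \<open>A generation beyond all \<open>N i\<close>.\<close>
      define m where "m = (\<Sum>i<b. N i)"
      have m: "N i \<le> m" if "i < b" for i unfolding m_def using that by (intro member_le_sum) auto
      obtain v where "v \<in> words b (Suc m)" "?y < cmod (path_weight v (tree \<omega>))"
        using surv unfolding surviving_trees_def by blast
      then obtain i u where v: "v = i # u" "i < b" "u \<in> words b m" and
        big: "?y < cmod (V [] \<omega> i) * cmod (path_weight u (branch i \<omega>))"
        by (auto elim!: words_Suc_cases simp: norm_mult)
      hence nz: "0 < cmod (V [] \<omega> i)" using \<gamma> by (metis norm_ge_zero less_eq_real_def mult_zero_left not_less zero_le_power)
      have "\<forall>v\<in>words b m. cmod (path_weight v (branch i \<omega>)) \<le> ?y / cmod (V [] \<omega> i)"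
      proof (rule level_bound_antimono[OF _ _ m[OF v(2)]])
        show "cmod (branch i \<omega> w j) \<le> 1" if "w \<in> lists {..<b}" "j < b" for w j
          using elim(2) v(2) that by (simp add: subtree_def)
        show "\<forall>v\<in>words b (N i). cmod (path_weight v (branch i \<omega>)) \<le> ?y / cmod (V [] \<omega> i)"
          using N[OF v(2)] nz by (simp add: pos_le_divide_eq mult.commute)
      qed
      hence "cmod (V [] \<omega> i) * cmod (path_weight u (branch i \<omega>)) \<le> ?y"
        using v(3) nz by (simp add: pos_le_divide_eq mult.commute)
      thus False using big by simp
    qed
  qed
  thus ?case by (rule null_of_unit_branches[OF surviving_trees_sets])
qed

theorem AE_critical_convergent:
  assumes \<gamma>: "0 < \<gamma>" "\<gamma> < 1" and crit: "AE \<omega> in M. critical_vector b \<gamma> (V [] \<omega>)"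
  shows "AE \<omega> in M. tree \<omega> \<in> convergent_trees b"
proof -
  have "{z \<in> space (weight_space b). \<forall>i\<in>{..<b}. cmod (z i) \<le> \<gamma> \<or>
     cmod (z i) = 1 \<and> ((\<Sum>k<i. z k) = 0 \<and> (\<Sum>k\<le>i. z k) = 1 \<or> (\<Sum>k<i. z k) = 1 \<and> (\<Sum>k\<le>i. z k) = 0)}
     \<in> sets (weight_space b)"
  proof (intro sets.sets_Collect_finite_All)
    fix i assume "i \<in> {..<b}"
    hence [measurable]: "(\<lambda>z. z i) \<in> borel_measurable (weight_space b)"
       "(\<lambda>z. \<Sum>k<i. z k) \<in> borel_measurable (weight_space b)" "(\<lambda>z. \<Sum>k\<le>i. z k) \<in> borel_measurable (weight_space b)"
      by (auto intro!: borel_measurable_sum)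
    show "{z \<in> space (weight_space b). cmod (z i) \<le> \<gamma> \<or>
     cmod (z i) = 1 \<and> ((\<Sum>k<i. z k) = 0 \<and> (\<Sum>k\<le>i. z k) = 1 \<or> (\<Sum>k<i. z k) = 1 \<and> (\<Sum>k\<le>i. z k) = 0)}
     \<in> sets (weight_space b)" by measurable
  qed simp
  hence "{z \<in> space (weight_space b). critical_vector b \<gamma> z} \<in> sets (weight_space b)"
    by (simp add: critical_vector_def Ball_def)
  note all = AE_all_vertices[OF crit this]
  have alt: "AE \<omega> in M. \<forall>i<b. cmod (V [] \<omega> i) \<le> \<gamma> \<or> cmod (V [] \<omega> i) = 1"
    using crit by eventually_elim (auto simp: critical_vector_def)
  have "AE \<omega> in M. \<forall>k. tree \<omega> \<notin> surviving_trees b (\<gamma> ^ k)"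
    unfolding AE_all_countable
    by (intro allI AE_not_in_null_tree_event[OF surviving_trees_sets] no_survival[OF \<gamma> alt])
  with AE_space AE_conservative all show ?thesis
  proof eventually_elim
    case (elim \<omega>)
    have "uniformly_convergent_on {0..1} (\<lambda>n. tree_cascade b n (tree \<omega>))"
    proof (rule tree_cascade_critical_convergent[OF elim(2,3) \<gamma> b_pos])
      fix \<epsilon> :: real assume "0 < \<epsilon>"
      then obtain k where k: "\<gamma> ^ k < \<epsilon>" using real_arch_pow_inv[of \<epsilon> \<gamma>] \<gamma> by blast
      have "tree \<omega> \<notin> surviving_trees b (\<gamma> ^ k)" using elim by blast
      then obtain n where "\<forall>v\<in>words b n. cmod (path_weight v (tree \<omega>)) \<le> \<gamma> ^ k"
        using tree_in_space[OF elim(1)] by (auto simp: surviving_trees_def not_less)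
      thus "\<exists>n. \<forall>v\<in>words b n. cmod (path_weight v (tree \<omega>)) \<le> \<epsilon>" using k by (meson less_imp_le order_trans)
    qed
    thus ?case using tree_in_space[OF elim(1)] by (simp add: convergent_trees_def)
  qed
qed

text \<open>
  If \<open>K\<close> is finite, it is finite for every child with a nonzero weight. There is always such a child, and
  with probability \<open>\<rho> > 0\<close> there are two given ones, so \<open>h \<le> \<rho> h\<^sup>2 + (1 - \<rho>) h\<close> for the probability \<open>h\<close> that
  \<open>K\<close> is finite; this leaves only 0 and 1.
\<close>

lemma unbounded_zero_one:
  assumes \<beta>: "1 < \<beta>"
  shows "\<P>(\<omega> in M. tree \<omega> \<in> unbounded_trees b \<beta>) \<in> {0, 1}"
proof -
  define H where "H = space (tree_space b) - unbounded_trees b \<beta>"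
  have H: "H \<in> sets (tree_space b)" unfolding H_def by (intro sets.compl_sets unbounded_trees_sets)
  let ?h = "\<P>(\<omega> in M. tree \<omega> \<in> H)"
  obtain i j where ij: "i < b" "j < b" "i \<noteq> j"
    and \<rho>: "0 < \<P>(\<omega> in M. cmod (V [] \<omega> i) = 1 \<and> cmod (V [] \<omega> j) = 1)"
    using two_unit_weights[OF unit_expectation nondegenerate] by blast
  let ?B = "\<lambda>z. cmod (z i) = 1 \<and> cmod (z j) = 1"
  \<comment> \<open>Off the event \<open>?B\<close> the outcomes are classified by the first child with a nonzero weight.\<close>
  let ?R = "\<lambda>k z. \<not> ?B z \<and> z k \<noteq> 0 \<and> (\<forall>l\<in>{..<k}. z l = (0::complex))"
  let ?\<rho> = "\<P>(\<omega> in M. ?B (V [] \<omega>))"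
  have Bm: "{z \<in> space (weight_space b). ?B z} \<in> sets (weight_space b)"
    by (intro sets.sets_Collect_conj unit_set ij)
  have Rm: "{z \<in> space (weight_space b). ?R k z} \<in> sets (weight_space b)" if "k < b" for k
  proof (intro sets.sets_Collect_conj sets.sets_Collect_neg Bm unit_set ij sets.sets_Collect_finite_All)
    show "{z \<in> space (weight_space b). z k = 0} \<in> sets (weight_space b)" using that by measurable
    show "{z \<in> space (weight_space b). z l = 0} \<in> sets (weight_space b)" if "l \<in> {..<k}" for l
    proof -
      have "l < b" using that \<open>k < b\<close> by simp
      thus ?thesis by measurable
    qed
  qed simp
  let ?D = "{\<omega> \<in> space M. ?B (V [] \<omega>) \<and> branch i \<omega> \<in> H \<and> branch j \<omega> \<in> H}"
  let ?C = "\<lambda>k. {\<omega> \<in> space M. ?R k (V [] \<omega>) \<and> branch k \<omega> \<in> H}"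
  have Dev: "?D \<in> events" by (intro sets.sets_Collect_conj root_event_measurable branch_event_measurable Bm H ij unit_set)
  have Cev: "?C k \<in> events" if "k < b" for k by (rule root_branch_event[OF Rm[OF that] H that])
  have "\<not> (?R m z \<and> ?R n z)" if "m \<noteq> n" for m n and z :: "nat \<Rightarrow> complex"
    using that by (cases m n rule: linorder_cases) auto
  hence dis: "disjoint_family_on (\<lambda>k. {\<omega> \<in> space M. ?R k (V [] \<omega>)}) {..<b}"
    unfolding disjoint_family_on_def by blast
  have Rev: "{\<omega> \<in> space M. ?R k (V [] \<omega>)} \<in> events" if "k < b" for k by (rule root_event_measurable[OF Rm[OF that]])
  have "(\<Sum>k<b. \<P>(\<omega> in M. ?R k (V [] \<omega>))) = prob (\<Union>k\<in>{..<b}. {\<omega> \<in> space M. ?R k (V [] \<omega>)})"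
    by (rule finite_measure_finite_Union[symmetric, OF finite_lessThan _ dis]) (use Rev in blast)
  also have "\<dots> \<le> prob (space M - {\<omega> \<in> space M. ?B (V [] \<omega>)})"
    by (intro finite_measure_mono sets.compl_sets root_event_measurable Bm) auto
  also have "\<dots> = 1 - ?\<rho>" by (intro prob_compl root_event_measurable Bm)
  finally have sumR: "(\<Sum>k<b. \<P>(\<omega> in M. ?R k (V [] \<omega>))) \<le> 1 - ?\<rho>" .
  have "?h \<le> prob (?D \<union> (\<Union>k\<in>{..<b}. ?C k))"
  proof (rule finite_measure_mono_AE)
    show "?D \<union> (\<Union>k\<in>{..<b}. ?C k) \<in> events" using Dev Cev by (intro sets.Un sets.finite_UN) auto
    show "AE \<omega> in M. \<omega> \<in> {\<omega> \<in> space M. tree \<omega> \<in> H} \<longrightarrow> \<omega> \<in> ?D \<union> (\<Union>k\<in>{..<b}. ?C k)"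
      using sum_weights
    proof eventually_elim
      case (elim \<omega>)
      show ?case
      proof
        assume a: "\<omega> \<in> {\<omega> \<in> space M. tree \<omega> \<in> H}"
        have sub: "branch k \<omega> \<in> H" if "k < b" "V [] \<omega> k \<noteq> 0" for k
          using unbounded_trees_of_branch[OF _ that(1) \<beta>, of "tree \<omega>"] a that
            measurable_space[OF measurable_branch[OF that(1)]] by (auto simp: H_def)
        show "\<omega> \<in> ?D \<union> (\<Union>k\<in>{..<b}. ?C k)"
        proof (cases "?B (V [] \<omega>)")
          case True
          hence "V [] \<omega> i \<noteq> 0" "V [] \<omega> j \<noteq> 0" by auto
          thus ?thesis using True sub ij a by auto
        next
          case False
          have ex: "\<exists>k. k < b \<and> V [] \<omega> k \<noteq> 0" using elim by (metis lessThan_iff sum.neutral zero_neq_one)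
          define k where "k = (LEAST k. k < b \<and> V [] \<omega> k \<noteq> 0)"
          have k: "k < b" "V [] \<omega> k \<noteq> 0" using LeastI_ex[OF ex] by (auto simp: k_def)
          have "V [] \<omega> l = 0" if "l < k" for l
            using not_less_Least[of l "\<lambda>k. k < b \<and> V [] \<omega> k \<noteq> 0"] that k(1) by (auto simp: k_def)
          hence "\<omega> \<in> ?C k" using k False sub a by auto
          thus ?thesis using k by blast
        qed
      qed
    qed
  qed
  also have "\<dots> \<le> prob ?D + prob (\<Union>k\<in>{..<b}. ?C k)"
    using Dev Cev by (intro measure_Un_le sets.finite_UN) auto
  also have "prob ?D = ?\<rho> * ?h\<^sup>2" using prob_root_two_branches_pred[OF Bm H ij] by simp
  also have "prob (\<Union>k\<in>{..<b}. ?C k) \<le> (\<Sum>k<b. prob (?C k))"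
    using Cev by (intro finite_measure_subadditive_finite) auto
  also have "(\<Sum>k<b. prob (?C k)) = (\<Sum>k<b. \<P>(\<omega> in M. ?R k (V [] \<omega>)) * ?h)"
    by (intro sum.cong refl prob_root_branch_pred Rm H) auto
  also have "\<dots> \<le> (1 - ?\<rho>) * ?h"
    unfolding sum_distrib_right[symmetric] by (intro mult_right_mono sumR) simp
  finally have "?\<rho> * (?h * (1 - ?h)) \<le> 0" by (simp add: algebra_simps power2_eq_square)
  hence "?h * (1 - ?h) \<le> 0" using \<rho> by (simp add: mult_le_0_iff)
  moreover have "0 \<le> ?h" "?h \<le> 1" by auto
  ultimately have h: "?h = 0 \<or> ?h = 1" by (auto simp: mult_le_0_iff)
  have "{\<omega> \<in> space M. tree \<omega> \<in> H} = space M - {\<omega> \<in> space M. tree \<omega> \<in> unbounded_trees b \<beta>}"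
    using tree_in_space by (auto simp: H_def)
  hence "?h = 1 - \<P>(\<omega> in M. tree \<omega> \<in> unbounded_trees b \<beta>)"
    by (simp only: prob_compl[OF tree_event_measurable[OF unbounded_trees_sets]])
  thus ?thesis using h by auto
qed

lemma intermediate_weight:
  "\<exists>i<b. \<exists>\<delta>>0. 0 < \<P>(\<omega> in M. \<delta> \<le> cmod (V [] \<omega> i) \<and> cmod (V [] \<omega> i) < 1)"
proof (rule ccontr)
  assume *: "\<not> ?thesis"
  have null: "AE \<omega> in M. \<not> (1 / real (Suc k) \<le> cmod (V [] \<omega> i) \<and> cmod (V [] \<omega> i) < 1)" if i: "i < b" for i k
  proof -
    have ev: "{\<omega> \<in> space M. 1 / real (Suc k) \<le> cmod (V [] \<omega> i) \<and> cmod (V [] \<omega> i) < 1} \<in> events"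
      using i by measurable
    have "(0::real) < 1 / real (Suc k)" by simp
    hence "prob {\<omega> \<in> space M. 1 / real (Suc k) \<le> cmod (V [] \<omega> i) \<and> cmod (V [] \<omega> i) < 1} = 0"
      using * i zero_less_measure_iff by blast
    from prob_eq_0[OF ev, THEN iffD1, OF this] show ?thesis by (auto elim: AE_mp intro: AE_I2)
  qed
  have "AE \<omega> in M. \<forall>i\<in>{..<b}. \<forall>k. \<not> (1 / real (Suc k) \<le> cmod (V [] \<omega> i) \<and> cmod (V [] \<omega> i) < 1)"
  proof (rule AE_finite_allI)
    fix i assume "i \<in> {..<b}"
    thus "AE \<omega> in M. \<forall>k. \<not> (1 / real (Suc k) \<le> cmod (V [] \<omega> i) \<and> cmod (V [] \<omega> i) < 1)"
      unfolding AE_all_countable using null by blast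
  qed simp
  with weights_le_1 have "AE \<omega> in M. \<forall>i<b. cmod (V [] \<omega> i) = 0 \<or> cmod (V [] \<omega> i) = 1"
  proof eventually_elim
    case (elim \<omega>)
    show ?case
    proof (intro allI impI, rule ccontr)
      fix i assume i: "i < b" and "\<not> (cmod (V [] \<omega> i) = 0 \<or> cmod (V [] \<omega> i) = 1)"
      hence "0 < cmod (V [] \<omega> i)" "cmod (V [] \<omega> i) < 1" using elim(1) by (auto simp: less_le)
      thus False using elim(2) i nat_approx_posE[of "cmod (V [] \<omega> i)"] by (metis lessThan_iff less_imp_le)
    qed
  qed
  thus False using not_all_weights_degenerate[OF unit_expectation nondegenerate] by blast
qed

text \<open>
  The tree exceeds \<open>\<beta>\<close> to the power \<open>n + 1\<close> if a child with weight of modulus 1 exceeds \<open>\<beta>\<^sup>n\<close>, or if the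
  child \<open>i0\<close> has a weight of modulus at least \<open>\<delta>\<close> and exceeds \<open>\<beta>\<close> to the power \<open>n + l\<close>. The former
  contributes \<open>u n\<close> to the sum of the probabilities, as the mean number of weights of modulus 1 is 1; the
  intersections cost at most \<open>(u n)\<^sup>2\<close> for each pair of children.
\<close>

lemma exceeding_recursion:
  assumes \<beta>: "1 < \<beta>" and i0: "i0 < b" and \<delta>: "0 < \<delta>" "1 \<le> \<delta> * \<beta> ^ l"
  shows "\<P>(\<omega> in M. tree \<omega> \<in> exceeding_trees b \<beta> n)
     + \<P>(\<omega> in M. \<delta> \<le> cmod (V [] \<omega> i0) \<and> cmod (V [] \<omega> i0) < 1)
         * \<P>(\<omega> in M. tree \<omega> \<in> exceeding_trees b \<beta> (n + l))
     - (real b)\<^sup>2 * (\<P>(\<omega> in M. tree \<omega> \<in> exceeding_trees b \<beta> n))\<^sup>2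
     \<le> \<P>(\<omega> in M. tree \<omega> \<in> exceeding_trees b \<beta> (Suc n))"
proof -
  let ?E = "exceeding_trees b \<beta>"
  let ?u = "\<lambda>n. \<P>(\<omega> in M. tree \<omega> \<in> ?E n)"
  let ?S = "\<lambda>z. \<delta> \<le> cmod (z i0) \<and> cmod (z i0 :: complex) < 1"
  let ?\<eta> = "\<P>(\<omega> in M. ?S (V [] \<omega>))"
  define A1 where "A1 = (\<lambda>i. {\<omega> \<in> space M. cmod (V [] \<omega> i) = 1 \<and> branch i \<omega> \<in> ?E n})"
  define A2 where "A2 = {\<omega> \<in> space M. ?S (V [] \<omega>) \<and> branch i0 \<omega> \<in> ?E (n + l)}"
  \<comment> \<open>The two events for \<open>i0\<close> are disjoint, so merging them leaves pairs of different children only,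
    to which independence applies.\<close>
  define A where "A = (\<lambda>i. A1 i \<union> (if i = i0 then A2 else {}))"
  have Sm: "{z \<in> space (weight_space b). ?S z} \<in> sets (weight_space b)" using i0 by measurable
  have ev1: "A1 i \<in> events" if "i < b" for i
    unfolding A1_def by (intro root_branch_event unit_set exceeding_trees_sets that)
  have ev2: "A2 \<in> events"
    unfolding A2_def by (intro root_branch_event[OF Sm] exceeding_trees_sets i0)
  have ev: "A i \<in> events" if "i < b" for i using ev1[OF that] ev2 by (auto simp: A_def)
  have pA: "prob (A i) = \<P>(\<omega> in M. cmod (V [] \<omega> i) = 1) * ?u n + (if i = i0 then ?\<eta> * ?u (n + l) else 0)"
    if i: "i < b" for i
  proof -
    have p1: "prob (A1 i) = \<P>(\<omega> in M. cmod (V [] \<omega> i) = 1) * ?u n"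
      unfolding A1_def by (rule prob_root_branch_pred[OF unit_set[OF i] exceeding_trees_sets i])
    have p2: "prob A2 = ?\<eta> * ?u (n + l)"
      unfolding A2_def by (rule prob_root_branch_pred[OF Sm exceeding_trees_sets i0])
    have "A1 i0 \<inter> A2 = {}" by (auto simp: A1_def A2_def)
    hence "prob (A1 i0 \<union> A2) = prob (A1 i0) + prob A2"
      using ev1[OF i0] ev2 by (intro finite_measure_Union)
    thus ?thesis using p1 p2 by (auto simp: A_def)
  qed
  have "(\<Sum>i<b. prob (A i)) = (\<Sum>i<b. \<P>(\<omega> in M. cmod (V [] \<omega> i) = 1) * ?u n + (if i = i0 then ?\<eta> * ?u (n + l) else 0))"
    by (intro sum.cong refl pA) simp
  also have "\<dots> = (\<Sum>i<b. \<P>(\<omega> in M. cmod (V [] \<omega> i) = 1)) * ?u n + ?\<eta> * ?u (n + l)"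
    using i0 by (simp add: sum.distrib sum_distrib_right)
  finally have sumA: "(\<Sum>i<b. prob (A i)) = ?u n + ?\<eta> * ?u (n + l)" by (simp only: unit_sum mult_1)
  have pair: "prob (A i \<inter> A j) \<le> (?u n)\<^sup>2" if ij: "i < b" "j < b" "i \<noteq> j" for i j
  proof -
    have sub: "A k \<subseteq> {\<omega> \<in> space M. branch k \<omega> \<in> ?E n}" for k
      using exceeding_trees_decseq[OF \<beta>, of n "n + l" b] by (auto simp: A_def A1_def A2_def split: if_splits)
    have "prob (A i \<inter> A j) \<le> \<P>(\<omega> in M. True \<and> branch i \<omega> \<in> ?E n \<and> branch j \<omega> \<in> ?E n)"
    proof (rule finite_measure_mono)
      show "A i \<inter> A j \<subseteq> {\<omega> \<in> space M. True \<and> branch i \<omega> \<in> ?E n \<and> branch j \<omega> \<in> ?E n}"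
        using sub[of i] sub[of j] by blast
      show "{\<omega> \<in> space M. True \<and> branch i \<omega> \<in> ?E n \<and> branch j \<omega> \<in> ?E n} \<in> events"
        using branch_event_measurable[OF exceeding_trees_sets] ij by (intro sets.sets_Collect_conj sets.sets_Collect_const)
    qed
    also have "\<dots> = (?u n)\<^sup>2"
      using prob_root_two_branches_pred[OF _ exceeding_trees_sets ij, of "\<lambda>_. True"] by (simp add: prob_space)
    finally show ?thesis .
  qed
  have "(\<Sum>i<b. prob (A i)) - (real (card {..<b}))\<^sup>2 * (?u n)\<^sup>2 \<le> prob (\<Union>i\<in>{..<b}. A i)"
    using ev pair by (intro prob_union_ge) auto
  also have "\<dots> \<le> ?u (Suc n)"
  proof (rule finite_measure_mono[OF _ tree_event_measurable[OF exceeding_trees_sets]], safe)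
    fix \<omega> i assume i: "i < b" and \<omega>: "\<omega> \<in> A i"
    hence sp: "\<omega> \<in> space M" by (auto simp: A_def A1_def A2_def split: if_splits)
    thus "\<omega> \<in> space M" .
    consider "\<omega> \<in> A1 i" | "i = i0" "\<omega> \<in> A2" using \<omega> by (auto simp: A_def split: if_splits)
    thus "tree \<omega> \<in> ?E (Suc n)"
    proof cases
      case 1
      thus ?thesis using \<beta>
        by (intro exceeding_trees_of_branch[OF tree_in_space[OF sp] i, of \<beta> n]) (auto simp: A1_def)
    next
      case 2
      hence w: "\<delta> \<le> cmod (V [] \<omega> i0)" "branch i0 \<omega> \<in> ?E (n + l)" by (auto simp: A2_def)
      have "1 \<le> cmod (V [] \<omega> i0) * \<beta> ^ l"
        using \<delta>(2) w(1) \<beta> by (intro order_trans[OF _ mult_right_mono[OF w(1)]]) auto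
      hence "\<beta> ^ Suc n * 1 \<le> \<beta> ^ Suc n * (cmod (V [] \<omega> i0) * \<beta> ^ l)"
        using \<beta> by (intro mult_left_mono) auto
      also have "\<dots> = cmod (tree \<omega> [] i0) * \<beta> ^ Suc (n + l)" by (simp add: power_add)
      finally show ?thesis using w \<delta> \<beta>
        by (intro exceeding_trees_of_branch[OF tree_in_space[OF sp] i0, of \<beta> "n + l"]) auto
    qed
  qed
  finally show ?thesis by (simp add: sumA)
qed

text \<open>
  A letter whose weight has modulus 1 with positive probability may be repeated \<open>n + 1\<close> times.
\<close>

lemma exceeding_positive:
  assumes \<beta>: "1 < \<beta>"
  shows "0 < \<P>(\<omega> in M. tree \<omega> \<in> exceeding_trees b \<beta> n)"
proof -
  obtain i where i: "i < b" and \<rho>: "0 < \<P>(\<omega> in M. cmod (V [] \<omega> i) = 1)"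
  proof -
    have "\<exists>i<b. \<P>(\<omega> in M. cmod (V [] \<omega> i) = 1) \<noteq> 0"
      using unit_sum by (metis (no_types, lifting) lessThan_iff sum.neutral zero_neq_one)
    thus ?thesis using that zero_less_measure_iff by blast
  qed
  show ?thesis
  proof (induction n)
    case 0
    have "{\<omega> \<in> space M. cmod (V [] \<omega> i) = 1} \<subseteq> {\<omega> \<in> space M. tree \<omega> \<in> exceeding_trees b \<beta> 0}"
      using i \<beta> tree_in_space by (auto simp: exceeding_trees_def intro!: bexI[of _ "[i]"])
    from finite_measure_mono[OF this tree_event_measurable[OF exceeding_trees_sets]] \<rho>
    show ?case by linarith
  next
    case (Suc n)
    have "{\<omega> \<in> space M. cmod (V [] \<omega> i) = 1 \<and> branch i \<omega> \<in> exceeding_trees b \<beta> n}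
        \<subseteq> {\<omega> \<in> space M. tree \<omega> \<in> exceeding_trees b \<beta> (Suc n)}"
      using \<beta> by (auto intro!: exceeding_trees_of_branch[OF tree_in_space i, of _ \<beta> n])
    from finite_measure_mono[OF this tree_event_measurable[OF exceeding_trees_sets]]
    have "\<P>(\<omega> in M. cmod (V [] \<omega> i) = 1) * \<P>(\<omega> in M. tree \<omega> \<in> exceeding_trees b \<beta> n)
       \<le> \<P>(\<omega> in M. tree \<omega> \<in> exceeding_trees b \<beta> (Suc n))"
      using prob_root_branch_pred[OF unit_set[OF i] exceeding_trees_sets i] by simp
    moreover have "0 < \<P>(\<omega> in M. cmod (V [] \<omega> i) = 1) * \<P>(\<omega> in M. tree \<omega> \<in> exceeding_trees b \<beta> n)"
      using \<rho> Suc by simp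
    ultimately show ?case by linarith
  qed
qed

theorem AE_unbounded:
  assumes \<beta>: "1 < \<beta>"
  shows "AE \<omega> in M. tree \<omega> \<in> unbounded_trees b \<beta>"
proof -
  define u where "u = (\<lambda>n. \<P>(\<omega> in M. tree \<omega> \<in> exceeding_trees b \<beta> n))"
  let ?p = "\<P>(\<omega> in M. tree \<omega> \<in> unbounded_trees b \<beta>)"
  have "?p \<noteq> 0"
  proof
    assume zero: "?p = 0"
    obtain i0 \<delta> where i0: "i0 < b" and \<delta>: "0 < \<delta>"
      and \<eta>: "0 < \<P>(\<omega> in M. \<delta> \<le> cmod (V [] \<omega> i0) \<and> cmod (V [] \<omega> i0) < 1)"
      using intermediate_weight by blast
    obtain l where "1 / \<delta> < \<beta> ^ l" using real_arch_pow[OF \<beta>] by blast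
    hence l: "1 \<le> \<delta> * \<beta> ^ l" using \<delta> by (simp add: field_simps)
    show False
    proof (rule no_slowly_decaying_sequence[of u])
      show "0 < u n" for n unfolding u_def by (rule exceeding_positive[OF \<beta>])
      show "u (Suc n) \<le> u n" for n
        unfolding u_def using exceeding_trees_decseq[OF \<beta>, of n "Suc n" b]
        by (intro finite_measure_mono tree_event_measurable exceeding_trees_sets) auto
      have "(\<lambda>n. prob {\<omega> \<in> space M. tree \<omega> \<in> exceeding_trees b \<beta> n})
          \<longlonglongrightarrow> prob (\<Inter>n. {\<omega> \<in> space M. tree \<omega> \<in> exceeding_trees b \<beta> n})"
      proof (rule finite_Lim_measure_decseq)
        show "range (\<lambda>n. {\<omega> \<in> space M. tree \<omega> \<in> exceeding_trees b \<beta> n}) \<subseteq> events"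
          using tree_event_measurable[OF exceeding_trees_sets] by blast
        show "decseq (\<lambda>n. {\<omega> \<in> space M. tree \<omega> \<in> exceeding_trees b \<beta> n})"
          using exceeding_trees_decseq[OF \<beta>] unfolding decseq_def by blast
      qed
      also have "(\<Inter>n. {\<omega> \<in> space M. tree \<omega> \<in> exceeding_trees b \<beta> n}) =
          {\<omega> \<in> space M. tree \<omega> \<in> unbounded_trees b \<beta>}"
        by (auto simp: unbounded_trees_def)
      finally show "u \<longlonglongrightarrow> 0" by (simp add: zero u_def)
      show "u n + \<P>(\<omega> in M. \<delta> \<le> cmod (V [] \<omega> i0) \<and> cmod (V [] \<omega> i0) < 1) * u (n + l) - (real b)\<^sup>2 * (u n)\<^sup>2
          \<le> u (Suc n)" for n
        unfolding u_def by (rule exceeding_recursion[OF \<beta> i0 \<delta> l])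
    qed (use \<eta> in auto)
  qed
  hence "?p = 1" using unbounded_zero_one[OF \<beta>] by blast
  from AE_prob_1[OF this] show ?thesis by eventually_elim simp
qed

theorem AE_not_holder:
  assumes conv: "AE \<omega> in M. tree \<omega> \<in> convergent_trees b"
  shows "AE \<omega> in M. \<forall>\<alpha>>0. \<not> holder_on \<alpha> {0..1} (limit_process \<omega>)"
proof -
  have \<beta>: "1 < real b powr (1 / real (Suc k))" for k using b2 by (intro gr_one_powr) auto
  have "AE \<omega> in M. \<forall>k. tree \<omega> \<in> unbounded_trees b (real b powr (1 / real (Suc k)))"
    unfolding AE_all_countable using AE_unbounded[OF \<beta>] by blast
  with conv AE_conservative show ?thesis
  proof eventually_elim
    case (elim \<omega>)
    show ?case
    proof (intro allI impI notI)
      fix \<alpha> :: real assume "0 < \<alpha>" and h: "holder_on \<alpha> {0..1} (limit_process \<omega>)"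
      then obtain k where "1 / real (Suc k) < \<alpha>" using nat_approx_posE by blast
      hence h': "holder_on (1 / real (Suc k)) {0..1} (limit_process \<omega>)"
        by (intro holder_on_mono[OF h]) simp
      have lim: "(\<lambda>n. tree_cascade b n (tree \<omega>) t) \<longlonglongrightarrow> limit_process \<omega> t" if "t \<in> {0..1}" for t
        unfolding limit_process_def by (rule limit_cascade_LIMSEQ[OF elim(1) that])
      obtain C where "\<And>n v. v \<in> words b n \<Longrightarrow>
          cmod (path_weight v (tree \<omega>)) * (real b powr (1 / real (Suc k))) ^ n \<le> C"
        using path_weight_bound_of_holder[OF elim(2) b_pos lim h'] by blast
      from not_unbounded_of_bound[OF \<beta> this] elim(3) show False by blast
    qed
  qed
qed

end

section \<open>Convergence and regularity of the cascade\<close>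

theorem theorem2p2:
  fixes M :: "'a measure" and b :: nat
    and V :: "nat list \<Rightarrow> 'a \<Rightarrow> nat \<Rightarrow> complex" and W :: "'a \<Rightarrow> nat \<Rightarrow> complex"
  assumes "prob_space M" and "b \<ge> 2"
    and "prob_space.indep_vars M (\<lambda>_. weight_space b) V (lists {..<b})"
    and "\<forall>w\<in>lists {..<b}. distr M (weight_space b) (V w) = distr M (weight_space b) W"
    and "W = V []"
    and "\<forall>i<b. integrable M (\<lambda>\<omega>. W \<omega> i)"
    and "(LINT \<omega>|M. (\<Sum>i<b. W \<omega> i)) = 1"
    and "\<P>(\<omega> in M. (\<Sum>i<b. W \<omega> i) = 1) = 1"
  shows
    "(\<forall>p>1. phi M b W p > 0 \<longrightarrow>
       (\<exists>F. random_function M F \<and>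
          (AE \<omega> in M. uniform_limit {0..1} (\<lambda>n. cascade b V n \<omega>) (F \<omega>) sequentially) \<and>
          ((\<lambda>n. \<integral>\<^sup>+\<omega>. ennreal (sup_norm (\<lambda>t. cascade b V n \<omega> t - F \<omega> t) powr p) \<partial>M)
             \<longlonglongrightarrow> 0) \<and>
          ((AE \<omega> in M. \<forall>i<b. W \<omega> i \<in> \<real>\<^sub>\<ge>\<^sub>0) \<longrightarrow>
             (AE \<omega> in M. F \<omega> ` {0..1} \<subseteq> \<real> \<and> mono_on {0..1} (\<lambda>t. Re (F \<omega> t)))) \<and>
          (\<exists>q\<in>{1<..p}. (\<forall>r\<in>{1<..p}. phi M b W r / ereal r \<le> phi M b W q / ereal q) \<and>
             (AE \<omega> in M. \<forall>\<gamma>. 0 < \<gamma> \<and> ereal \<gamma> < phi M b W q / ereal q \<longrightarrow>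
                holder_on \<gamma> {0..1} (F \<omega>))) \<and>
          scaling_property M b W F))
     \<and>
     ((phi M b W \<longlongrightarrow> 0) at_top \<longleftrightarrow>
        \<P>(\<omega> in M. \<forall>i<b. cmod (W \<omega> i) \<le> 1) = 1 \<and>
        (\<Sum>i<b. \<P>(\<omega> in M. cmod (W \<omega> i) = 1)) = 1)
     \<and>
     ((phi M b W \<longlongrightarrow> 0) at_top \<and>
      \<P>(\<omega> in M. card {i. i < b \<and> cmod (W \<omega> i) = 1} = 1) < 1 \<longrightarrow>
        strict_mono_on {0..} (phi M b W) \<and>
        (\<forall>p>1. phi M b W p < 0) \<and>
        (\<forall>\<gamma>. 0 < \<gamma> \<and> \<gamma> < 1 \<and>
           (AE \<omega> in M. \<forall>i<b.
              cmod (W \<omega> i) \<le> \<gamma> \<or>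
              cmod (W \<omega> i) = 1 \<and>
              ((\<Sum>k<i. W \<omega> k), (\<Sum>k\<le>i. W \<omega> k)) \<in> {(0, 1), (1, 0)}) \<longrightarrow>
           (\<exists>F. random_function M F \<and>
              (AE \<omega> in M. uniform_limit {0..1} (\<lambda>n. cascade b V n \<omega>) (F \<omega>) sequentially) \<and>
              (AE \<omega> in M. \<forall>\<alpha>>0. \<not> holder_on \<alpha> {0..1} (F \<omega>)) \<and>
              scaling_property M b W F)))"
proof -
  interpret prob_space M by fact
  have sum: "AE \<omega> in M. (\<Sum>i<b. W \<omega> i) = 1" using AE_prob_1[OF assms(8)] by eventually_elim simp
  note W = \<open>W = V []\<close>
  interpret cascade_weights M b V
  proof
    show "2 \<le> b" and "indep_vars (\<lambda>_. weight_space b) V (lists {..<b})" by fact+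
    show "distr M (weight_space b) (V w) = distr M (weight_space b) (V [])" if "w \<in> lists {..<b}" for w
      using assms(4) that unfolding W by blast
    show "AE \<omega> in M. (\<Sum>i<b. V [] \<omega> i) = 1" using sum unfolding W .
  qed
  show ?thesis
    unfolding W
  \<comment> \<open>The goals are the moment case, the criterion for \<open>phi\<close> to tend to 0, and the three assertions about
    the critical case: monotonicity of \<open>phi\<close>, its sign, and the behaviour of the limit.\<close>
  proof (intro conjI allI impI, goal_cases)
    case (1 p)
    have p: "0 < p" and mom: "moment p < 1" using 1 moment_less_1_of_phi by auto
    note conv = AE_convergent[OF p mom]
    obtain q where q: "q \<in> {1<..p}"
      "\<forall>r\<in>{1<..p}. phi M b (V []) r / ereal r \<le> phi M b (V []) q / ereal q"
      "AE \<omega> in M. \<forall>\<gamma>. 0 < \<gamma> \<and> ereal \<gamma> < phi M b (V []) q / ereal q \<longrightarrow> holder_on \<gamma> {0..1} (limit_process \<omega>)"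
      using optimal_holder_exponent[OF 1] .
    have "AE \<omega> in M. uniform_limit {0..1} (\<lambda>n. cascade b V n \<omega>) (limit_process \<omega>) sequentially"
      using conv by eventually_elim (rule limit_process_uniform_limit)
    thus ?case
      using random_function_limit_process cascade_Lp_convergence[OF p mom] q
        limit_process_nonneg_mono[OF conv] limit_process_scaling[OF conv]
      by (intro exI[of _ limit_process] conjI impI bexI[of _ q])
  next
    case 2
    show ?case using phi_limit_iff by (simp only: prob_eq_1_bounded_weights)
  next
    case 3
    then interpret critical_cascade M b V
      using phi_limit_iff prob_card_unit_eq_1 by unfold_locales auto
    show ?case by (rule critical_phi_strict_mono[OF weights_le_1 unit_expectation nondegenerate])
  next
    case (4 p)
    then interpret critical_cascade M b V
      using phi_limit_iff prob_card_unit_eq_1 by unfold_locales auto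
    show ?case using 4 by (intro critical_phi_negative[OF weights_le_1 unit_expectation nondegenerate]) simp
  next
    case (5 \<gamma>)
    then interpret critical_cascade M b V
      using phi_limit_iff prob_card_unit_eq_1 by unfold_locales auto
    have conv: "AE \<omega> in M. tree \<omega> \<in> convergent_trees b"
      using 5 by (intro AE_critical_convergent[of \<gamma>]) (auto simp: critical_vector_def)
    have "AE \<omega> in M. uniform_limit {0..1} (\<lambda>n. cascade b V n \<omega>) (limit_process \<omega>) sequentially"
      using conv by eventually_elim (rule limit_process_uniform_limit)
    thus ?case
      using random_function_limit_process AE_not_holder[OF conv] limit_process_scaling[OF conv] by blast
  qed
qed

end
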